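(* Let $\mathcal A$ be an abelian category with enough projective objects and let $M$ be a non-zero object of $\mathcal A$. Then the quasi-projective dimensions and quasi-projective lengths of $M$ defined via quasi-projective resolutions and via quasi-projective filtrations coincide: $$\mathrm{qpd}^{\mathrm{res}}_{\mathcal A}(M)=\mathrm{qpd}^{\mathrm{filt}}_{\mathcal A}(M)\quad\text{and}\quad \mathrm{qpl}^{\mathrm{res}}_{\mathcal A}(M)=\mathrm{qpl}^{\mathrm{filt}}_{\mathcal A}(M).$$
   Context: Complexes are indexed homologically and $[n]$ denotes the $n$-th shift ($H_i(X[n])\cong H_{i-n}(X)$). For a complex $X$ in $\mathcal A$ put $\sup(X)=\sup\{i\mid X_i\ne0\}$, $\inf(X)=\inf\{i\mid X_i\neq0\}$, $\mathrm{hsup}(X)=\sup\{i\mid H_i(X)\neq0\}$. The infimum of the empty set is $\infty$. Definition via resolutions (Gheibi--Jorgensen--Takahashi): a finite quasi-projective resolution of $M$ is a bounded complex $P$ of projective objects of $\mathcal A$ such that, for every $i$, $H_i(P)\cong M^{\oplus a_i}$ for non-negative integers $a_i$, not all zero. Define $$\mathrm{qpd}^{\mathrm{res}}_{\mathcal A}(M)=\inf_P(\sup(P)-\mathrm{hsup}(P)),\qquad \mathrm{qpl}^{\mathrm{res}}_{\mathcal A}(M)=\inf_P(\sup(P)-\inf(P)),$$ over all finite quasi-projective resolutions $P$ of $M$. Definition via filtrations: let $\mathsf D(\mathcal A)$ be the derived category and $\mathsf D_{\mathsf b}(\mathcal A)$ the full subcategory of homologically bounded complexes. $\mathrm{pd}_{\mathcal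 A}(X)$ is the infimum of all integers $n$ such that $X\simeq P$ in $\mathsf D(\mathcal A)$ for some bounded complex $P$ of projective objects with $P_i\cong0$ for all $i>n$. A finite quasi-projective filtration by a non-zero $M\in\mathsf D_{\mathsf b}(\mathcal A)$ is a sequence $\mathbb F=(F^{t+1}\to F^t\to\cdots\to F^{s+1}\to F^s)$ of morphisms in $\mathsf D_{\mathsf b}(\mathcal A)$, with integers $s\le t$, such that $F^{t+1}\cong0$, $\mathrm{Cone}(F^{i+1}\to F^i)\cong M[i]^{\oplus a_i}$ for $i=s,\dots,t$ for some non-negative integers $a_s,\dots,a_t$ with $a_s,a_t>0$, and $F^s$ is non-zero with $\mathrm{pd}_{\mathcal A}(F^s)<\infty$. Define $$\mathrm{qpd}^{\mathrm{filt}}_{\mathcal A}(M)=\inf_{\mathbb F}(\mathrm{pd}_{\mathcal A}(F^s)-t),\qquad \mathrm{qpl}^{\mathrm{filt}}_{\mathcal A}(M)=\inf_{\mathbb F}(\mathrm{pd}_{\mathcal A}(F^s)-s),$$ over all finite quasi-projective filtrations $\mathbb F$ by $M$. An object of $\mathcal A$ is viewed in $\mathsf D_{\mathsf b}(\mathcal A)$ as a complex concentrated in degree $0$. *)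

theory Defs
  imports "HOL-Algebra.Group" "HOL-Library.Extended_Real"
begin

section \<open>Categories\<close>

record ('o, 'm) cat =
  Obj :: "'o set"
  Arr :: "'m set"
  Dom :: "'m \<Rightarrow> 'o"
  Cod :: "'m \<Rightarrow> 'o"
  Idn :: "'o \<Rightarrow> 'm"
  Comp :: "'m \<Rightarrow> 'm \<Rightarrow> 'm" (infixl "\<cdot>\<index>" 70)

definition Hom :: "('o, 'm, 'z) cat_scheme \<Rightarrow> 'o \<Rightarrow> 'o \<Rightarrow> 'm set" where
  "Hom C X Y = {f \<in> Arr C. Dom C f = X \<and> Cod C f = Y}"

locale category =
  fixes C :: "('o, 'm, 'z) cat_scheme" (structure)
  assumes Dom_Obj: "f \<in> Arr C \<Longrightarrow> Dom C f \<in> Obj C"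
    and Cod_Obj: "f \<in> Arr C \<Longrightarrow> Cod C f \<in> Obj C"
    and Idn_Hom: "X \<in> Obj C \<Longrightarrow> Idn C X \<in> Hom C X X"
    and Comp_Hom: "\<lbrakk>f \<in> Hom C X Y; g \<in> Hom C Y Z\<rbrakk> \<Longrightarrow> g \<cdot> f \<in> Hom C X Z"
    and Comp_assoc: "\<lbrakk>f \<in> Hom C W X; g \<in> Hom C X Y; h \<in> Hom C Y Z\<rbrakk> \<Longrightarrow> (h \<cdot> g) \<cdot> f = h \<cdot> (g \<cdot> f)"
    and Comp_Idn: "f \<in> Hom C X Y \<Longrightarrow> f \<cdot> Idn C X = f"
    and Idn_Comp: "f \<in> Hom C X Y \<Longrightarrow> Idn C Y \<cdot> f = f"

definition is_iso :: "('o, 'm, 'z) cat_scheme \<Rightarrow> 'm \<Rightarrow> bool" where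
  "is_iso C f \<longleftrightarrow> f \<in> Arr C \<and> (\<exists>g \<in> Hom C (Cod C f) (Dom C f).
     g \<cdot>\<^bsub>C\<^esub> f = Idn C (Dom C f) \<and> f \<cdot>\<^bsub>C\<^esub> g = Idn C (Cod C f))"

definition isomorphic :: "('o, 'm, 'z) cat_scheme \<Rightarrow> 'o \<Rightarrow> 'o \<Rightarrow> bool" where
  "isomorphic C X Y \<longleftrightarrow> (\<exists>f \<in> Hom C X Y. is_iso C f)"

definition is_mono :: "('o, 'm, 'z) cat_scheme \<Rightarrow> 'm \<Rightarrow> bool" where
  "is_mono C f \<longleftrightarrow> f \<in> Arr C \<and> (\<forall>W. \<forall>g \<in> Hom C W (Dom C f). \<forall>h \<in> Hom C W (Dom C f).
     f \<cdot>\<^bsub>C\<^esub> g = f \<cdot>\<^bsub>C\<^esub> h \<longrightarrow> g = h)"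

definition is_epi :: "('o, 'm, 'z) cat_scheme \<Rightarrow> 'm \<Rightarrow> bool" where
  "is_epi C f \<longleftrightarrow> f \<in> Arr C \<and> (\<forall>W. \<forall>g \<in> Hom C (Cod C f) W. \<forall>h \<in> Hom C (Cod C f) W.
     g \<cdot>\<^bsub>C\<^esub> f = h \<cdot>\<^bsub>C\<^esub> f \<longrightarrow> g = h)"

definition is_zero :: "('o, 'm, 'z) cat_scheme \<Rightarrow> 'o \<Rightarrow> bool" where
  "is_zero C Z \<longleftrightarrow> Z \<in> Obj C \<and>
     (\<forall>X \<in> Obj C. (\<exists>!f. f \<in> Hom C X Z) \<and> (\<exists>!f. f \<in> Hom C Z X))"

definition projective :: "('o, 'm, 'z) cat_scheme \<Rightarrow> 'o \<Rightarrow> bool" where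
  "projective C P \<longleftrightarrow> P \<in> Obj C \<and>
     (\<forall>e. is_epi C e \<longrightarrow> (\<forall>f \<in> Hom C P (Cod C e). \<exists>g \<in> Hom C P (Dom C e). e \<cdot>\<^bsub>C\<^esub> g = f))"

definition enough_projectives :: "('o, 'm, 'z) cat_scheme \<Rightarrow> bool" where
  "enough_projectives C \<longleftrightarrow>
     (\<forall>X \<in> Obj C. \<exists>P. projective C P \<and> (\<exists>e \<in> Hom C P X. is_epi C e))"

definition full_subcat :: "('o, 'm, 'z) cat_scheme \<Rightarrow> 'o set \<Rightarrow> ('o, 'm) cat" where
  "full_subcat C S = \<lparr>Obj = Obj C \<inter> S, Arr = {f \<in> Arr C. Dom C f \<in> S \<and> Cod C f \<in> S},
     Dom = Dom C, Cod = Cod C, Idn = Idn C, Comp = Comp C\<rparr>"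


section \<open>Localization of a category\<close>

text \<open>The localization of \<open>C\<close> at a set \<open>W\<close> of arrows, after Gabriel and Zisman: arrows are zigzags
  of arrows of \<open>C\<close> and formal inverses of arrows in \<open>W\<close>, modulo the congruence that makes
  the arrows of \<open>C\<close> compose as in \<open>C\<close> and the formal inverses actual inverses.
  A zigzag lists its letters in the order in which they are traversed.\<close>

datatype 'm letter = Fwd 'm | Bwd 'm

fun zigzag :: "('o, 'm, 'z) cat_scheme \<Rightarrow> 'm set \<Rightarrow> 'o \<Rightarrow> 'm letter list \<Rightarrow> 'o \<Rightarrow> bool" where
  "zigzag C W X [] Y \<longleftrightarrow> X \<in> Obj C \<and> X = Y"
| "zigzag C W X (Fwd f # u) Y \<longleftrightarrow> f \<in> Arr C \<and> Dom C f = X \<and> zigzag C W (Cod C f) u Y"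
| "zigzag C W X (Bwd f # u) Y \<longleftrightarrow> f \<in> Arr C \<inter> W \<and> Cod C f = X \<and> zigzag C W (Dom C f) u Y"

inductive zz_step ::
    "('o, 'm, 'z) cat_scheme \<Rightarrow> 'm set \<Rightarrow> 'm letter list \<Rightarrow> 'm letter list \<Rightarrow> bool"
  for C W where
  "\<lbrakk>f \<in> Hom C X Y; g \<in> Hom C Y Z\<rbrakk> \<Longrightarrow> zz_step C W (u @ [Fwd f, Fwd g] @ v) (u @ [Fwd (g \<cdot>\<^bsub>C\<^esub> f)] @ v)"
| "X \<in> Obj C \<Longrightarrow> zz_step C W (u @ [Fwd (Idn C X)] @ v) (u @ v)"
| "f \<in> Arr C \<inter> W \<Longrightarrow> zz_step C W (u @ [Fwd f, Bwd f] @ v) (u @ v)"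
| "f \<in> Arr C \<inter> W \<Longrightarrow> zz_step C W (u @ [Bwd f, Fwd f] @ v) (u @ v)"

definition zz_rel ::
    "('o, 'm, 'z) cat_scheme \<Rightarrow> 'm set \<Rightarrow> 'o \<Rightarrow> 'o \<Rightarrow> ('m letter list \<times> 'm letter list) set" where
  "zz_rel C W X Y = {(u, v). zigzag C W X u Y \<and> zigzag C W X v Y \<and>
     (u, v) \<in> ({(a, b). zigzag C W X a Y \<and> zigzag C W X b Y \<and> (zz_step C W a b \<or> zz_step C W b a)})\<^sup>*}"

type_synonym ('o, 'm) loc_arr = "'o \<times> 'o \<times> 'm letter list set"

definition localization ::
    "('o, 'm, 'z) cat_scheme \<Rightarrow> 'm set \<Rightarrow> ('o, ('o, 'm) loc_arr) cat" where
  "localization C W = \<lparr>Obj = Obj C,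
     Arr = {(X, Y, S) |X Y S. S \<in> {u. zigzag C W X u Y} // zz_rel C W X Y},
     Dom = (\<lambda>(X, Y, S). X),
     Cod = (\<lambda>(X, Y, S). Y),
     Idn = (\<lambda>X. (X, X, zz_rel C W X X `` {[]})),
     Comp = (\<lambda>(Y', Z, T) (X, Y, S). (X, Z, zz_rel C W X Z `` {u @ v |u v. u \<in> S \<and> v \<in> T}))\<rparr>"

definition loc_of :: "('o, 'm, 'z) cat_scheme \<Rightarrow> 'm set \<Rightarrow> 'm \<Rightarrow> ('o, 'm) loc_arr" where
  "loc_of C W f = (Dom C f, Cod C f, zz_rel C W (Dom C f) (Cod C f) `` {[Fwd f]})"


section \<open>Abelian categories\<close>

record ('o, 'm) addcat = "('o, 'm) cat" +
  Add :: "'m \<Rightarrow> 'm \<Rightarrow> 'm" (infixl "\<boxplus>\<index>" 65)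
  Zer :: "'o \<Rightarrow> 'o \<Rightarrow> 'm"

definition Hom_group :: "('o, 'm, 'z) addcat_scheme \<Rightarrow> 'o \<Rightarrow> 'o \<Rightarrow> 'm monoid" where
  "Hom_group A X Y = \<lparr>carrier = Hom A X Y, mult = Add A, one = Zer A X Y\<rparr>"

definition Neg :: "('o, 'm, 'z) addcat_scheme \<Rightarrow> 'm \<Rightarrow> 'm" where
  "Neg A f = inv\<^bsub>Hom_group A (Dom A f) (Cod A f)\<^esub> f"

definition is_kernel :: "('o, 'm, 'z) addcat_scheme \<Rightarrow> 'm \<Rightarrow> 'm \<Rightarrow> bool" where
  "is_kernel A f k \<longleftrightarrow> f \<in> Arr A \<and> k \<in> Arr A \<and> Cod A k = Dom A f \<and>
     f \<cdot>\<^bsub>A\<^esub> k = Zer A (Dom A k) (Cod A f) \<and>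
     (\<forall>W. \<forall>g \<in> Hom A W (Dom A f). f \<cdot>\<^bsub>A\<^esub> g = Zer A W (Cod A f) \<longrightarrow>
        (\<exists>!h. h \<in> Hom A W (Dom A k) \<and> k \<cdot>\<^bsub>A\<^esub> h = g))"

definition is_cokernel :: "('o, 'm, 'z) addcat_scheme \<Rightarrow> 'm \<Rightarrow> 'm \<Rightarrow> bool" where
  "is_cokernel A f c \<longleftrightarrow> f \<in> Arr A \<and> c \<in> Arr A \<and> Dom A c = Cod A f \<and>
     c \<cdot>\<^bsub>A\<^esub> f = Zer A (Dom A f) (Cod A c) \<and>
     (\<forall>W. \<forall>g \<in> Hom A (Cod A f) W. g \<cdot>\<^bsub>A\<^esub> f = Zer A (Dom A f) W \<longrightarrow>
        (\<exists>!h. h \<in> Hom A (Cod A c) W \<and> h \<cdot>\<^bsub>A\<^esub> c = g))"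

definition is_biproduct ::
    "('o, 'm, 'z) addcat_scheme \<Rightarrow> 'o \<Rightarrow> 'o \<Rightarrow> 'o \<times> 'm \<times> 'm \<times> 'm \<times> 'm \<Rightarrow> bool" where
  "is_biproduct A X Y = (\<lambda>(S, i, j, p, q).
     S \<in> Obj A \<and> i \<in> Hom A X S \<and> j \<in> Hom A Y S \<and> p \<in> Hom A S X \<and> q \<in> Hom A S Y \<and>
     p \<cdot>\<^bsub>A\<^esub> i = Idn A X \<and> q \<cdot>\<^bsub>A\<^esub> j = Idn A Y \<and>
     q \<cdot>\<^bsub>A\<^esub> i = Zer A X Y \<and> p \<cdot>\<^bsub>A\<^esub> j = Zer A Y X \<and>
     (i \<cdot>\<^bsub>A\<^esub> p) \<boxplus>\<^bsub>A\<^esub> (j \<cdot>\<^bsub>A\<^esub> q) = Idn A S)"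

locale preadditive_category = category A for A :: "('o, 'm, 'z) addcat_scheme" (structure) +
  assumes Hom_comm_group: "\<lbrakk>X \<in> Obj A; Y \<in> Obj A\<rbrakk> \<Longrightarrow> comm_group (Hom_group A X Y)"
    and Comp_Add: "\<lbrakk>f \<in> Hom A X Y; f' \<in> Hom A X Y; g \<in> Hom A Y Z\<rbrakk> \<Longrightarrow>
      g \<cdot> (f \<boxplus> f') = (g \<cdot> f) \<boxplus> (g \<cdot> f')"
    and Add_Comp: "\<lbrakk>f \<in> Hom A X Y; g \<in> Hom A Y Z; g' \<in> Hom A Y Z\<rbrakk> \<Longrightarrow>
      (g \<boxplus> g') \<cdot> f = (g \<cdot> f) \<boxplus> (g' \<cdot> f)"

locale abelian_category = preadditive_category +
  assumes zero_exists: "\<exists>Z. is_zero A Z"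
    and biproduct_exists: "\<lbrakk>X \<in> Obj A; Y \<in> Obj A\<rbrakk> \<Longrightarrow> \<exists>b. is_biproduct A X Y b"
    and kernel_exists: "f \<in> Arr A \<Longrightarrow> \<exists>k. is_kernel A f k"
    and cokernel_exists: "f \<in> Arr A \<Longrightarrow> \<exists>c. is_cokernel A f c"
    and mono_kernel: "is_mono A f \<Longrightarrow> \<exists>g. is_kernel A g f"
    and epi_cokernel: "is_epi A f \<Longrightarrow> \<exists>g. is_cokernel A g f"

definition zero_ob :: "('o, 'm, 'z) addcat_scheme \<Rightarrow> 'o" where
  "zero_ob A = (SOME Z. is_zero A Z)"

definition ker :: "('o, 'm, 'z) addcat_scheme \<Rightarrow> 'm \<Rightarrow> 'm" where
  "ker A f = (SOME k. is_kernel A f k)"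

definition coker :: "('o, 'm, 'z) addcat_scheme \<Rightarrow> 'm \<Rightarrow> 'm" where
  "coker A f = (SOME c. is_cokernel A f c)"

definition biprod :: "('o, 'm, 'z) addcat_scheme \<Rightarrow> 'o \<Rightarrow> 'o \<Rightarrow> 'o \<times> 'm \<times> 'm \<times> 'm \<times> 'm" where
  "biprod A X Y = (SOME b. is_biproduct A X Y b)"

definition dirsum :: "('o, 'm, 'z) addcat_scheme \<Rightarrow> 'o \<Rightarrow> 'o \<Rightarrow> 'o" where
  "dirsum A X Y = (case biprod A X Y of (S, i, j, p, q) \<Rightarrow> S)"

definition in1 :: "('o, 'm, 'z) addcat_scheme \<Rightarrow> 'o \<Rightarrow> 'o \<Rightarrow> 'm" where
  "in1 A X Y = (case biprod A X Y of (S, i, j, p, q) \<Rightarrow> i)"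

definition in2 :: "('o, 'm, 'z) addcat_scheme \<Rightarrow> 'o \<Rightarrow> 'o \<Rightarrow> 'm" where
  "in2 A X Y = (case biprod A X Y of (S, i, j, p, q) \<Rightarrow> j)"

definition pr1 :: "('o, 'm, 'z) addcat_scheme \<Rightarrow> 'o \<Rightarrow> 'o \<Rightarrow> 'm" where
  "pr1 A X Y = (case biprod A X Y of (S, i, j, p, q) \<Rightarrow> p)"

definition pr2 :: "('o, 'm, 'z) addcat_scheme \<Rightarrow> 'o \<Rightarrow> 'o \<Rightarrow> 'm" where
  "pr2 A X Y = (case biprod A X Y of (S, i, j, p, q) \<Rightarrow> q)"

primrec dpow :: "('o, 'm, 'z) addcat_scheme \<Rightarrow> 'o \<Rightarrow> nat \<Rightarrow> 'o" where
  "dpow A M 0 = zero_ob A"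
| "dpow A M (Suc n) = dirsum A M (dpow A M n)"


section \<open>Complexes and homology\<close>

text \<open>Complexes are indexed homologically: \<open>df X i\<close> goes from degree \<open>i\<close> to degree \<open>i - 1\<close>.\<close>

record ('o, 'm) cx =
  ob :: "int \<Rightarrow> 'o"
  df :: "int \<Rightarrow> 'm"

definition is_complex :: "('o, 'm, 'z) addcat_scheme \<Rightarrow> ('o, 'm) cx \<Rightarrow> bool" where
  "is_complex A X \<longleftrightarrow> (\<forall>i. ob X i \<in> Obj A \<and> df X i \<in> Hom A (ob X i) (ob X (i - 1)) \<and>
     df X (i - 1) \<cdot>\<^bsub>A\<^esub> df X i = Zer A (ob X i) (ob X (i - 1 - 1)))"

type_synonym ('o, 'm) cx_map = "('o, 'm) cx \<times> ('o, 'm) cx \<times> (int \<Rightarrow> 'm)"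

definition is_chain_map :: "('o, 'm, 'z) addcat_scheme \<Rightarrow> ('o, 'm) cx_map \<Rightarrow> bool" where
  "is_chain_map A = (\<lambda>(X, Y, f). is_complex A X \<and> is_complex A Y \<and>
     (\<forall>i. f i \<in> Hom A (ob X i) (ob Y i) \<and> df Y i \<cdot>\<^bsub>A\<^esub> f i = f (i - 1) \<cdot>\<^bsub>A\<^esub> df X i))"

definition Ch :: "('o, 'm, 'z) addcat_scheme \<Rightarrow> (('o, 'm) cx, ('o, 'm) cx_map) cat" where
  "Ch A = \<lparr>Obj = {X. is_complex A X},
     Arr = {f. is_chain_map A f},
     Dom = (\<lambda>(X, Y, f). X),
     Cod = (\<lambda>(X, Y, f). Y),
     Idn = (\<lambda>X. (X, X, \<lambda>i. Idn A (ob X i))),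
     Comp = (\<lambda>(Y', Z, g) (X, Y, f). (X, Z, \<lambda>i. g i \<cdot>\<^bsub>A\<^esub> f i))\<rparr>"

definition cycles :: "('o, 'm, 'z) addcat_scheme \<Rightarrow> ('o, 'm) cx \<Rightarrow> int \<Rightarrow> 'm" where
  "cycles A X i = ker A (df X i)"

definition bdry :: "('o, 'm, 'z) addcat_scheme \<Rightarrow> ('o, 'm) cx \<Rightarrow> int \<Rightarrow> 'm" where
  "bdry A X i = (THE b. b \<in> Hom A (ob X (i + 1)) (Dom A (cycles A X i)) \<and>
     cycles A X i \<cdot>\<^bsub>A\<^esub> b = df X (i + 1))"

definition homol_proj :: "('o, 'm, 'z) addcat_scheme \<Rightarrow> ('o, 'm) cx \<Rightarrow> int \<Rightarrow> 'm" where
  "homol_proj A X i = coker A (bdry A X i)"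

definition homol :: "('o, 'm, 'z) addcat_scheme \<Rightarrow> ('o, 'm) cx \<Rightarrow> int \<Rightarrow> 'o" where
  "homol A X i = Cod A (homol_proj A X i)"

definition cycles_map :: "('o, 'm, 'z) addcat_scheme \<Rightarrow> ('o, 'm) cx_map \<Rightarrow> int \<Rightarrow> 'm" where
  "cycles_map A = (\<lambda>(X, Y, f) i.
     THE z. z \<in> Hom A (Dom A (cycles A X i)) (Dom A (cycles A Y i)) \<and>
       cycles A Y i \<cdot>\<^bsub>A\<^esub> z = f i \<cdot>\<^bsub>A\<^esub> cycles A X i)"

definition homol_map :: "('o, 'm, 'z) addcat_scheme \<Rightarrow> ('o, 'm) cx_map \<Rightarrow> int \<Rightarrow> 'm" where
  "homol_map A = (\<lambda>(X, Y, f) i.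
     THE h. h \<in> Hom A (homol A X i) (homol A Y i) \<and>
       h \<cdot>\<^bsub>A\<^esub> homol_proj A X i = homol_proj A Y i \<cdot>\<^bsub>A\<^esub> cycles_map A (X, Y, f) i)"

definition quasi_isos :: "('o, 'm, 'z) addcat_scheme \<Rightarrow> ('o, 'm) cx_map set" where
  "quasi_isos A = {f. is_chain_map A f \<and> (\<forall>i. is_iso A (homol_map A f i))}"

definition stalk :: "('o, 'm, 'z) addcat_scheme \<Rightarrow> 'o \<Rightarrow> ('o, 'm) cx" where
  "stalk A M = (let X = (\<lambda>i. if i = 0 then M else zero_ob A)
     in \<lparr>ob = X, df = (\<lambda>i. Zer A (X i) (X (i - 1)))\<rparr>)"

definition zero_cx :: "('o, 'm, 'z) addcat_scheme \<Rightarrow> ('o, 'm) cx" where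
  "zero_cx A = \<lparr>ob = (\<lambda>i. zero_ob A), df = (\<lambda>i. Zer A (zero_ob A) (zero_ob A))\<rparr>"

definition shift :: "('o, 'm, 'z) addcat_scheme \<Rightarrow> int \<Rightarrow> ('o, 'm) cx \<Rightarrow> ('o, 'm) cx" where
  "shift A n X = \<lparr>ob = (\<lambda>i. ob X (i - n)),
     df = (\<lambda>i. if even n then df X (i - n) else Neg A (df X (i - n)))\<rparr>"

definition shift_map :: "('o, 'm, 'z) addcat_scheme \<Rightarrow> int \<Rightarrow> ('o, 'm) cx_map \<Rightarrow> ('o, 'm) cx_map" where
  "shift_map A n = (\<lambda>(X, Y, f). (shift A n X, shift A n Y, \<lambda>i. f (i - n)))"

definition dirsum_cx :: "('o, 'm, 'z) addcat_scheme \<Rightarrow> ('o, 'm) cx \<Rightarrow> ('o, 'm) cx \<Rightarrow> ('o, 'm) cx" where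
  "dirsum_cx A X Y = \<lparr>ob = (\<lambda>i. dirsum A (ob X i) (ob Y i)),
     df = (\<lambda>i. (in1 A (ob X (i - 1)) (ob Y (i - 1)) \<cdot>\<^bsub>A\<^esub> df X i \<cdot>\<^bsub>A\<^esub> pr1 A (ob X i) (ob Y i))
            \<boxplus>\<^bsub>A\<^esub> (in2 A (ob X (i - 1)) (ob Y (i - 1)) \<cdot>\<^bsub>A\<^esub> df Y i \<cdot>\<^bsub>A\<^esub> pr2 A (ob X i) (ob Y i)))\<rparr>"

text \<open>Finite direct sums in the derived category are formed degreewise.\<close>

primrec dpow_cx :: "('o, 'm, 'z) addcat_scheme \<Rightarrow> ('o, 'm) cx \<Rightarrow> nat \<Rightarrow> ('o, 'm) cx" where
  "dpow_cx A M 0 = zero_cx A"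
| "dpow_cx A M (Suc n) = dirsum_cx A M (dpow_cx A M n)"

text \<open>The mapping cone of \<open>f : X \<rightarrow> Y\<close> is \<open>Y\<^sub>i \<oplus> X\<^sub>i\<^sub>-\<^sub>1\<close> in degree \<open>i\<close>, with differential
  \<open>(y, x) \<mapsto> (d y + f x, - d x)\<close>.\<close>

definition cone :: "('o, 'm, 'z) addcat_scheme \<Rightarrow> ('o, 'm) cx_map \<Rightarrow> ('o, 'm) cx" where
  "cone A = (\<lambda>(X, Y, f). \<lparr>ob = (\<lambda>i. dirsum A (ob Y i) (ob X (i - 1))),
     df = (\<lambda>i. let p = pr1 A (ob Y i) (ob X (i - 1)); q = pr2 A (ob Y i) (ob X (i - 1));
                   j = in1 A (ob Y (i - 1)) (ob X (i - 1 - 1)); k = in2 A (ob Y (i - 1)) (ob X (i - 1 - 1))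
       in (j \<cdot>\<^bsub>A\<^esub> ((df Y i \<cdot>\<^bsub>A\<^esub> p) \<boxplus>\<^bsub>A\<^esub> (f (i - 1) \<cdot>\<^bsub>A\<^esub> q))) \<boxplus>\<^bsub>A\<^esub> (k \<cdot>\<^bsub>A\<^esub> Neg A (df X (i - 1)) \<cdot>\<^bsub>A\<^esub> q))\<rparr>)"

definition cone_in :: "('o, 'm, 'z) addcat_scheme \<Rightarrow> ('o, 'm) cx_map \<Rightarrow> ('o, 'm) cx_map" where
  "cone_in A = (\<lambda>(X, Y, f). (Y, cone A (X, Y, f), \<lambda>i. in1 A (ob Y i) (ob X (i - 1))))"

definition cone_out :: "('o, 'm, 'z) addcat_scheme \<Rightarrow> ('o, 'm) cx_map \<Rightarrow> ('o, 'm) cx_map" where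
  "cone_out A = (\<lambda>(X, Y, f). (cone A (X, Y, f), shift A 1 X, \<lambda>i. pr2 A (ob Y i) (ob X (i - 1))))"


section \<open>The derived category\<close>

type_synonym ('o, 'm) der_arr = "(('o, 'm) cx, ('o, 'm) cx_map) loc_arr"

definition Der :: "('o, 'm, 'z) addcat_scheme \<Rightarrow> (('o, 'm) cx, ('o, 'm) der_arr) cat" where
  "Der A = localization (Ch A) (quasi_isos A)"

definition Der_of :: "('o, 'm, 'z) addcat_scheme \<Rightarrow> ('o, 'm) cx_map \<Rightarrow> ('o, 'm) der_arr" where
  "Der_of A f = loc_of (Ch A) (quasi_isos A) f"

definition Der_shift :: "('o, 'm, 'z) addcat_scheme \<Rightarrow> int \<Rightarrow> ('o, 'm) der_arr \<Rightarrow> ('o, 'm) der_arr" where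
  "Der_shift A n = (\<lambda>(X, Y, S). (shift A n X, shift A n Y,
     zz_rel (Ch A) (quasi_isos A) (shift A n X) (shift A n Y) `` (map (map_letter (shift_map A n)) ` S)))"

definition Derb :: "('o, 'm, 'z) addcat_scheme \<Rightarrow> (('o, 'm) cx, ('o, 'm) der_arr) cat" where
  "Derb A = full_subcat (Der A) {X. finite {i. \<not> is_zero A (homol A X i)}}"

definition distinguished ::
    "('o, 'm, 'z) addcat_scheme \<Rightarrow> ('o, 'm) der_arr \<Rightarrow> ('o, 'm) der_arr \<Rightarrow> ('o, 'm) der_arr \<Rightarrow> bool" where
  "distinguished A u v w \<longleftrightarrow> (\<exists>X Y Z.
     u \<in> Hom (Der A) X Y \<and> v \<in> Hom (Der A) Y Z \<and> w \<in> Hom (Der A) Z (shift A 1 X) \<and>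
     (\<exists>X' Y' f. \<exists>\<alpha> \<in> Hom (Der A) X X'. \<exists>\<beta> \<in> Hom (Der A) Y Y'. \<exists>\<gamma> \<in> Hom (Der A) Z (cone A f).
        f \<in> Hom (Ch A) X' Y' \<and>
        is_iso (Der A) \<alpha> \<and> is_iso (Der A) \<beta> \<and> is_iso (Der A) \<gamma> \<and>
        \<beta> \<cdot>\<^bsub>Der A\<^esub> u = Der_of A f \<cdot>\<^bsub>Der A\<^esub> \<alpha> \<and>
        \<gamma> \<cdot>\<^bsub>Der A\<^esub> v = Der_of A (cone_in A f) \<cdot>\<^bsub>Der A\<^esub> \<beta> \<and>
        Der_shift A 1 \<alpha> \<cdot>\<^bsub>Der A\<^esub> w = Der_of A (cone_out A f) \<cdot>\<^bsub>Der A\<^esub> \<gamma>))"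

definition is_cone :: "('o, 'm, 'z) addcat_scheme \<Rightarrow> ('o, 'm) der_arr \<Rightarrow> ('o, 'm) cx \<Rightarrow> bool" where
  "is_cone A u Z \<longleftrightarrow> (\<exists>v w. Cod (Der A) v = Z \<and> distinguished A u v w)"


section \<open>Quasi-projective dimension and length\<close>

definition csup :: "('o, 'm, 'z) addcat_scheme \<Rightarrow> ('o, 'm) cx \<Rightarrow> ereal" where
  "csup A X = Sup ((\<lambda>i. ereal (of_int i)) ` {i. \<not> is_zero A (ob X i)})"

definition cinf :: "('o, 'm, 'z) addcat_scheme \<Rightarrow> ('o, 'm) cx \<Rightarrow> ereal" where
  "cinf A X = Inf ((\<lambda>i. ereal (of_int i)) ` {i. \<not> is_zero A (ob X i)})"

definition hsup :: "('o, 'm, 'z) addcat_scheme \<Rightarrow> ('o, 'm) cx \<Rightarrow> ereal" where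
  "hsup A X = Sup ((\<lambda>i. ereal (of_int i)) ` {i. \<not> is_zero A (homol A X i)})"

definition bounded_proj_cx :: "('o, 'm, 'z) addcat_scheme \<Rightarrow> ('o, 'm) cx \<Rightarrow> bool" where
  "bounded_proj_cx A P \<longleftrightarrow> is_complex A P \<and> finite {i. \<not> is_zero A (ob P i)} \<and>
     (\<forall>i. projective A (ob P i))"

definition qp_resolution :: "('o, 'm, 'z) addcat_scheme \<Rightarrow> 'o \<Rightarrow> ('o, 'm) cx \<Rightarrow> bool" where
  "qp_resolution A M P \<longleftrightarrow> bounded_proj_cx A P \<and>
     (\<exists>a :: int \<Rightarrow> nat. (\<forall>i. isomorphic A (homol A P i) (dpow A M (a i))) \<and> (\<exists>i. a i \<noteq> 0))"

definition qpd_res :: "('o, 'm, 'z) addcat_scheme \<Rightarrow> 'o \<Rightarrow> ereal" where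
  "qpd_res A M = Inf {csup A P - hsup A P |P. qp_resolution A M P}"

definition qpl_res :: "('o, 'm, 'z) addcat_scheme \<Rightarrow> 'o \<Rightarrow> ereal" where
  "qpl_res A M = Inf {csup A P - cinf A P |P. qp_resolution A M P}"

definition pd :: "('o, 'm, 'z) addcat_scheme \<Rightarrow> ('o, 'm) cx \<Rightarrow> ereal" where
  "pd A X = Inf ((\<lambda>n. ereal (of_int n)) ` {n. \<exists>P. bounded_proj_cx A P \<and>
     isomorphic (Der A) X P \<and> (\<forall>i > n. is_zero A (ob P i))})"

text \<open>Only \<open>F i\<close> for \<open>s \<le> i \<le> t + 1\<close> and \<open>\<phi> i : F (i + 1) \<rightarrow> F i\<close> for \<open>s \<le> i \<le> t\<close>
  belong to the filtration; the other values of \<open>F\<close> and \<open>\<phi>\<close> are irrelevant.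
  That \<open>M\<close> is a non-zero object of \<open>Derb A\<close> is left to the users of the predicate.\<close>

definition qp_filtration ::
    "('o, 'm, 'z) addcat_scheme \<Rightarrow> ('o, 'm) cx \<Rightarrow> int \<Rightarrow> int \<Rightarrow>
     (int \<Rightarrow> ('o, 'm) cx) \<Rightarrow> (int \<Rightarrow> ('o, 'm) der_arr) \<Rightarrow> bool" where
  "qp_filtration A M s t F \<phi> \<longleftrightarrow> s \<le> t \<and>
     (\<forall>i \<in> {s..t + 1}. F i \<in> Obj (Derb A)) \<and>
     (\<forall>i \<in> {s..t}. \<phi> i \<in> Hom (Derb A) (F (i + 1)) (F i)) \<and>
     isomorphic (Der A) (F (t + 1)) (zero_cx A) \<and>
     (\<exists>a :: int \<Rightarrow> nat. a s > 0 \<and> a t > 0 \<and>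
        (\<forall>i \<in> {s..t}. \<exists>Z. is_cone A (\<phi> i) Z \<and> isomorphic (Der A) Z (dpow_cx A (shift A i M) (a i)))) \<and>
     \<not> isomorphic (Der A) (F s) (zero_cx A) \<and> pd A (F s) < \<infinity>"

definition qpd_filt :: "('o, 'm, 'z) addcat_scheme \<Rightarrow> ('o, 'm) cx \<Rightarrow> ereal" where
  "qpd_filt A M = Inf {pd A (F s) - ereal (of_int t) |s t F \<phi>. qp_filtration A M s t F \<phi>}"

definition qpl_filt :: "('o, 'm, 'z) addcat_scheme \<Rightarrow> ('o, 'm) cx \<Rightarrow> ereal" where
  "qpl_filt A M = Inf {pd A (F s) - ereal (of_int s) |s t F \<phi>. qp_filtration A M s t F \<phi>}"

end

theory Submission
  imports Defs
begin

text \<open>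
  Both inequalities pass between a complex and its canonical truncations.

  Given a bounded complex \<open>P\<close> of projectives whose homology consists of powers of
  \<open>M\<close>, living in degrees from \<open>s\<close> to \<open>t\<close>, its truncations at
  \<open>s\<close>, \<open>s + 1\<close>, \<open>\<dots>\<close>, \<open>t + 1\<close> form a
  filtration: passing from the truncation at \<open>i + 1\<close> to the one at \<open>i\<close> adds
  just the homology of degree \<open>i\<close>, so the cone is a shifted power of \<open>M\<close>
  (\<open>truncation_cone\<close>), and the last truncation is acyclic. The first one is isomorphic to
  \<open>P\<close> in the derived category, so its projective dimension is at most the supremum of
  \<open>P\<close>, while \<open>t\<close> is the homological supremum of \<open>P\<close> and
  \<open>s\<close> is at least its infimum (\<open>resolution_filtration\<close>).

  Conversely, a filtration adds homology degree by degree, from \<open>t\<close> downwards. The long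
  exact sequence shows that no cancellation is possible, so \<open>F s\<close> has homology consisting
  of powers of \<open>M\<close>, non-zero in degrees \<open>s\<close> and \<open>t\<close> and zero
  outside (\<open>filtration_homol\<close>). Hence every bounded complex \<open>P\<close> of projectives
  isomorphic to \<open>F s\<close> is a quasi-projective resolution with homological supremum
  \<open>t\<close>. For the lengths its terms below degree \<open>s\<close> have to be removed: there
  \<open>P\<close> is exact and bounded, hence split, so that its truncation at \<open>s\<close> still
  consists of projectives (\<open>projective_cycles\<close>).

  Two devices keep this elementary. In a category with enough projectives, arrows out of projective
  objects serve as elements in diagram chases; quasi-isomorphisms and acyclicity become statements about
  cycles and boundaries (\<open>homol_zero_iff\<close>, \<open>homol_map_iso_iff\<close>), and the
  needed parts of the long exact sequence are computations with pairs in a mapping cone. Of a morphism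
  in a filtration, only the objects of its triangle up to isomorphism are used, and isomorphic objects
  of the derived category have isomorphic homology because homology inverts quasi-isomorphisms
  (\<open>map_isomorphic\<close>).
\<close>


section \<open>Categories and additive structure\<close>

lemma Hom_iff: "f \<in> Hom C X Y \<longleftrightarrow> f \<in> Arr C \<and> Dom C f = X \<and> Cod C f = Y"
  by (simp add: Hom_def)

context category
begin

lemma Dom_in_Obj [simp]: "f \<in> Arr C \<Longrightarrow> Dom C f \<in> Obj C"
  and Cod_in_Obj [simp]: "f \<in> Arr C \<Longrightarrow> Cod C f \<in> Obj C"
  by (simp_all add: Dom_Obj Cod_Obj)

lemma comp_simps [simp]:
  assumes "f \<in> Arr C" "g \<in> Arr C" "Cod C f = Dom C g"
  shows "g \<cdot> f \<in> Arr C" "Dom C (g \<cdot> f) = Dom C f" "Cod C (g \<cdot> f) = Cod C g"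
  using Comp_Hom[of f "Dom C f" "Cod C f" g "Cod C g"] assms by (auto simp: Hom_iff)

lemma comp_assoc [simp]:
  "\<lbrakk>f \<in> Arr C; g \<in> Arr C; h \<in> Arr C; Cod C f = Dom C g; Cod C g = Dom C h\<rbrakk>
    \<Longrightarrow> (h \<cdot> g) \<cdot> f = h \<cdot> (g \<cdot> f)"
  using Comp_assoc[of f "Dom C f" "Cod C f" g "Cod C g" h "Cod C h"] by (auto simp: Hom_iff)

text \<open>With composites nested to the right, \<open>g \<cdot> f\<close> does not occur in \<open>g \<cdot> (f
  \<cdot> h)\<close>; this rule applies an equation for \<open>g \<cdot> f\<close> in front of a further
  arrow.\<close>

lemma comp_assoc_eq:
  "\<lbrakk>g \<cdot> f = k; f \<in> Arr C; g \<in> Arr C; h \<in> Arr C; Cod C f = Dom C g; Cod C h = Dom C f\<rbrakk>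
    \<Longrightarrow> g \<cdot> (f \<cdot> h) = k \<cdot> h"
  using comp_assoc[of h f g] by simp

lemma idn_simps [simp]:
  assumes "X \<in> Obj C"
  shows "Idn C X \<in> Arr C" "Dom C (Idn C X) = X" "Cod C (Idn C X) = X"
  using Idn_Hom[OF assms] by (auto simp: Hom_iff)

lemma comp_idn [simp]: "\<lbrakk>f \<in> Arr C; X = Dom C f\<rbrakk> \<Longrightarrow> f \<cdot> Idn C X = f"
  and idn_comp [simp]: "\<lbrakk>f \<in> Arr C; Y = Cod C f\<rbrakk> \<Longrightarrow> Idn C Y \<cdot> f = f"
  using Comp_Idn[of f "Dom C f" "Cod C f"] Idn_Comp[of f "Dom C f" "Cod C f"]
  by (auto simp: Hom_iff)

lemma iso_idn: "X \<in> Obj C \<Longrightarrow> is_iso C (Idn C X)"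
  unfolding is_iso_def by (auto simp: Hom_iff intro!: bexI[of _ "Idn C X"])

lemma iso_comp:
  assumes "is_iso C f" "is_iso C g" "Cod C f = Dom C g"
  shows "is_iso C (g \<cdot> f)"
proof -
  obtain f' where f': "f' \<in> Arr C" "Dom C f' = Cod C f" "Cod C f' = Dom C f"
      "f' \<cdot> f = Idn C (Dom C f)" "f \<cdot> f' = Idn C (Cod C f)"
    using assms(1) by (auto simp: is_iso_def Hom_iff)
  obtain g' where g': "g' \<in> Arr C" "Dom C g' = Cod C g" "Cod C g' = Dom C g"
      "g' \<cdot> g = Idn C (Dom C g)" "g \<cdot> g' = Idn C (Cod C g)"
    using assms(2) by (auto simp: is_iso_def Hom_iff)
  have fg: "f \<in> Arr C" "g \<in> Arr C" using assms by (auto simp: is_iso_def)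
  have "(f' \<cdot> g') \<cdot> (g \<cdot> f) = Idn C (Dom C f)"
    using fg f' g' assms(3) comp_assoc_eq[OF g'(4), of f] by simp
  moreover have "(g \<cdot> f) \<cdot> (f' \<cdot> g') = Idn C (Cod C g)"
    using fg f' g' assms(3) comp_assoc_eq[OF f'(5), of g'] by simp
  ultimately show ?thesis
    using fg f' g' assms(3) unfolding is_iso_def
    by (auto simp: Hom_iff intro!: bexI[of _ "f' \<cdot> g'"])
qed

lemma isomorphicI: "is_iso C f \<Longrightarrow> isomorphic C (Dom C f) (Cod C f)"
  by (auto simp: isomorphic_def is_iso_def Hom_iff)

lemma isomorphic_sym: "isomorphic C X Y \<Longrightarrow> isomorphic C Y X"
proof -
  assume "isomorphic C X Y"
  then obtain f g where "f \<in> Arr C" "Dom C f = X" "Cod C f = Y" "g \<in> Arr C" "Dom C g = Y"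
      "Cod C g = X" "g \<cdot> f = Idn C X" "f \<cdot> g = Idn C Y"
    by (auto simp: isomorphic_def is_iso_def Hom_iff)
  moreover from this have "is_iso C g"
    unfolding is_iso_def by (auto simp: Hom_iff intro!: bexI[of _ f])
  ultimately show ?thesis using isomorphicI[of g] by simp
qed

lemma isomorphic_trans: "\<lbrakk>isomorphic C X Y; isomorphic C Y Z\<rbrakk> \<Longrightarrow> isomorphic C X Z"
proof -
  assume "isomorphic C X Y" "isomorphic C Y Z"
  then obtain f g where "is_iso C f" "Dom C f = X" "Cod C f = Y" "is_iso C g" "Dom C g = Y"
      "Cod C g = Z" "f \<in> Arr C" "g \<in> Arr C"
    by (auto simp: isomorphic_def Hom_iff)
  then show ?thesis using isomorphicI[OF iso_comp, of f g] by simp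
qed

lemma isomorphic_Obj: "isomorphic C X Y \<Longrightarrow> X \<in> Obj C \<and> Y \<in> Obj C"
  by (auto simp: isomorphic_def Hom_iff)

end

context preadditive_category
begin

lemma zer_simps [simp]:
  assumes "X \<in> Obj A" "Y \<in> Obj A"
  shows "Zer A X Y \<in> Arr A" "Dom A (Zer A X Y) = X" "Cod A (Zer A X Y) = Y"
proof -
  interpret G: comm_group "Hom_group A X Y" using Hom_comm_group assms .
  show "Zer A X Y \<in> Arr A" "Dom A (Zer A X Y) = X" "Cod A (Zer A X Y) = Y"
    using G.one_closed by (auto simp: Hom_group_def Hom_iff)
qed

lemma add_simps [simp]:
  assumes "f \<in> Arr A" "g \<in> Arr A" "Dom A f = Dom A g" "Cod A f = Cod A g"
  shows "f \<boxplus> g \<in> Arr A" "Dom A (f \<boxplus> g) = Dom A g" "Cod A (f \<boxplus> g) = Cod A g"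
proof -
  interpret G: comm_group "Hom_group A (Dom A g) (Cod A g)" using Hom_comm_group assms by simp
  show "f \<boxplus> g \<in> Arr A" "Dom A (f \<boxplus> g) = Dom A g" "Cod A (f \<boxplus> g) = Cod A g"
    using G.m_closed[of f g] assms by (auto simp: Hom_group_def Hom_iff)
qed

lemma neg_simps [simp]:
  assumes "f \<in> Arr A"
  shows "Neg A f \<in> Arr A" "Dom A (Neg A f) = Dom A f" "Cod A (Neg A f) = Cod A f"
proof -
  interpret G: comm_group "Hom_group A (Dom A f) (Cod A f)" using Hom_comm_group assms by simp
  show "Neg A f \<in> Arr A" "Dom A (Neg A f) = Dom A f" "Cod A (Neg A f) = Cod A f"
    using G.inv_closed[of f] assms by (auto simp: Hom_group_def Hom_iff Neg_def)
qed

lemma add_assoc [simp]: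
  assumes "f \<in> Arr A" "g \<in> Arr A" "h \<in> Arr A" "Dom A f = Dom A g" "Cod A f = Cod A g"
    "Dom A g = Dom A h" "Cod A g = Cod A h"
  shows "(f \<boxplus> g) \<boxplus> h = f \<boxplus> (g \<boxplus> h)"
proof -
  interpret G: comm_group "Hom_group A (Dom A g) (Cod A g)" using Hom_comm_group assms by simp
  show ?thesis using G.m_assoc[of f g h] assms by (auto simp: Hom_group_def Hom_iff)
qed

lemma add_commute:
  assumes "f \<in> Arr A" "g \<in> Arr A" "Dom A f = Dom A g" "Cod A f = Cod A g"
  shows "f \<boxplus> g = g \<boxplus> f"
proof -
  interpret G: comm_group "Hom_group A (Dom A g) (Cod A g)" using Hom_comm_group assms by simp
  show ?thesis using G.m_comm[of f g] assms by (auto simp: Hom_group_def Hom_iff)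
qed

lemma add_left_commute:
  assumes "f \<in> Arr A" "g \<in> Arr A" "h \<in> Arr A" "Dom A f = Dom A g" "Cod A f = Cod A g"
    "Dom A g = Dom A h" "Cod A g = Cod A h"
  shows "f \<boxplus> (g \<boxplus> h) = g \<boxplus> (f \<boxplus> h)"
  using add_assoc[of f g h] add_assoc[of g f h] add_commute[of f g] assms by simp

lemma add_zer [simp]:
  assumes "f \<in> Arr A" "X = Dom A f" "Y = Cod A f"
  shows "f \<boxplus> Zer A X Y = f" "Zer A X Y \<boxplus> f = f"
proof -
  interpret G: comm_group "Hom_group A (Dom A f) (Cod A f)" using Hom_comm_group assms by simp
  show "f \<boxplus> Zer A X Y = f" "Zer A X Y \<boxplus> f = f"
    using G.r_one[of f] G.l_one[of f] assms by (auto simp: Hom_group_def Hom_iff)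
qed

lemma add_neg [simp]:
  assumes "f \<in> Arr A"
  shows "f \<boxplus> Neg A f = Zer A (Dom A f) (Cod A f)" "Neg A f \<boxplus> f = Zer A (Dom A f) (Cod A f)"
proof -
  interpret G: comm_group "Hom_group A (Dom A f) (Cod A f)" using Hom_comm_group assms by simp
  show "f \<boxplus> Neg A f = Zer A (Dom A f) (Cod A f)" "Neg A f \<boxplus> f = Zer A (Dom A f) (Cod A f)"
    using G.r_inv[of f] G.l_inv[of f] assms by (auto simp: Hom_group_def Hom_iff Neg_def)
qed

lemma add_neg_cancel [simp]:
  assumes "f \<in> Arr A" "g \<in> Arr A" "Dom A f = Dom A g" "Cod A f = Cod A g"
  shows "f \<boxplus> (Neg A f \<boxplus> g) = g" "Neg A f \<boxplus> (f \<boxplus> g) = g"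
  using add_assoc[of f "Neg A f" g] add_assoc[of "Neg A f" f g] assms by simp_all

lemma neg_unique:
  assumes "f \<in> Arr A" "g \<in> Arr A" "Dom A f = Dom A g" "Cod A f = Cod A g"
    "f \<boxplus> g = Zer A (Dom A g) (Cod A g)"
  shows "f = Neg A g"
proof -
  have "f = (f \<boxplus> g) \<boxplus> Neg A g" using assms(1-4) by simp
  then show ?thesis unfolding assms(5) using assms(1-4) by simp
qed

lemma diff_zer:
  assumes "f \<in> Arr A" "g \<in> Arr A" "Dom A f = Dom A g" "Cod A f = Cod A g"
    "f \<boxplus> Neg A g = Zer A (Dom A g) (Cod A g)"
  shows "f = g"
proof -
  have "f = (f \<boxplus> Neg A g) \<boxplus> g" using assms(1-4) by simp
  then show ?thesis unfolding assms(5) using assms(1-4) by simp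
qed

lemma neg_neg [simp]: "f \<in> Arr A \<Longrightarrow> Neg A (Neg A f) = f"
  using neg_unique[of f "Neg A f"] by simp

lemma neg_zer [simp]: "\<lbrakk>X \<in> Obj A; Y \<in> Obj A\<rbrakk> \<Longrightarrow> Neg A (Zer A X Y) = Zer A X Y"
  using neg_unique[of "Zer A X Y" "Zer A X Y"] by simp

lemma neg_eq_zer [simp]: "f \<in> Arr A \<Longrightarrow> X = Dom A f \<Longrightarrow> Y = Cod A f \<Longrightarrow>
    Neg A f = Zer A X Y \<longleftrightarrow> f = Zer A X Y"
  by (metis neg_neg neg_zer Dom_in_Obj Cod_in_Obj)

lemma neg_add [simp]:
  assumes "f \<in> Arr A" "g \<in> Arr A" "Dom A f = Dom A g" "Cod A f = Cod A g"
  shows "Neg A (f \<boxplus> g) = Neg A f \<boxplus> Neg A g"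
proof -
  have "(Neg A f \<boxplus> Neg A g) \<boxplus> (f \<boxplus> g) = Zer A (Dom A g) (Cod A g)"
    using assms add_left_commute[of "Neg A g" f g] by simp
  then show ?thesis using neg_unique[of "Neg A f \<boxplus> Neg A g" "f \<boxplus> g"] assms by simp
qed

lemma comp_add [simp]:
  "\<lbrakk>f \<in> Arr A; f' \<in> Arr A; g \<in> Arr A; Dom A f = Dom A f'; Cod A f = Dom A g; Cod A f' = Dom A g\<rbrakk>
    \<Longrightarrow> g \<cdot> (f \<boxplus> f') = (g \<cdot> f) \<boxplus> (g \<cdot> f')"
  using Comp_Add[of f "Dom A f" "Dom A g" f' g "Cod A g"] by (simp add: Hom_iff)

lemma add_comp [simp]:
  "\<lbrakk>f \<in> Arr A; g \<in> Arr A; g' \<in> Arr A; Dom A g = Cod A f; Dom A g' = Cod A f; Cod A g = Cod A g'\<rbrakk>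
    \<Longrightarrow> (g \<boxplus> g') \<cdot> f = (g \<cdot> f) \<boxplus> (g' \<cdot> f)"
  using Add_Comp[of f "Dom A f" "Cod A f" g "Cod A g" g'] by (simp add: Hom_iff)

lemma add_self_zer:
  assumes "f \<in> Arr A" "f \<boxplus> f = f"
  shows "f = Zer A (Dom A f) (Cod A f)"
  using add_neg_cancel(2)[of f f] assms by simp

lemma comp_zer [simp]:
  assumes "g \<in> Arr A" "X \<in> Obj A" "Y = Dom A g"
  shows "g \<cdot> Zer A X Y = Zer A X (Cod A g)"
proof -
  have "(g \<cdot> Zer A X Y) \<boxplus> (g \<cdot> Zer A X Y) = g \<cdot> (Zer A X Y \<boxplus> Zer A X Y)"
    using assms by (subst comp_add) simp_all
  also have "\<dots> = g \<cdot> Zer A X Y" using assms by simp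
  finally have "g \<cdot> Zer A X Y = Zer A (Dom A (g \<cdot> Zer A X Y)) (Cod A (g \<cdot> Zer A X Y))"
    using assms by (intro add_self_zer) simp_all
  also have "\<dots> = Zer A X (Cod A g)" using assms by simp
  finally show ?thesis .
qed

lemma zer_comp [simp]:
  assumes "f \<in> Arr A" "Y \<in> Obj A" "X = Cod A f"
  shows "Zer A X Y \<cdot> f = Zer A (Dom A f) Y"
proof -
  have "(Zer A X Y \<cdot> f) \<boxplus> (Zer A X Y \<cdot> f) = (Zer A X Y \<boxplus> Zer A X Y) \<cdot> f"
    using assms by (subst add_comp) simp_all
  also have "\<dots> = Zer A X Y \<cdot> f" using assms by simp
  finally have "Zer A X Y \<cdot> f = Zer A (Dom A (Zer A X Y \<cdot> f)) (Cod A (Zer A X Y \<cdot> f))"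
    using assms by (intro add_self_zer) simp_all
  also have "\<dots> = Zer A (Dom A f) Y" using assms by simp
  finally show ?thesis .
qed

lemma comp_neg [simp]:
  assumes "f \<in> Arr A" "g \<in> Arr A" "Dom A g = Cod A f"
  shows "g \<cdot> Neg A f = Neg A (g \<cdot> f)" "Neg A g \<cdot> f = Neg A (g \<cdot> f)"
proof -
  have "(g \<cdot> Neg A f) \<boxplus> (g \<cdot> f) = g \<cdot> (Neg A f \<boxplus> f)"
    using assms by (subst comp_add) simp_all
  then show "g \<cdot> Neg A f = Neg A (g \<cdot> f)"
    using assms by (intro neg_unique) (simp_all del: comp_add)
  have "(Neg A g \<cdot> f) \<boxplus> (g \<cdot> f) = (Neg A g \<boxplus> g) \<cdot> f"
    using assms by (subst add_comp) simp_all
  then show "Neg A g \<cdot> f = Neg A (g \<cdot> f)"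
    using assms by (intro neg_unique) (simp_all del: add_comp)
qed

lemma mono_iff: "is_mono A f \<longleftrightarrow> f \<in> Arr A \<and>
    (\<forall>g \<in> Arr A. Cod A g = Dom A f \<longrightarrow> f \<cdot> g = Zer A (Dom A g) (Cod A f) \<longrightarrow> g = Zer A (Dom A g) (Dom A f))"
  (is "_ \<longleftrightarrow> ?R")
proof
  assume m: "is_mono A f"
  have "g = Zer A (Dom A g) (Dom A f)"
    if "g \<in> Arr A" "Cod A g = Dom A f" "f \<cdot> g = Zer A (Dom A g) (Cod A f)" for g
  proof -
    have "f \<cdot> g = f \<cdot> Zer A (Dom A g) (Dom A f)" using m that by (simp add: is_mono_def)
    moreover have "f \<in> Arr A" using m by (simp add: is_mono_def)
    ultimately show ?thesis
      using m[unfolded is_mono_def, THEN conjunct2, rule_format, of g "Dom A g" "Zer A (Dom A g) (Dom A f)"]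
        that(1,2) by (simp add: Hom_iff)
  qed
  then show ?R using m by (auto simp: is_mono_def)
next
  assume R: ?R
  have "g = h" if "g \<in> Arr A" "Cod A g = Dom A f" "h \<in> Arr A" "Cod A h = Dom A f" "Dom A g = Dom A h"
    "f \<cdot> g = f \<cdot> h" for g h
  proof (rule diff_zer)
    have "f \<cdot> (g \<boxplus> Neg A h) = Zer A (Dom A h) (Cod A f)" using that R by simp
    then have "g \<boxplus> Neg A h = Zer A (Dom A h) (Dom A f)"
      using R[THEN conjunct2, THEN bspec, of "g \<boxplus> Neg A h"] that by simp
    then show "g \<boxplus> Neg A h = Zer A (Dom A h) (Cod A h)" using that by simp
  qed (use that in auto)
  then show "is_mono A f" using R by (auto simp: is_mono_def Hom_iff)
qed

lemma epi_iff: "is_epi A f \<longleftrightarrow> f \<in> Arr A \<and>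
    (\<forall>g \<in> Arr A. Dom A g = Cod A f \<longrightarrow> g \<cdot> f = Zer A (Dom A f) (Cod A g) \<longrightarrow> g = Zer A (Cod A f) (Cod A g))"
  (is "_ \<longleftrightarrow> ?R")
proof
  assume m: "is_epi A f"
  have "g = Zer A (Cod A f) (Cod A g)"
    if "g \<in> Arr A" "Dom A g = Cod A f" "g \<cdot> f = Zer A (Dom A f) (Cod A g)" for g
  proof -
    have "g \<cdot> f = Zer A (Cod A f) (Cod A g) \<cdot> f" using m that by (simp add: is_epi_def)
    moreover have "f \<in> Arr A" using m by (simp add: is_epi_def)
    ultimately show ?thesis
      using m[unfolded is_epi_def, THEN conjunct2, rule_format, of g "Cod A g" "Zer A (Cod A f) (Cod A g)"]
        that(1,2) by (simp add: Hom_iff)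
  qed
  then show ?R using m by (auto simp: is_epi_def)
next
  assume R: ?R
  have "g = h" if "g \<in> Arr A" "Dom A g = Cod A f" "h \<in> Arr A" "Dom A h = Cod A f" "Cod A g = Cod A h"
    "g \<cdot> f = h \<cdot> f" for g h
  proof (rule diff_zer)
    have "(g \<boxplus> Neg A h) \<cdot> f = Zer A (Dom A f) (Cod A h)" using that R by simp
    then have "g \<boxplus> Neg A h = Zer A (Cod A f) (Cod A h)"
      using R[THEN conjunct2, THEN bspec, of "g \<boxplus> Neg A h"] that by simp
    then show "g \<boxplus> Neg A h = Zer A (Dom A h) (Cod A h)" using that by simp
  qed (use that in auto)
  then show "is_epi A f" using R by (auto simp: is_epi_def Hom_iff)
qed

lemma mono_cancel:
  "\<lbrakk>is_mono A f; f \<cdot> g = f \<cdot> h; g \<in> Arr A; h \<in> Arr A; Cod A g = Dom A f; Cod A h = Dom A f; Dom A g = Dom A h\<rbrakk>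
    \<Longrightarrow> g = h"
  by (auto simp: is_mono_def Hom_iff)

lemma epi_cancel:
  "\<lbrakk>is_epi A f; g \<cdot> f = h \<cdot> f; g \<in> Arr A; h \<in> Arr A; Dom A g = Cod A f; Dom A h = Cod A f; Cod A g = Cod A h\<rbrakk>
    \<Longrightarrow> g = h"
  by (auto simp: is_epi_def Hom_iff)

lemma is_zero_iff: "is_zero A Z \<longleftrightarrow> Z \<in> Obj A \<and> Idn A Z = Zer A Z Z"
proof
  assume z: "is_zero A Z"
  then have "Z \<in> Obj A" by (simp add: is_zero_def)
  moreover then have "\<exists>!f. f \<in> Hom A Z Z" using z by (auto simp: is_zero_def)
  ultimately show "Z \<in> Obj A \<and> Idn A Z = Zer A Z Z" by (auto simp: Hom_iff)
next
  assume z: "Z \<in> Obj A \<and> Idn A Z = Zer A Z Z"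
  have 1: "f = Zer A X Z" if "f \<in> Hom A X Z" for f X
    using z that unfolding Hom_iff by (metis idn_comp zer_comp)
  have 2: "f = Zer A Z X" if "f \<in> Hom A Z X" for f X
    using z that unfolding Hom_iff by (metis comp_idn comp_zer)
  show "is_zero A Z"
    unfolding is_zero_def using z by (auto intro!: ex1I 1 2 simp: Hom_iff)
qed

lemma to_zero: "\<lbrakk>is_zero A Z; f \<in> Arr A; Cod A f = Z\<rbrakk> \<Longrightarrow> f = Zer A (Dom A f) Z"
  by (metis idn_comp zer_comp is_zero_iff)

lemma from_zero: "\<lbrakk>is_zero A Z; f \<in> Arr A; Dom A f = Z\<rbrakk> \<Longrightarrow> f = Zer A Z (Cod A f)"
  by (metis comp_idn comp_zer is_zero_iff)

lemma is_zero_Obj: "is_zero A Z \<Longrightarrow> Z \<in> Obj A"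
  by (simp add: is_zero_iff)

lemma is_zero_isomorphic:
  assumes "isomorphic A X Y" "is_zero A X"
  shows "is_zero A Y"
proof -
  obtain f g where fg: "f \<in> Arr A" "Dom A f = X" "Cod A f = Y" "g \<in> Arr A" "Dom A g = Y"
      "Cod A g = X" "f \<cdot> g = Idn A Y"
    using assms(1) by (auto simp: isomorphic_def is_iso_def Hom_iff)
  have "g = Zer A Y X" using to_zero[OF assms(2), of g] fg by simp
  then have "f \<cdot> g = Zer A Y Y" using fg isomorphic_Obj[OF assms(1)] by simp
  then show ?thesis using fg isomorphic_Obj[OF assms(1)] by (simp add: is_zero_iff)
qed

lemma isomorphic_zeros:
  assumes "is_zero A X" "is_zero A Y" shows "isomorphic A X Y"
proof -
  have O: "X \<in> Obj A" "Y \<in> Obj A" using assms is_zero_Obj by auto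
  have "is_iso A (Zer A X Y)"
    unfolding is_iso_def using assms O
    by (intro conjI bexI[of _ "Zer A Y X"]) (simp_all add: Hom_iff is_zero_iff)
  then show ?thesis using isomorphicI[of "Zer A X Y"] O by simp
qed

end


section \<open>Exactness tested on projective objects\<close>

context preadditive_category
begin

lemma kernel_lift:
  assumes "is_kernel A f k" "g \<in> Arr A" "Cod A g = Dom A f" "f \<cdot> g = Zer A (Dom A g) (Cod A f)"
  obtains h where "h \<in> Arr A" "Dom A h = Dom A g" "Cod A h = Dom A k" "k \<cdot> h = g"
proof -
  have "g \<in> Hom A (Dom A g) (Dom A f)" using assms by (simp add: Hom_iff)
  then have "\<exists>!h. h \<in> Hom A (Dom A g) (Dom A k) \<and> k \<cdot> h = g"
    using assms(1,4) unfolding is_kernel_def by blast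
  then show ?thesis using that by (auto simp: Hom_iff)
qed

lemma cokernel_lift:
  assumes "is_cokernel A f c" "g \<in> Arr A" "Dom A g = Cod A f" "g \<cdot> f = Zer A (Dom A f) (Cod A g)"
  obtains h where "h \<in> Arr A" "Dom A h = Cod A c" "Cod A h = Cod A g" "h \<cdot> c = g"
proof -
  have "g \<in> Hom A (Cod A f) (Cod A g)" using assms by (simp add: Hom_iff)
  then have "\<exists>!h. h \<in> Hom A (Cod A c) (Cod A g) \<and> h \<cdot> c = g"
    using assms(1,4) unfolding is_cokernel_def by blast
  then show ?thesis using that by (auto simp: Hom_iff)
qed

lemma kernel_mono:
  assumes "is_kernel A f k" shows "is_mono A k"
  unfolding mono_iff
proof (intro conjI ballI impI)
  show k: "k \<in> Arr A" using assms by (simp add: is_kernel_def)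
  fix g assume g: "g \<in> Arr A" "Cod A g = Dom A k" "k \<cdot> g = Zer A (Dom A g) (Cod A k)"
  have f: "f \<in> Arr A" "Cod A k = Dom A f" using assms by (auto simp: is_kernel_def)
  have "\<exists>!h. h \<in> Hom A (Dom A g) (Dom A k) \<and> k \<cdot> h = Zer A (Dom A g) (Cod A k)"
    using assms f g(1) unfolding is_kernel_def by (auto simp: Hom_iff)
  moreover have "g \<in> Hom A (Dom A g) (Dom A k) \<and> k \<cdot> g = Zer A (Dom A g) (Cod A k)"
    using g by (simp add: Hom_iff)
  moreover have "Zer A (Dom A g) (Dom A k) \<in> Hom A (Dom A g) (Dom A k) \<and>
      k \<cdot> Zer A (Dom A g) (Dom A k) = Zer A (Dom A g) (Cod A k)"
    using g k by (simp add: Hom_iff)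
  ultimately show "g = Zer A (Dom A g) (Dom A k)" by blast
qed

lemma cokernel_epi:
  assumes "is_cokernel A f c" shows "is_epi A c"
  unfolding epi_iff
proof (intro conjI ballI impI)
  show c: "c \<in> Arr A" using assms by (simp add: is_cokernel_def)
  fix g assume g: "g \<in> Arr A" "Dom A g = Cod A c" "g \<cdot> c = Zer A (Dom A c) (Cod A g)"
  have f: "f \<in> Arr A" "Dom A c = Cod A f" using assms by (auto simp: is_cokernel_def)
  have "\<exists>!h. h \<in> Hom A (Cod A c) (Cod A g) \<and> h \<cdot> c = Zer A (Dom A c) (Cod A g)"
    using assms f g(1) unfolding is_cokernel_def by (auto simp: Hom_iff)
  moreover have "g \<in> Hom A (Cod A c) (Cod A g) \<and> g \<cdot> c = Zer A (Dom A c) (Cod A g)"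
    using g by (simp add: Hom_iff)
  moreover have "Zer A (Cod A c) (Cod A g) \<in> Hom A (Cod A c) (Cod A g) \<and>
      Zer A (Cod A c) (Cod A g) \<cdot> c = Zer A (Dom A c) (Cod A g)"
    using g c by (simp add: Hom_iff)
  ultimately show "g = Zer A (Cod A c) (Cod A g)" by blast
qed

lemma mono_comp:
  assumes "is_mono A f" "is_mono A g" "Cod A f = Dom A g" shows "is_mono A (g \<cdot> f)"
proof -
  have fg: "f \<in> Arr A" "g \<in> Arr A" using assms by (auto simp: is_mono_def)
  have *: "h = h'" if "h \<in> Arr A" "h' \<in> Arr A" "Cod A h = Dom A f" "Cod A h' = Dom A f"
    "Dom A h = Dom A h'" "(g \<cdot> f) \<cdot> h = (g \<cdot> f) \<cdot> h'" for h h'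
    by (rule mono_cancel[OF assms(1)], rule mono_cancel[OF assms(2)])
      (use that fg assms(3) in simp_all)
  show ?thesis
    unfolding is_mono_def
  proof (intro conjI allI ballI impI)
    fix W h h' assume "h \<in> Hom A W (Dom A (g \<cdot> f))" "h' \<in> Hom A W (Dom A (g \<cdot> f))"
      and eq: "(g \<cdot> f) \<cdot> h = (g \<cdot> f) \<cdot> h'"
    then show "h = h'" using fg assms(3) by (intro *[OF _ _ _ _ _ eq]) (simp_all add: Hom_iff)
  qed (use fg assms(3) in simp)
qed

lemma projective_lift:
  assumes "projective A (Dom A f)" "is_epi A e" "f \<in> Arr A" "Cod A f = Cod A e"
  obtains g where "g \<in> Arr A" "Dom A g = Dom A f" "Cod A g = Dom A e" "e \<cdot> g = f"
proof -
  have "f \<in> Hom A (Dom A f) (Cod A e)" using assms by (simp add: Hom_iff)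
  then have "\<exists>g\<in>Hom A (Dom A f) (Dom A e). e \<cdot> g = f"
    using assms(1,2) unfolding projective_def by blast
  then show ?thesis using that by (auto simp: Hom_iff)
qed

text \<open>A lift of \<open>f \<cdot> r\<close>, restricted along \<open>k\<close>, lifts \<open>f\<close>.\<close>

lemma projective_retract:
  assumes P: "projective A P" and k: "k \<in> Arr A" "Dom A k = X" "Cod A k = P"
    and r: "r \<in> Arr A" "Dom A r = P" "Cod A r = X" and rk: "r \<cdot> k = Idn A X"
  shows "projective A X"
  unfolding projective_def
proof (intro conjI allI impI ballI)
  show "X \<in> Obj A" using k by auto
  fix e f assume e: "is_epi A e" and f: "f \<in> Hom A X (Cod A e)"
  obtain g where g: "g \<in> Arr A" "Dom A g = P" "Cod A g = Dom A e" "e \<cdot> g = f \<cdot> r"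
    using projective_lift[of "f \<cdot> r" e] P e f r by (auto simp: Hom_iff)
  have "e \<in> Arr A" using e by (simp add: is_epi_def)
  then have "e \<cdot> (g \<cdot> k) = f"
    using comp_assoc_eq[OF g(4), of k] g k r rk f by (simp add: Hom_iff)
  then show "\<exists>g\<in>Hom A X (Dom A e). e \<cdot> g = f"
    using g k by (intro bexI[of _ "g \<cdot> k"]) (auto simp: Hom_iff)
qed

lemma zero_projective: "is_zero A Z \<Longrightarrow> projective A Z"
  unfolding projective_def
proof (intro conjI allI impI ballI)
  assume z: "is_zero A Z"
  then show Z: "Z \<in> Obj A" by (rule is_zero_Obj)
  fix e f assume e: "is_epi A e" and f: "f \<in> Hom A Z (Cod A e)"
  then have "f = Zer A Z (Cod A e)" using from_zero[OF z, of f] by (simp add: Hom_iff)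
  then show "\<exists>g\<in>Hom A Z (Dom A e). e \<cdot> g = f"
    using e Z by (intro bexI[of _ "Zer A Z (Dom A e)"]) (auto simp: Hom_iff is_epi_def)
qed

end

context abelian_category
begin

lemma ker_is_kernel: "f \<in> Arr A \<Longrightarrow> is_kernel A f (ker A f)"
  unfolding ker_def by (rule someI_ex) (rule kernel_exists)

lemma coker_is_cokernel: "f \<in> Arr A \<Longrightarrow> is_cokernel A f (coker A f)"
  unfolding coker_def by (rule someI_ex) (rule cokernel_exists)

lemma zero_ob_zero [simp]: "is_zero A (zero_ob A)"
  unfolding zero_ob_def by (rule someI_ex) (rule zero_exists)

lemma zero_ob_Obj [simp]: "zero_ob A \<in> Obj A"
  using zero_ob_zero by (rule is_zero_Obj)

text \<open>The factor \<open>e\<close> is epic because \<open>k\<close> is the least subobject through which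
  \<open>b\<close> factors: if \<open>g \<cdot> e = 0\<close>, then \<open>b\<close> factors through the
  smaller subobject \<open>k \<cdot> m\<close> with \<open>m = ker g\<close>. As a monomorphism,
  \<open>k \<cdot> m\<close> is the kernel of some \<open>h\<close>; since \<open>h\<close> kills
  \<open>b\<close> it factors through \<open>c\<close>, so it kills \<open>k\<close>, and
  \<open>m\<close> is split epic.\<close>

lemma image_factor:
  assumes c: "is_cokernel A b c" and k: "is_kernel A c k"
  obtains e where "e \<in> Arr A" "Dom A e = Dom A b" "Cod A e = Dom A k" "k \<cdot> e = b" "is_epi A e"
proof -
  have b: "b \<in> Arr A" "c \<in> Arr A" "Dom A c = Cod A b" "c \<cdot> b = Zer A (Dom A b) (Cod A c)"
    using c by (auto simp: is_cokernel_def)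
  have kk: "k \<in> Arr A" "Cod A k = Dom A c" "c \<cdot> k = Zer A (Dom A k) (Cod A c)"
    using k by (auto simp: is_kernel_def)
  obtain e where e: "e \<in> Arr A" "Dom A e = Dom A b" "Cod A e = Dom A k" "k \<cdot> e = b"
    using kernel_lift[OF k, of b] b by auto
  have "g = Zer A (Cod A e) (Cod A g)"
    if g: "g \<in> Arr A" "Dom A g = Cod A e" "g \<cdot> e = Zer A (Dom A e) (Cod A g)" for g
  proof -
    define m where "m = ker A g"
    have m: "is_kernel A g m" using ker_is_kernel g m_def by simp
    then have mm: "m \<in> Arr A" "Cod A m = Dom A g" "g \<cdot> m = Zer A (Dom A m) (Cod A g)"
      by (auto simp: is_kernel_def)
    obtain e' where e': "e' \<in> Arr A" "Dom A e' = Dom A e" "Cod A e' = Dom A m" "m \<cdot> e' = e"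
      using kernel_lift[OF m, of e] e g by auto
    have "is_mono A (k \<cdot> m)"
      by (rule mono_comp[OF kernel_mono[OF m] kernel_mono[OF k]]) (use mm g e in simp)
    then obtain h where h: "is_kernel A h (k \<cdot> m)" using mono_kernel by blast
    then have hh: "h \<in> Arr A" "Dom A h = Cod A k" "h \<cdot> (k \<cdot> m) = Zer A (Dom A m) (Cod A h)"
      using mm g e kk by (auto simp: is_kernel_def)
    have "h \<cdot> b = (h \<cdot> (k \<cdot> m)) \<cdot> e'"
      using e e' hh(1,2) kk mm g b by simp
    then have "h \<cdot> b = Zer A (Dom A b) (Cod A h)"
      unfolding hh(3) using e e' hh mm by simp
    then obtain h' where h': "h' \<in> Arr A" "Dom A h' = Cod A c" "Cod A h' = Cod A h" "h' \<cdot> c = h"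
      using cokernel_lift[OF c, of h] hh kk b by auto
    have "h \<cdot> k = h' \<cdot> (c \<cdot> k)" using comp_assoc_eq[OF h'(4), of k] h'(1-3) kk(1,2) b(1-3) by simp
    then have "h \<cdot> k = Zer A (Dom A k) (Cod A h)" using h' kk b by simp
    then obtain n where n: "n \<in> Arr A" "Dom A n = Dom A k" "Cod A n = Dom A (k \<cdot> m)" "(k \<cdot> m) \<cdot> n = k"
      using kernel_lift[OF h, of k] hh kk by auto
    have "m \<cdot> n = Idn A (Dom A k)"
      by (rule mono_cancel[OF kernel_mono[OF k]]) (use n mm kk g e in simp_all)
    then have "g = g \<cdot> (m \<cdot> n)" using g e kk by simp
    also have "\<dots> = Zer A (Dom A k) (Cod A g)"
      using comp_assoc_eq[OF mm(3), of n] n mm kk g e by simp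
    finally show ?thesis using e by simp
  qed
  then have "is_epi A e" unfolding epi_iff using e by blast
  then show ?thesis using that e by blast
qed

text \<open>Exactness of \<open>Hom(Q, -)\<close> for projective \<open>Q\<close>: the arrow \<open>z\<close>
  lands in the kernel of the cokernel of \<open>b\<close>, which is the image of \<open>b\<close>, and
  lifts along the epimorphism onto that image.\<close>

lemma projective_exact:
  assumes c: "is_cokernel A b c" and z: "z \<in> Arr A" "Cod A z = Cod A b"
    "c \<cdot> z = Zer A (Dom A z) (Cod A c)" and Q: "projective A (Dom A z)"
  obtains y where "y \<in> Arr A" "Dom A y = Dom A z" "Cod A y = Dom A b" "b \<cdot> y = z"
proof -
  have b: "b \<in> Arr A" "c \<in> Arr A" "Dom A c = Cod A b"
    using c by (auto simp: is_cokernel_def)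
  have k: "is_kernel A c (ker A c)" using ker_is_kernel b by simp
  have kA: "ker A c \<in> Arr A" using k by (simp add: is_kernel_def)
  obtain e where e: "e \<in> Arr A" "Dom A e = Dom A b" "Cod A e = Dom A (ker A c)"
      "ker A c \<cdot> e = b" "is_epi A e" by (rule image_factor[OF c k])
  obtain w where w: "w \<in> Arr A" "Dom A w = Dom A z" "Cod A w = Dom A (ker A c)" "ker A c \<cdot> w = z"
    using kernel_lift[OF k, of z] z b by auto
  obtain y where y: "y \<in> Arr A" "Dom A y = Dom A w" "Cod A y = Dom A e" "e \<cdot> y = w"
    using projective_lift[of w e] w e Q by auto
  have "b \<cdot> y = ker A c \<cdot> (e \<cdot> y)"
    using comp_assoc_eq[OF e(4), of y] y(1-3) e(1-3) kA by simp
  then show ?thesis using that[of y] y w e by simp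
qed

text \<open>The monomorphism \<open>f\<close> is the kernel of some \<open>g\<close>, and \<open>g = 0\<close>
  because \<open>f\<close> is epic; so the identity factors through \<open>f\<close>.\<close>

lemma iso_if_mono_epi:
  assumes "is_mono A f" "is_epi A f" shows "is_iso A f"
proof -
  have f: "f \<in> Arr A" using assms by (simp add: is_mono_def)
  obtain g where g: "is_kernel A g f" using mono_kernel assms by blast
  then have gg: "g \<in> Arr A" "Dom A g = Cod A f" "g \<cdot> f = Zer A (Dom A f) (Cod A g)"
    by (auto simp: is_kernel_def)
  then have "g = Zer A (Cod A f) (Cod A g)" using assms(2) by (simp add: epi_iff)
  then have "g \<cdot> Idn A (Cod A f) = Zer A (Cod A f) (Cod A g)" using gg f by simp
  then obtain h where h: "h \<in> Arr A" "Dom A h = Cod A f" "Cod A h = Dom A f" "f \<cdot> h = Idn A (Cod A f)"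
    using kernel_lift[OF g, of "Idn A (Cod A f)"] gg f by auto
  have "h \<cdot> f = Idn A (Dom A f)"
    by (rule mono_cancel[OF assms(1)]) (use h f comp_assoc_eq[OF h(4), of f] in simp_all)
  then show ?thesis unfolding is_iso_def using f h by (auto simp: Hom_iff)
qed

lemma biprod_is_biproduct: "\<lbrakk>X \<in> Obj A; Y \<in> Obj A\<rbrakk> \<Longrightarrow> is_biproduct A X Y (biprod A X Y)"
  unfolding biprod_def by (rule someI_ex) (rule biproduct_exists)

lemma dirsum_biproduct:
  "\<lbrakk>X \<in> Obj A; Y \<in> Obj A\<rbrakk> \<Longrightarrow>
    is_biproduct A X Y (dirsum A X Y, in1 A X Y, in2 A X Y, pr1 A X Y, pr2 A X Y)"
  using biprod_is_biproduct[of X Y]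
  by (auto simp: dirsum_def in1_def in2_def pr1_def pr2_def split: prod.split)

lemma dirsum_simps [simp]:
  assumes "X \<in> Obj A" "Y \<in> Obj A"
  shows "dirsum A X Y \<in> Obj A"
    "in1 A X Y \<in> Arr A" "Dom A (in1 A X Y) = X" "Cod A (in1 A X Y) = dirsum A X Y"
    "in2 A X Y \<in> Arr A" "Dom A (in2 A X Y) = Y" "Cod A (in2 A X Y) = dirsum A X Y"
    "pr1 A X Y \<in> Arr A" "Dom A (pr1 A X Y) = dirsum A X Y" "Cod A (pr1 A X Y) = X"
    "pr2 A X Y \<in> Arr A" "Dom A (pr2 A X Y) = dirsum A X Y" "Cod A (pr2 A X Y) = Y"
    "pr1 A X Y \<cdot> in1 A X Y = Idn A X" "pr2 A X Y \<cdot> in2 A X Y = Idn A Y"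
    "pr2 A X Y \<cdot> in1 A X Y = Zer A X Y" "pr1 A X Y \<cdot> in2 A X Y = Zer A Y X"
  using dirsum_biproduct[OF assms] by (auto simp: is_biproduct_def Hom_iff)

lemma dirsum_comp_simps [simp]:
  assumes "X \<in> Obj A" "Y \<in> Obj A" "f \<in> Arr A"
  shows "Cod A f = X \<Longrightarrow> pr1 A X Y \<cdot> (in1 A X Y \<cdot> f) = f"
    "Cod A f = X \<Longrightarrow> pr2 A X Y \<cdot> (in1 A X Y \<cdot> f) = Zer A (Dom A f) Y"
    "Cod A f = Y \<Longrightarrow> pr1 A X Y \<cdot> (in2 A X Y \<cdot> f) = Zer A (Dom A f) X"
    "Cod A f = Y \<Longrightarrow> pr2 A X Y \<cdot> (in2 A X Y \<cdot> f) = f"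
  using assms by (auto simp flip: comp_assoc)

lemma dirsum_ext:
  assumes "X \<in> Obj A" "Y \<in> Obj A" "c \<in> Arr A" "c' \<in> Arr A" "Dom A c = Dom A c'"
    "Cod A c = dirsum A X Y" "Cod A c' = dirsum A X Y"
    "pr1 A X Y \<cdot> c = pr1 A X Y \<cdot> c'" "pr2 A X Y \<cdot> c = pr2 A X Y \<cdot> c'"
  shows "c = c'"
proof -
  have *: "x = in1 A X Y \<cdot> (pr1 A X Y \<cdot> x) \<boxplus> in2 A X Y \<cdot> (pr2 A X Y \<cdot> x)"
    if "x \<in> Arr A" "Cod A x = dirsum A X Y" for x
  proof -
    have "(in1 A X Y \<cdot> pr1 A X Y) \<boxplus> (in2 A X Y \<cdot> pr2 A X Y) = Idn A (dirsum A X Y)"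
      using dirsum_biproduct[OF assms(1,2)] by (auto simp: is_biproduct_def)
    then have "x = ((in1 A X Y \<cdot> pr1 A X Y) \<boxplus> (in2 A X Y \<cdot> pr2 A X Y)) \<cdot> x"
      using that by simp
    then show ?thesis using that assms(1,2) by simp
  qed
  show ?thesis using *[OF assms(3,6)] *[OF assms(4,7)] assms(8,9) by simp
qed

lemma dirsum_zero:
  assumes "is_zero A X" "is_zero A Y" shows "is_zero A (dirsum A X Y)"
proof -
  have O: "X \<in> Obj A" "Y \<in> Obj A" using assms is_zero_Obj by auto
  have "Idn A (dirsum A X Y) = Zer A (dirsum A X Y) (dirsum A X Y)"
    by (rule dirsum_ext[OF O])
      (use O to_zero[OF assms(1), of "pr1 A X Y"] to_zero[OF assms(2), of "pr2 A X Y"] in simp_all)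
  then show ?thesis using O by (simp add: is_zero_iff)
qed

lemma dirsum_zero_left:
  assumes "is_zero A (dirsum A X Y)" "X \<in> Obj A" "Y \<in> Obj A" shows "is_zero A X"
proof -
  have "in1 A X Y = Zer A X (dirsum A X Y)" using to_zero[OF assms(1), of "in1 A X Y"] assms by simp
  then have "pr1 A X Y \<cdot> in1 A X Y = Zer A X X" using assms(2,3) by (simp del: dirsum_simps(14))
  then show ?thesis using assms by (simp add: is_zero_iff)
qed

lemma dpow_Obj [simp]: "M \<in> Obj A \<Longrightarrow> dpow A M a \<in> Obj A"
  by (induction a) simp_all

lemma dpow_zero: "is_zero A M \<Longrightarrow> is_zero A (dpow A M a)"
  by (induction a) (auto intro: dirsum_zero)

lemma dpow_zero_iff: "\<lbrakk>M \<in> Obj A; \<not> is_zero A M\<rbrakk> \<Longrightarrow> is_zero A (dpow A M a) \<longleftrightarrow> a = 0"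
  by (cases a) (auto dest: dirsum_zero_left)

end

locale abelian_enough_projectives = abelian_category +
  assumes enough: "enough_projectives A"
begin

lemma projective_cover:
  assumes "X \<in> Obj A"
  obtains e where "e \<in> Arr A" "projective A (Dom A e)" "Cod A e = X" "is_epi A e"
proof -
  obtain P e where "projective A P" "e \<in> Hom A P X" "is_epi A e"
    using assms enough unfolding enough_projectives_def by blast
  then show ?thesis using that by (auto simp: Hom_iff)
qed

text \<open>With enough projectives, arrows out of projective objects can be used as if they were elements: they
  detect monomorphisms and epimorphisms, and by the lifting property exact sequences stay exact on them.
  This makes diagram chases possible without passing to refinements of the test object.\<close>

lemma mono_if_elements:
  assumes f: "f \<in> Arr A"
    and el: "\<And>q. \<lbrakk>q \<in> Arr A; projective A (Dom A q); Cod A q = Dom A f;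
      f \<cdot> q = Zer A (Dom A q) (Cod A f)\<rbrakk> \<Longrightarrow> q = Zer A (Dom A q) (Dom A f)"
  shows "is_mono A f"
  unfolding mono_iff
proof (intro conjI ballI impI f)
  fix g assume g: "g \<in> Arr A" "Cod A g = Dom A f" "f \<cdot> g = Zer A (Dom A g) (Cod A f)"
  obtain e where e: "e \<in> Arr A" "projective A (Dom A e)" "Cod A e = Dom A g" "is_epi A e"
    using projective_cover[of "Dom A g"] g by auto
  have "f \<cdot> (g \<cdot> e) = Zer A (Dom A e) (Cod A f)"
    using comp_assoc_eq[OF g(3), of e] g e f by simp
  then have "g \<cdot> e = Zer A (Dom A e) (Cod A g)" using el[of "g \<cdot> e"] e g by simp
  then show "g = Zer A (Dom A g) (Dom A f)"
    using e g unfolding epi_iff by metis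
qed

lemma epi_if_elements:
  assumes f: "f \<in> Arr A"
    and el: "\<And>q. \<lbrakk>q \<in> Arr A; projective A (Dom A q); Cod A q = Cod A f\<rbrakk>
      \<Longrightarrow> \<exists>p \<in> Arr A. Dom A p = Dom A q \<and> Cod A p = Dom A f \<and> f \<cdot> p = q"
  shows "is_epi A f"
  unfolding epi_iff
proof (intro conjI ballI impI f)
  fix g assume g: "g \<in> Arr A" "Dom A g = Cod A f" "g \<cdot> f = Zer A (Dom A f) (Cod A g)"
  obtain e where e: "e \<in> Arr A" "projective A (Dom A e)" "Cod A e = Cod A f" "is_epi A e"
    using projective_cover[of "Cod A f"] f by auto
  obtain p where p: "p \<in> Arr A" "Dom A p = Dom A e" "Cod A p = Dom A f" "f \<cdot> p = e"
    using el[of e] e by auto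
  have "g \<cdot> e = Zer A (Dom A e) (Cod A g)"
    using comp_assoc_eq[OF g(3), of p] g p f by simp
  then show "g = Zer A (Cod A f) (Cod A g)"
    using e g unfolding epi_iff by metis
qed

end


section \<open>Homology in terms of cycles and boundaries\<close>

context preadditive_category
begin

lemma complexD [simp]:
  assumes "is_complex A X"
  shows "ob X i \<in> Obj A" "df X i \<in> Arr A" "Dom A (df X i) = ob X i" "Cod A (df X i) = ob X (i - 1)"
  using assms by (auto simp: is_complex_def Hom_iff)

lemma complex_dd [simp]:
  "\<lbrakk>is_complex A X; j = i - 1\<rbrakk> \<Longrightarrow> df X j \<cdot> df X i = Zer A (ob X i) (ob X (j - 1))"
  unfolding is_complex_def by simp

lemma complex_dd_comp [simp]:
  "\<lbrakk>is_complex A X; j = i - 1; y \<in> Arr A; Cod A y = ob X i\<rbrakk>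
    \<Longrightarrow> df X j \<cdot> (df X i \<cdot> y) = Zer A (Dom A y) (ob X (j - 1))"
  using comp_assoc_eq[OF complex_dd[of X j i], of y] by simp

lemma complexI:
  assumes "\<And>i. ob X i \<in> Obj A" "\<And>i. df X i \<in> Arr A" "\<And>i. Dom A (df X i) = ob X i"
    "\<And>i. Cod A (df X i) = ob X (i - 1)"
    "\<And>i. df X (i - 1) \<cdot> df X i = Zer A (ob X i) (ob X (i - 1 - 1))"
  shows "is_complex A X"
  unfolding is_complex_def Hom_iff by (intro allI conjI assms)

lemma chain_mapD:
  assumes "is_chain_map A (X, Y, f)"
  shows "is_complex A X" "is_complex A Y" "f i \<in> Arr A" "Dom A (f i) = ob X i" "Cod A (f i) = ob Y i"
    "df Y i \<cdot> f i = f (i - 1) \<cdot> df X i"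
  using assms by (auto simp: is_chain_map_def Hom_iff)

lemma chain_mapI:
  assumes "is_complex A X" "is_complex A Y"
    "\<And>i. f i \<in> Arr A" "\<And>i. Dom A (f i) = ob X i" "\<And>i. Cod A (f i) = ob Y i"
    "\<And>i. df Y i \<cdot> f i = f (i - 1) \<cdot> df X i"
  shows "is_chain_map A (X, Y, f)"
  using assms by (auto simp: is_chain_map_def Hom_iff)

lemma chain_map_comm:
  assumes "is_chain_map A (X, Y, f)" "x \<in> Arr A" "Cod A x = ob X i"
  shows "df Y i \<cdot> (f i \<cdot> x) = f (i - 1) \<cdot> (df X i \<cdot> x)"
  using comp_assoc_eq[OF chain_mapD(6)[OF assms(1)], of i x] chain_mapD(1-5)[OF assms(1)] assms(2,3)
  by simp

text \<open>Elements of a complex in degree \<open>i\<close> are arrows into \<open>ob X i\<close> from an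
  arbitrary object.\<close>

definition cycle :: "(_, _) cx \<Rightarrow> int \<Rightarrow> _ \<Rightarrow> bool" where
  "cycle X i x \<longleftrightarrow> x \<in> Arr A \<and> Cod A x = ob X i \<and> df X i \<cdot> x = Zer A (Dom A x) (ob X (i - 1))"

definition boundary :: "(_, _) cx \<Rightarrow> int \<Rightarrow> _ \<Rightarrow> bool" where
  "boundary X i x \<longleftrightarrow> (\<exists>y \<in> Arr A. Dom A y = Dom A x \<and> Cod A y = ob X (i + 1) \<and> df X (i + 1) \<cdot> y = x)"

lemma cycleD:
  assumes "cycle X i x"
  shows "x \<in> Arr A" "Cod A x = ob X i" "df X i \<cdot> x = Zer A (Dom A x) (ob X (i - 1))"
  using assms by (auto simp: cycle_def)

lemma boundaryI: "\<lbrakk>y \<in> Arr A; is_complex A X; Cod A y = ob X (i + 1)\<rbrakk> \<Longrightarrow> boundary X i (df X (i + 1) \<cdot> y)"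
  by (auto simp: boundary_def)

lemma cycle_comp: "\<lbrakk>is_complex A X; cycle X i x; e \<in> Arr A; Cod A e = Dom A x\<rbrakk> \<Longrightarrow> cycle X i (x \<cdot> e)"
  unfolding cycle_def using comp_assoc_eq[of "df X i" x "Zer A (Dom A x) (ob X (i - 1))" e] by auto

lemma cycle_add:
  "\<lbrakk>is_complex A X; cycle X i x; cycle X i y; Dom A x = Dom A y\<rbrakk> \<Longrightarrow> cycle X i (x \<boxplus> y)"
  unfolding cycle_def by auto

lemma cycle_neg: "\<lbrakk>is_complex A X; cycle X i x\<rbrakk> \<Longrightarrow> cycle X i (Neg A x)"
  unfolding cycle_def by auto

lemma boundary_add:
  assumes "is_complex A X" "boundary X i x" "boundary X i y" "Dom A x = Dom A y"
  shows "boundary X i (x \<boxplus> y)"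
proof -
  obtain u v where "u \<in> Arr A" "Dom A u = Dom A x" "Cod A u = ob X (i + 1)" "df X (i + 1) \<cdot> u = x"
    "v \<in> Arr A" "Dom A v = Dom A y" "Cod A v = ob X (i + 1)" "df X (i + 1) \<cdot> v = y"
    using assms(2,3) unfolding boundary_def by blast
  then show ?thesis
    using assms(1,4) boundaryI[of "u \<boxplus> v" X i] by simp
qed

lemma cycle_map:
  "\<lbrakk>is_chain_map A (X, Y, f); cycle X i x\<rbrakk> \<Longrightarrow> cycle Y i (f i \<cdot> x)"
  using chain_map_comm[of X Y f x i] chain_mapD(1-5)[of X Y f]
  unfolding cycle_def by simp

lemma boundary_map:
  assumes f: "is_chain_map A (X, Y, f)" and x: "boundary X i x" shows "boundary Y i (f i \<cdot> x)"
proof -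
  obtain u where u: "u \<in> Arr A" "Dom A u = Dom A x" "Cod A u = ob X (i + 1)" "df X (i + 1) \<cdot> u = x"
    using x unfolding boundary_def by blast
  have "df Y (i + 1) \<cdot> (f (i + 1) \<cdot> u) = f i \<cdot> x"
    using chain_map_comm[OF f u(1,3)] u by simp
  then show ?thesis
    using u chain_mapD(1-5)[OF f] boundaryI[of "f (i + 1) \<cdot> u" Y i] by simp
qed

end

context abelian_category
begin

lemma cycles_kernel: "is_complex A X \<Longrightarrow> is_kernel A (df X i) (cycles A X i)"
  unfolding cycles_def by (rule ker_is_kernel) simp

lemma cycles_simps [simp]:
  assumes "is_complex A X"
  shows "cycles A X i \<in> Arr A" "Cod A (cycles A X i) = ob X i"
    "df X i \<cdot> cycles A X i = Zer A (Dom A (cycles A X i)) (ob X (i - 1))"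
  using cycles_kernel[OF assms, of i] assms by (auto simp: is_kernel_def)

lemma cycle_cycles: "is_complex A X \<Longrightarrow> cycle X i (cycles A X i)"
  by (simp add: cycle_def)

lemma cycle_factor:
  assumes X: "is_complex A X" and x: "cycle X i x"
  shows "\<exists>!z. z \<in> Hom A (Dom A x) (Dom A (cycles A X i)) \<and> cycles A X i \<cdot> z = x"
proof -
  obtain z where z: "z \<in> Arr A" "Dom A z = Dom A x" "Cod A z = Dom A (cycles A X i)" "cycles A X i \<cdot> z = x"
    using kernel_lift[OF cycles_kernel[OF X], of x i] X cycleD[OF x] by auto
  show ?thesis
  proof (rule ex1I[of _ z])
    fix w assume "w \<in> Hom A (Dom A x) (Dom A (cycles A X i)) \<and> cycles A X i \<cdot> w = x"
    then show "w = z"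
      by (intro mono_cancel[OF kernel_mono[OF cycles_kernel[OF X, of i]], of w z])
        (use z in \<open>simp_all add: Hom_iff\<close>)
  qed (use z in \<open>simp add: Hom_iff\<close>)
qed

lemma bdry_simps [simp]:
  assumes X: "is_complex A X"
  shows "bdry A X i \<in> Arr A" "Dom A (bdry A X i) = ob X (i + 1)"
    "Cod A (bdry A X i) = Dom A (cycles A X i)" "cycles A X i \<cdot> bdry A X i = df X (i + 1)"
proof -
  have "cycle X i (df X (i + 1))" using X by (simp add: cycle_def)
  from theI'[OF cycle_factor[OF X this]]
  show "bdry A X i \<in> Arr A" "Dom A (bdry A X i) = ob X (i + 1)"
    "Cod A (bdry A X i) = Dom A (cycles A X i)" "cycles A X i \<cdot> bdry A X i = df X (i + 1)"
    using X unfolding bdry_def by (simp_all add: Hom_iff)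
qed

lemma homol_proj_cokernel: "is_complex A X \<Longrightarrow> is_cokernel A (bdry A X i) (homol_proj A X i)"
  unfolding homol_proj_def by (rule coker_is_cokernel) simp

lemma homol_proj_simps [simp]:
  assumes X: "is_complex A X"
  shows "homol_proj A X i \<in> Arr A" "Dom A (homol_proj A X i) = Dom A (cycles A X i)"
    "Cod A (homol_proj A X i) = homol A X i"
    "homol_proj A X i \<cdot> bdry A X i = Zer A (ob X (i + 1)) (homol A X i)"
  using homol_proj_cokernel[OF X, of i] X by (auto simp: is_cokernel_def homol_def)

lemma homol_Obj [simp]: "is_complex A X \<Longrightarrow> homol A X i \<in> Obj A"
  using Cod_in_Obj[of "homol_proj A X i"] by (simp del: Cod_in_Obj)

text \<open>The homology class of a cycle \<open>x\<close>: its factorization through the kernel of the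
  differential, followed by the projection onto homology.\<close>

definition hclass :: "(_, _) cx \<Rightarrow> int \<Rightarrow> _ \<Rightarrow> _" where
  "hclass X i x = homol_proj A X i \<cdot>
     (THE z. z \<in> Hom A (Dom A x) (Dom A (cycles A X i)) \<and> cycles A X i \<cdot> z = x)"

lemma hclass_eq:
  assumes X: "is_complex A X" and z: "z \<in> Arr A" "Cod A z = Dom A (cycles A X i)"
  shows "hclass X i (cycles A X i \<cdot> z) = homol_proj A X i \<cdot> z"
proof -
  have "(THE z'. z' \<in> Hom A (Dom A (cycles A X i \<cdot> z)) (Dom A (cycles A X i)) \<and>
      cycles A X i \<cdot> z' = cycles A X i \<cdot> z) = z"
    by (rule the1_equality[OF cycle_factor[OF X cycle_comp[OF X cycle_cycles[OF X]]]])
      (use X z in \<open>simp_all add: Hom_iff\<close>)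
  then show ?thesis unfolding hclass_def by simp
qed

lemma cycleE:
  assumes "is_complex A X" "cycle X i x"
  obtains z where "z \<in> Arr A" "Dom A z = Dom A x" "Cod A z = Dom A (cycles A X i)"
    "x = cycles A X i \<cdot> z" "hclass X i x = homol_proj A X i \<cdot> z"
proof -
  obtain z where "z \<in> Arr A" "Dom A z = Dom A x" "Cod A z = Dom A (cycles A X i)" "x = cycles A X i \<cdot> z"
    using ex1_implies_ex[OF cycle_factor[OF assms]] by (auto simp: Hom_iff)
  then show ?thesis using that hclass_eq[OF assms(1)] by metis
qed

lemma hclass_simps [simp]:
  assumes "is_complex A X" "cycle X i x"
  shows "hclass X i x \<in> Arr A" "Dom A (hclass X i x) = Dom A x" "Cod A (hclass X i x) = homol A X i"
  by (rule cycleE[OF assms], use assms(1) in simp)+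

lemma hclass_comp:
  assumes X: "is_complex A X" and x: "cycle X i x" and e: "e \<in> Arr A" "Cod A e = Dom A x"
  shows "hclass X i (x \<cdot> e) = hclass X i x \<cdot> e"
proof (rule cycleE[OF X x])
  fix z assume z: "z \<in> Arr A" "Dom A z = Dom A x" "Cod A z = Dom A (cycles A X i)"
    "x = cycles A X i \<cdot> z" "hclass X i x = homol_proj A X i \<cdot> z"
  have "x \<cdot> e = cycles A X i \<cdot> (z \<cdot> e)" unfolding z(4) using z(1-3) e X by simp
  then have "hclass X i (x \<cdot> e) = homol_proj A X i \<cdot> (z \<cdot> e)"
    using hclass_eq[OF X, of "z \<cdot> e"] z(1-3) e by simp
  also have "\<dots> = hclass X i x \<cdot> e" unfolding z(5) using z(1-3) e X by simp
  finally show ?thesis .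
qed

lemma hclass_add:
  assumes X: "is_complex A X" and x: "cycle X i x" "cycle X i y" "Dom A x = Dom A y"
  shows "hclass X i (x \<boxplus> y) = hclass X i x \<boxplus> hclass X i y"
proof (rule cycleE[OF X x(1)], rule cycleE[OF X x(2)])
  fix z w assume z: "z \<in> Arr A" "Dom A z = Dom A x" "Cod A z = Dom A (cycles A X i)"
    "x = cycles A X i \<cdot> z" "hclass X i x = homol_proj A X i \<cdot> z"
   and w: "w \<in> Arr A" "Dom A w = Dom A y" "Cod A w = Dom A (cycles A X i)"
    "y = cycles A X i \<cdot> w" "hclass X i y = homol_proj A X i \<cdot> w"
  have "x \<boxplus> y = cycles A X i \<cdot> (z \<boxplus> w)" unfolding z(4) w(4) using z(1-3) w(1-3) x(3) X by simp
  then have "hclass X i (x \<boxplus> y) = homol_proj A X i \<cdot> (z \<boxplus> w)"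
    using hclass_eq[OF X, of "z \<boxplus> w"] z(1-3) w(1-3) x(3) by simp
  also have "\<dots> = hclass X i x \<boxplus> hclass X i y" unfolding z(5) w(5) using z(1-3) w(1-3) x(3) X by simp
  finally show ?thesis .
qed

lemma hclass_neg:
  assumes X: "is_complex A X" and x: "cycle X i x"
  shows "hclass X i (Neg A x) = Neg A (hclass X i x)"
proof (rule cycleE[OF X x])
  fix z assume z: "z \<in> Arr A" "Dom A z = Dom A x" "Cod A z = Dom A (cycles A X i)"
    "x = cycles A X i \<cdot> z" "hclass X i x = homol_proj A X i \<cdot> z"
  have "Neg A x = cycles A X i \<cdot> Neg A z" unfolding z(4) using z(1-3) X by simp
  then have "hclass X i (Neg A x) = homol_proj A X i \<cdot> Neg A z"
    using hclass_eq[OF X, of "Neg A z"] z(1-3) by simp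
  also have "\<dots> = Neg A (hclass X i x)" unfolding z(5) using z(1-3) X by simp
  finally show ?thesis .
qed

lemma hclass_boundary:
  assumes X: "is_complex A X" and x: "boundary X i x"
  shows "hclass X i x = Zer A (Dom A x) (homol A X i)"
proof -
  obtain y where y: "y \<in> Arr A" "Dom A y = Dom A x" "Cod A y = ob X (i + 1)" "df X (i + 1) \<cdot> y = x"
    using x unfolding boundary_def by blast
  have "cycles A X i \<cdot> (bdry A X i \<cdot> y) = x"
    using comp_assoc_eq[OF bdry_simps(4)[OF X], of i y] y X by simp
  then have "hclass X i x = homol_proj A X i \<cdot> (bdry A X i \<cdot> y)"
    using hclass_eq[OF X, of "bdry A X i \<cdot> y" i] y(1-3) X by simp
  also have "\<dots> = Zer A (ob X (i + 1)) (homol A X i) \<cdot> y"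
    by (rule comp_assoc_eq) (use X y in simp_all)
  also have "\<dots> = Zer A (Dom A x) (homol A X i)" using X y by simp
  finally show ?thesis .
qed

text \<open>The domain has to be projective because the preimage under the differential is found by lifting along
  an epimorphism.\<close>

lemma boundary_if_hclass_zero:
  assumes X: "is_complex A X" and x: "cycle X i x" "projective A (Dom A x)"
    and zero: "hclass X i x = Zer A (Dom A x) (homol A X i)"
  shows "boundary X i x"
proof (rule cycleE[OF X x(1)])
  fix z assume z: "z \<in> Arr A" "Dom A z = Dom A x" "Cod A z = Dom A (cycles A X i)"
    "x = cycles A X i \<cdot> z" "hclass X i x = homol_proj A X i \<cdot> z"
  obtain y where y: "y \<in> Arr A" "Dom A y = Dom A z" "Cod A y = ob X (i + 1)" "bdry A X i \<cdot> y = z"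
    using projective_exact[OF homol_proj_cokernel[OF X, of i], of z] z(1-3,5) zero x(2) X by auto
  have "df X (i + 1) \<cdot> y = x"
    using comp_assoc_eq[OF bdry_simps(4)[OF X], of i y] y X z(4) by simp
  then show ?thesis using y z(2) unfolding boundary_def by auto
qed

lemma hclass_surj:
  assumes X: "is_complex A X" and h: "h \<in> Arr A" "Cod A h = homol A X i" "projective A (Dom A h)"
  obtains x where "cycle X i x" "Dom A x = Dom A h" "hclass X i x = h"
proof -
  obtain z where z: "z \<in> Arr A" "Dom A z = Dom A h" "Cod A z = Dom A (cycles A X i)" "homol_proj A X i \<cdot> z = h"
    using projective_lift[OF h(3) cokernel_epi[OF homol_proj_cokernel[OF X, of i]]] h X by auto
  then show ?thesis
    using that[of "cycles A X i \<cdot> z"] hclass_eq[OF X, of z] X cycle_comp[OF X cycle_cycles[OF X], of z] by simp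
qed

lemma homol_map_ex1:
  assumes f: "is_chain_map A (X, Y, f)"
  shows "\<exists>!h. h \<in> Hom A (homol A X i) (homol A Y i) \<and>
      h \<cdot> homol_proj A X i = hclass Y i (f i \<cdot> cycles A X i)"
proof -
  note XY = chain_mapD(1,2)[OF f]
  note ff = chain_mapD(3-5)[OF f]
  have c: "cycle Y i (f i \<cdot> cycles A X i)" by (rule cycle_map[OF f cycle_cycles[OF XY(1)]])
  have b: "boundary Y i (f i \<cdot> df X (i + 1))"
    by (rule boundary_map[OF f]) (use boundaryI[of "Idn A (ob X (i + 1))" X i] XY in simp)
  have "hclass Y i (f i \<cdot> cycles A X i) \<cdot> bdry A X i = hclass Y i ((f i \<cdot> cycles A X i) \<cdot> bdry A X i)"
    using hclass_comp[OF XY(2) c, of "bdry A X i"] ff XY by simp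
  also have "(f i \<cdot> cycles A X i) \<cdot> bdry A X i = f i \<cdot> df X (i + 1)"
    using ff XY by simp
  also have "hclass Y i \<dots> = Zer A (ob X (i + 1)) (homol A Y i)"
    using hclass_boundary[OF XY(2) b] ff XY by simp
  finally obtain h where h: "h \<in> Arr A" "Dom A h = homol A X i" "Cod A h = homol A Y i"
      "h \<cdot> homol_proj A X i = hclass Y i (f i \<cdot> cycles A X i)"
    using cokernel_lift[OF homol_proj_cokernel[OF XY(1), of i], of "hclass Y i (f i \<cdot> cycles A X i)"]
      XY c ff by auto
  show ?thesis
  proof (rule ex1I[of _ h])
    fix g assume "g \<in> Hom A (homol A X i) (homol A Y i) \<and>
      g \<cdot> homol_proj A X i = hclass Y i (f i \<cdot> cycles A X i)"
    then show "g = h"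
      by (intro epi_cancel[OF cokernel_epi[OF homol_proj_cokernel[OF XY(1), of i]], of g h])
        (use h XY in \<open>simp_all add: Hom_iff\<close>)
  qed (use h in \<open>simp add: Hom_iff\<close>)
qed

lemma homol_map_eq_the:
  assumes f: "is_chain_map A (X, Y, f)"
  shows "homol_map A (X, Y, f) i = (THE h. h \<in> Hom A (homol A X i) (homol A Y i) \<and>
      h \<cdot> homol_proj A X i = hclass Y i (f i \<cdot> cycles A X i))"
  unfolding homol_map_def cycles_map_def hclass_def using chain_mapD(1-5)[OF f] by simp

lemma homol_map_simps [simp]:
  assumes f: "is_chain_map A (X, Y, f)"
  shows "homol_map A (X, Y, f) i \<in> Arr A" "Dom A (homol_map A (X, Y, f) i) = homol A X i"
    "Cod A (homol_map A (X, Y, f) i) = homol A Y i"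
  using theI'[OF homol_map_ex1[OF f, of i]] unfolding homol_map_eq_the[OF f, symmetric]
  by (simp_all add: Hom_iff)

lemma homol_map_hclass:
  assumes f: "is_chain_map A (X, Y, f)" and x: "cycle X i x"
  shows "homol_map A (X, Y, f) i \<cdot> hclass X i x = hclass Y i (f i \<cdot> x)"
proof (rule cycleE[OF chain_mapD(1)[OF f] x])
  note XY = chain_mapD(1,2)[OF f]
  note ff = chain_mapD(3-5)[OF f]
  fix z assume z: "z \<in> Arr A" "Dom A z = Dom A x" "Cod A z = Dom A (cycles A X i)"
    "x = cycles A X i \<cdot> z" "hclass X i x = homol_proj A X i \<cdot> z"
  have "homol_map A (X, Y, f) i \<cdot> homol_proj A X i = hclass Y i (f i \<cdot> cycles A X i)"
    using theI'[OF homol_map_ex1[OF f, of i]] unfolding homol_map_eq_the[OF f, symmetric] by simp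
  then have "homol_map A (X, Y, f) i \<cdot> (homol_proj A X i \<cdot> z) = hclass Y i (f i \<cdot> cycles A X i) \<cdot> z"
    by (rule comp_assoc_eq) (use f XY z in simp_all)
  also have "\<dots> = hclass Y i ((f i \<cdot> cycles A X i) \<cdot> z)"
    by (rule hclass_comp[symmetric, OF XY(2) cycle_map[OF f cycle_cycles[OF XY(1)]]])
      (use z XY ff in simp_all)
  also have "(f i \<cdot> cycles A X i) \<cdot> z = f i \<cdot> x"
    unfolding z(4) using z(1-3) XY ff by simp
  finally show ?thesis unfolding z(5) .
qed

text \<open>The class of the inclusion of the cycles is the projection onto homology, which is epic.\<close>

lemma homol_arr_ext:
  assumes X: "is_complex A X" and g: "g \<in> Arr A" "Dom A g = homol A X i"
    and h: "h \<in> Arr A" "Dom A h = homol A X i" "Cod A g = Cod A h"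
    and eq: "\<And>x. cycle X i x \<Longrightarrow> g \<cdot> hclass X i x = h \<cdot> hclass X i x"
  shows "g = h"
proof (rule epi_cancel[OF cokernel_epi[OF homol_proj_cokernel[OF X, of i]]])
  have "hclass X i (cycles A X i) = homol_proj A X i"
    using hclass_eq[OF X, of "Idn A (Dom A (cycles A X i))" i] X by simp
  then show "g \<cdot> homol_proj A X i = h \<cdot> homol_proj A X i"
    using eq[OF cycle_cycles[OF X]] by simp
qed (use assms(1-6) in simp_all)

lemma homol_map_id:
  assumes X: "is_complex A X"
  shows "homol_map A (X, X, \<lambda>i. Idn A (ob X i)) i = Idn A (homol A X i)"
proof -
  have f: "is_chain_map A (X, X, \<lambda>i. Idn A (ob X i))" by (rule chain_mapI) (use X in simp_all)
  show ?thesis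
  proof (rule homol_arr_ext[OF X])
    fix x assume x: "cycle X i x"
    show "homol_map A (X, X, \<lambda>i. Idn A (ob X i)) i \<cdot> hclass X i x = Idn A (homol A X i) \<cdot> hclass X i x"
      using homol_map_hclass[OF f x] X x cycleD[OF x] by simp
  qed (use X f in simp_all)
qed

lemma chain_map_comp:
  assumes f: "is_chain_map A (X, Y, f)" and g: "is_chain_map A (Y, Z, g)"
  shows "is_chain_map A (X, Z, \<lambda>i. g i \<cdot> f i)"
proof (rule chain_mapI)
  note F = chain_mapD(1-5)[OF f] chain_mapD(1-5)[OF g]
  fix i
  have "df Z i \<cdot> (g i \<cdot> f i) = g (i - 1) \<cdot> (df Y i \<cdot> f i)"
    by (rule chain_map_comm[OF g]) (use F in simp_all)
  then show "df Z i \<cdot> (g i \<cdot> f i) = g (i - 1) \<cdot> f (i - 1) \<cdot> df X i"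
    using F chain_mapD(6)[OF f, of i] by simp
qed (use chain_mapD(1-5)[OF f] chain_mapD(1-5)[OF g] in simp_all)

lemma homol_map_comp:
  assumes f: "is_chain_map A (X, Y, f)" and g: "is_chain_map A (Y, Z, g)"
  shows "homol_map A (X, Z, \<lambda>i. g i \<cdot> f i) i = homol_map A (Y, Z, g) i \<cdot> homol_map A (X, Y, f) i"
proof (rule homol_arr_ext)
  note F = chain_mapD(1-5)[OF f] chain_mapD(1-5)[OF g]
  note gf = chain_map_comp[OF f g]
  fix x assume x: "cycle X i x"
  have "(homol_map A (Y, Z, g) i \<cdot> homol_map A (X, Y, f) i) \<cdot> hclass X i x
      = homol_map A (Y, Z, g) i \<cdot> hclass Y i (f i \<cdot> x)"
    using homol_map_hclass[OF f x] f g x F by simp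
  also have "\<dots> = hclass Z i (g i \<cdot> (f i \<cdot> x))"
    by (rule homol_map_hclass[OF g cycle_map[OF f x]])
  also have "\<dots> = homol_map A (X, Z, \<lambda>i. g i \<cdot> f i) i \<cdot> hclass X i x"
    using homol_map_hclass[OF gf x] x F cycleD[OF x] by simp
  finally show "homol_map A (X, Z, \<lambda>i. g i \<cdot> f i) i \<cdot> hclass X i x =
      (homol_map A (Y, Z, g) i \<cdot> homol_map A (X, Y, f) i) \<cdot> hclass X i x" by simp
qed (use chain_mapD(1)[OF f] f g homol_map_simps[OF chain_map_comp[OF f g]] in simp_all)

text \<open>Vanishing of homology, and injectivity and surjectivity of the map induced on homology, expressed by
  elements with projective domain; see \<open>homol_zero_iff\<close> and
  \<open>homol_map_iso_iff\<close>.\<close>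

definition acyclic_at :: "(_, _) cx \<Rightarrow> int \<Rightarrow> bool" where
  "acyclic_at X i \<longleftrightarrow> (\<forall>x. cycle X i x \<and> projective A (Dom A x) \<longrightarrow> boundary X i x)"

definition hinj :: "(_, _) cx_map \<Rightarrow> int \<Rightarrow> bool" where
  "hinj = (\<lambda>(X, Y, f) i. \<forall>x. cycle X i x \<and> projective A (Dom A x) \<and> boundary Y i (f i \<cdot> x)
     \<longrightarrow> boundary X i x)"

definition hsurj :: "(_, _) cx_map \<Rightarrow> int \<Rightarrow> bool" where
  "hsurj = (\<lambda>(X, Y, f) i. \<forall>y. cycle Y i y \<and> projective A (Dom A y) \<longrightarrow>
     (\<exists>x. cycle X i x \<and> Dom A x = Dom A y \<and> boundary Y i (y \<boxplus> Neg A (f i \<cdot> x))))"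

end

context abelian_enough_projectives
begin

lemma homol_zero_iff:
  assumes X: "is_complex A X" shows "is_zero A (homol A X i) \<longleftrightarrow> acyclic_at X i"
proof
  assume z: "is_zero A (homol A X i)"
  show "acyclic_at X i"
    unfolding acyclic_at_def
  proof (intro allI impI)
    fix x assume x: "cycle X i x \<and> projective A (Dom A x)"
    have "hclass X i x = Zer A (Dom A (hclass X i x)) (homol A X i)"
      by (rule to_zero[OF z]) (use X x in simp_all)
    then show "boundary X i x" using boundary_if_hclass_zero[OF X] X x by simp
  qed
next
  assume a: "acyclic_at X i"
  obtain e where e: "e \<in> Arr A" "projective A (Dom A e)" "Cod A e = homol A X i" "is_epi A e"
    using projective_cover[of "homol A X i"] X by auto
  obtain x where x: "cycle X i x" "Dom A x = Dom A e" "hclass X i x = e"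
    using hclass_surj[OF X e(1,3,2)] by blast
  then have "boundary X i x" using a e by (simp add: acyclic_at_def)
  then have "e = Zer A (Dom A e) (homol A X i)" using hclass_boundary[OF X] x by metis
  then have "Idn A (homol A X i) \<cdot> e = Zer A (homol A X i) (homol A X i) \<cdot> e"
    using e X by simp
  then have "Idn A (homol A X i) = Zer A (homol A X i) (homol A X i)"
    by (rule epi_cancel[OF e(4)]) (use e X in simp_all)
  then show "is_zero A (homol A X i)" using X by (simp add: is_zero_iff)
qed

text \<open>The comparison with the element-level conditions frees all later arguments from the chosen kernels and
  cokernels in the definition of homology.\<close>

lemma homol_map_iso_iff:
  assumes f: "is_chain_map A (X, Y, f)"
  shows "is_iso A (homol_map A (X, Y, f) i) \<longleftrightarrow> hinj (X, Y, f) i \<and> hsurj (X, Y, f) i"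
proof
  note XY = chain_mapD(1,2)[OF f]
  note ff = chain_mapD(3-5)[OF f]
  let ?H = "homol_map A (X, Y, f) i"
  assume "is_iso A ?H"
  then obtain g where g: "g \<in> Arr A" "Dom A g = homol A Y i" "Cod A g = homol A X i"
      "g \<cdot> ?H = Idn A (homol A X i)" "?H \<cdot> g = Idn A (homol A Y i)"
    using f by (auto simp: is_iso_def Hom_iff)
  have "boundary X i x" if x: "cycle X i x" "projective A (Dom A x)" "boundary Y i (f i \<cdot> x)" for x
  proof (rule boundary_if_hclass_zero[OF XY(1) x(1,2)])
    have "hclass X i x = g \<cdot> (?H \<cdot> hclass X i x)"
      using comp_assoc_eq[OF g(4), of "hclass X i x"] g f x XY by simp
    also have "\<dots> = g \<cdot> Zer A (Dom A x) (homol A Y i)"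
      using homol_map_hclass[OF f x(1)] hclass_boundary[OF XY(2) x(3)] ff cycleD[OF x(1)] by simp
    also have "\<dots> = Zer A (Dom A x) (homol A X i)" using g cycleD[OF x(1)] by simp
    finally show "hclass X i x = Zer A (Dom A x) (homol A X i)" .
  qed
  moreover have "\<exists>x. cycle X i x \<and> Dom A x = Dom A y \<and> boundary Y i (y \<boxplus> Neg A (f i \<cdot> x))"
    if y: "cycle Y i y" "projective A (Dom A y)" for y
  proof -
    obtain x where x: "cycle X i x" "Dom A x = Dom A y" "hclass X i x = g \<cdot> hclass Y i y"
      using hclass_surj[OF XY(1), of "g \<cdot> hclass Y i y" i] g y XY by auto
    have fx: "cycle Y i (f i \<cdot> x)" by (rule cycle_map[OF f x(1)])
    have D: "Dom A (f i \<cdot> x) = Dom A y" using ff x cycleD[OF x(1)] by simp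
    have "hclass Y i (f i \<cdot> x) = ?H \<cdot> (g \<cdot> hclass Y i y)"
      using homol_map_hclass[OF f x(1)] x(3) by simp
    also have "\<dots> = hclass Y i y"
      using comp_assoc_eq[OF g(5), of "hclass Y i y"] g f y XY by simp
    finally have eq: "hclass Y i (f i \<cdot> x) = hclass Y i y" .
    have "hclass Y i (y \<boxplus> Neg A (f i \<cdot> x)) = hclass Y i y \<boxplus> hclass Y i (Neg A (f i \<cdot> x))"
      by (rule hclass_add[OF XY(2) y(1) cycle_neg[OF XY(2) fx]]) (use D fx in \<open>simp add: cycleD\<close>)
    also have "\<dots> = Zer A (Dom A y) (homol A Y i)"
      unfolding hclass_neg[OF XY(2) fx] eq using XY y by simp
    finally have "boundary Y i (y \<boxplus> Neg A (f i \<cdot> x))"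
      using y D cycleD[OF fx] cycleD[OF y(1)]
      by (intro boundary_if_hclass_zero[OF XY(2)] cycle_add[OF XY(2)] cycle_neg[OF XY(2)] fx) simp_all
    then show ?thesis using x by blast
  qed
  ultimately show "hinj (X, Y, f) i \<and> hsurj (X, Y, f) i"
    by (auto simp: hinj_def hsurj_def)
next
  note XY = chain_mapD(1,2)[OF f]
  note ff = chain_mapD(3-5)[OF f]
  let ?H = "homol_map A (X, Y, f) i"
  assume h: "hinj (X, Y, f) i \<and> hsurj (X, Y, f) i"
  have "is_mono A ?H"
  proof (rule mono_if_elements)
    fix q assume q: "q \<in> Arr A" "projective A (Dom A q)" "Cod A q = Dom A ?H"
      "?H \<cdot> q = Zer A (Dom A q) (Cod A ?H)"
    obtain x where x: "cycle X i x" "Dom A x = Dom A q" "hclass X i x = q"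
      using hclass_surj[OF XY(1), of q i] q f by auto
    have "boundary Y i (f i \<cdot> x)"
      by (rule boundary_if_hclass_zero[OF XY(2) cycle_map[OF f x(1)]])
        (use homol_map_hclass[OF f x(1)] x(2,3) q f ff cycleD[OF x(1)] in simp_all)
    then have "boundary X i x" using h x q by (auto simp: hinj_def)
    from hclass_boundary[OF XY(1) this] show "q = Zer A (Dom A q) (Dom A ?H)"
      using x f by simp
  qed (use f in simp)
  moreover have "is_epi A ?H"
  proof (rule epi_if_elements)
    fix q assume q: "q \<in> Arr A" "projective A (Dom A q)" "Cod A q = Cod A ?H"
    obtain y where y: "cycle Y i y" "Dom A y = Dom A q" "hclass Y i y = q"
      using hclass_surj[OF XY(2), of q i] q f by auto
    obtain x where x: "cycle X i x" "Dom A x = Dom A y" "boundary Y i (y \<boxplus> Neg A (f i \<cdot> x))"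
      using h y q by (auto simp: hsurj_def)
    have fx: "cycle Y i (f i \<cdot> x)" by (rule cycle_map[OF f x(1)])
    have D: "Dom A (f i \<cdot> x) = Dom A y" using ff x cycleD[OF x(1)] by simp
    have "hclass Y i (y \<boxplus> Neg A (f i \<cdot> x)) = hclass Y i y \<boxplus> hclass Y i (Neg A (f i \<cdot> x))"
      by (rule hclass_add[OF XY(2) y(1) cycle_neg[OF XY(2) fx]]) (use D fx in \<open>simp add: cycleD\<close>)
    then have diff: "hclass Y i y \<boxplus> Neg A (hclass Y i (f i \<cdot> x)) = Zer A (Dom A y) (homol A Y i)"
      using hclass_boundary[OF XY(2) x(3)] hclass_neg[OF XY(2) fx] D cycleD[OF fx] cycleD[OF y(1)] by simp
    have "hclass Y i y = hclass Y i (f i \<cdot> x)"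
      by (rule diff_zer) (use diff XY y fx D q f in simp_all)
    then show "\<exists>p \<in> Arr A. Dom A p = Dom A q \<and> Cod A p = Dom A ?H \<and> ?H \<cdot> p = q"
      using homol_map_hclass[OF f x(1)] x y XY f by (intro bexI[of _ "hclass X i x"]) simp_all
  qed (use f in simp)
  ultimately show "is_iso A ?H" by (rule iso_if_mono_epi)
qed

end


section \<open>Functors out of a localization\<close>

context category
begin

lemma zigzag_Obj: "zigzag C W X u Y \<Longrightarrow> X \<in> Obj C \<and> Y \<in> Obj C"
proof (induction u arbitrary: X)
  case (Cons l u)
  then show ?case by (cases l) auto
qed auto

lemma zigzag_append: "zigzag C W X (u @ v) Y \<longleftrightarrow> (\<exists>Z. zigzag C W X u Z \<and> zigzag C W Z v Y)"
proof (induction u arbitrary: X)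
  case Nil
  then show ?case using zigzag_Obj[of W X v Y] by auto
next
  case (Cons l u)
  then show ?case by (cases l) auto
qed

lemma zz_rel_refl: "zigzag C W X u Y \<Longrightarrow> (u, u) \<in> zz_rel C W X Y"
  by (simp add: zz_rel_def)

lemma zz_rel_sym: "(u, v) \<in> zz_rel C W X Y \<Longrightarrow> (v, u) \<in> zz_rel C W X Y"
proof -
  have "sym ({(a, b). zigzag C W X a Y \<and> zigzag C W X b Y \<and> (zz_step C W a b \<or> zz_step C W b a)}\<^sup>*)"
    by (rule sym_rtrancl) (auto simp: sym_def)
  then show "(u, v) \<in> zz_rel C W X Y \<Longrightarrow> (v, u) \<in> zz_rel C W X Y"
    unfolding zz_rel_def by (auto dest: symD)
qed

lemma zz_rel_trans:
  "\<lbrakk>(u, v) \<in> zz_rel C W X Y; (v, w) \<in> zz_rel C W X Y\<rbrakk> \<Longrightarrow> (u, w) \<in> zz_rel C W X Y"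
  by (auto simp: zz_rel_def)

lemma zz_rel_step:
  "\<lbrakk>zz_step C W u v; zigzag C W X u Y; zigzag C W X v Y\<rbrakk> \<Longrightarrow> (u, v) \<in> zz_rel C W X Y"
  by (auto simp: zz_rel_def intro!: r_into_rtrancl)

lemma zz_rel_zigzag: "(u, v) \<in> zz_rel C W X Y \<Longrightarrow> zigzag C W X u Y \<and> zigzag C W X v Y"
  by (auto simp: zz_rel_def)

text \<open>Symmetry and transitivity as cases, so that an invariant of zigzags has only to be checked on a single
  elementary step in its given direction.\<close>

lemma zz_rel_induct [consumes 1, case_names refl sym trans step]:
  assumes "(u, v) \<in> zz_rel C W X Y"
    and refl: "\<And>u. zigzag C W X u Y \<Longrightarrow> P u u"
    and sym: "\<And>u v. P u v \<Longrightarrow> P v u"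
    and trans: "\<And>u v w. \<lbrakk>P u v; P v w\<rbrakk> \<Longrightarrow> P u w"
    and step: "\<And>u v. \<lbrakk>zz_step C W u v; zigzag C W X u Y; zigzag C W X v Y\<rbrakk> \<Longrightarrow> P u v"
  shows "P u v"
proof -
  have "(u, v) \<in> {(a, b). zigzag C W X a Y \<and> zigzag C W X b Y \<and> (zz_step C W a b \<or> zz_step C W b a)}\<^sup>*"
    and u: "zigzag C W X u Y"
    using assms(1) by (auto simp: zz_rel_def)
  then show ?thesis
  proof (induction rule: rtrancl_induct)
    case base
    then show ?case by (rule refl)
  next
    case (step v w)
    then have "P v w" using assms(5) sym by blast
    then show ?case using step trans by blast
  qed
qed

lemma zz_step_context: "zz_step C W u v \<Longrightarrow> zz_step C W (a @ u @ b) (a @ v @ b)"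
proof (induction rule: zz_step.induct)
  case (1 f X Y g Z u v)
  then show ?case using zz_step.intros(1)[of f C X Y g Z W "a @ u" "v @ b"] by simp
next
  case (2 X u v)
  then show ?case using zz_step.intros(2)[of X C W "a @ u" "v @ b"] by simp
next
  case (3 f u v)
  then show ?case using zz_step.intros(3)[of f C W "a @ u" "v @ b"] by simp
next
  case (4 f u v)
  then show ?case using zz_step.intros(4)[of f C W "a @ u" "v @ b"] by simp
qed

lemma zz_rel_context:
  assumes "(u, v) \<in> zz_rel C W X Y" "zigzag C W X' a X" "zigzag C W Y b Y'"
  shows "(a @ u @ b, a @ v @ b) \<in> zz_rel C W X' Y'"
  using assms(1)
proof (induction rule: zz_rel_induct)
  case (refl u)
  then show ?case using assms(2,3) by (intro zz_rel_refl) (auto simp: zigzag_append)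
next
  case (step u v)
  then show ?case
    using assms(2,3) by (intro zz_rel_step zz_step_context) (auto simp: zigzag_append)
next
  case (sym u v)
  then show ?case by (rule zz_rel_sym)
next
  case (trans u v w)
  then show ?case by (rule zz_rel_trans)
qed

text \<open>Concatenation respects the congruence, so that composition of classes can be computed on
  representatives.\<close>

lemma zz_rel_append:
  assumes "(u, u') \<in> zz_rel C W X Y" "(v, v') \<in> zz_rel C W Y Z"
  shows "(u @ v, u' @ v') \<in> zz_rel C W X Z"
proof (rule zz_rel_trans)
  have z: "zigzag C W X u' Y" "zigzag C W Y v Z" "zigzag C W X [] X" "zigzag C W Z [] Z"
    using assms[THEN zz_rel_zigzag] zigzag_Obj[of W X u Y] zigzag_Obj[of W Y v Z] by auto
  show "(u @ v, u' @ v) \<in> zz_rel C W X Z"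
    using zz_rel_context[OF assms(1) z(3,2)] by simp
  show "(u' @ v, u' @ v') \<in> zz_rel C W X Z"
    using zz_rel_context[OF assms(2) z(1,4)] by simp
qed

definition zclass :: "_ set \<Rightarrow> _ \<Rightarrow> _ letter list \<Rightarrow> _ \<Rightarrow> (_, _) loc_arr" where
  "zclass W X u Y = (X, Y, zz_rel C W X Y `` {u})"

lemma zclass_eqI: "(u, v) \<in> zz_rel C W X Y \<Longrightarrow> zclass W X u Y = zclass W X v Y"
  unfolding zclass_def by (auto intro: zz_rel_sym zz_rel_trans)

lemma zclass_eqD:
  "\<lbrakk>zclass W X u Y = zclass W X v Y; zigzag C W X v Y\<rbrakk> \<Longrightarrow> (u, v) \<in> zz_rel C W X Y"
  unfolding zclass_def using zz_rel_refl[of W X v Y] by blast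

lemma localization_Obj [simp]: "Obj (localization C W) = Obj C"
  by (simp add: localization_def)

lemma localization_Idn: "Idn (localization C W) X = zclass W X [] X"
  by (simp add: localization_def zclass_def)

lemma loc_of_eq: "loc_of C W f = zclass W (Dom C f) [Fwd f] (Cod C f)"
  by (simp add: loc_of_def zclass_def)

lemma zclass_Hom: "zigzag C W X u Y \<Longrightarrow> zclass W X u Y \<in> Hom (localization C W) X Y"
  by (auto simp: Hom_def localization_def zclass_def quotient_def)

lemma localization_HomE:
  assumes "\<alpha> \<in> Hom (localization C W) X Y"
  obtains u where "zigzag C W X u Y" "\<alpha> = zclass W X u Y"
  using assms by (auto simp: Hom_def localization_def zclass_def quotient_def)

lemma zclass_comp:
  assumes u: "zigzag C W X u Y" and v: "zigzag C W Y v Z"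
  shows "zclass W Y v Z \<cdot>\<^bsub>localization C W\<^esub> zclass W X u Y = zclass W X (u @ v) Z"
proof -
  have "zz_rel C W X Z `` {u' @ v' |u' v'. u' \<in> zz_rel C W X Y `` {u} \<and> v' \<in> zz_rel C W Y Z `` {v}}
      = zz_rel C W X Z `` {u @ v}" (is "?L = ?R")
  proof
    show "?L \<subseteq> ?R" by (auto intro: zz_rel_trans[OF zz_rel_append])
    show "?R \<subseteq> ?L" using zz_rel_refl[OF u] zz_rel_refl[OF v] by blast
  qed
  then show ?thesis by (simp add: localization_def zclass_def)
qed

lemma localization_iso_idn: "X \<in> Obj C \<Longrightarrow> is_iso (localization C W) (zclass W X [] X)"
proof -
  assume X: "X \<in> Obj C"
  then have z: "zigzag C W X [] X" by simp
  have H: "zclass W X [] X \<in> Hom (localization C W) X X" using zclass_Hom[OF z] .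
  then show ?thesis
    unfolding is_iso_def using zclass_comp[OF z z] localization_Idn[of W X]
    by (auto simp: Hom_iff intro!: bexI[of _ "zclass W X [] X"])
qed

lemma loc_of_Hom: "f \<in> Hom C X Y \<Longrightarrow> loc_of C W f \<in> Hom (localization C W) X Y"
  unfolding loc_of_eq by (auto simp: Hom_iff[of f] intro!: zclass_Hom)

lemma loc_of_iso:
  assumes f: "f \<in> Arr C" "f \<in> W" shows "is_iso (localization C W) (loc_of C W f)"
proof -
  let ?b = "zclass W (Cod C f) [Bwd f] (Dom C f)"
  have z: "zigzag C W (Dom C f) [Fwd f] (Cod C f)" "zigzag C W (Cod C f) [Bwd f] (Dom C f)"
    using f by auto
  have H: "loc_of C W f \<in> Hom (localization C W) (Dom C f) (Cod C f)"
    "?b \<in> Hom (localization C W) (Cod C f) (Dom C f)"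
    using z by (auto simp: loc_of_eq intro: zclass_Hom)
  have 1: "([Fwd f] @ [Bwd f], []) \<in> zz_rel C W (Dom C f) (Dom C f)"
    by (rule zz_rel_step) (use f zz_step.intros(3)[of f C W "[]" "[]"] in auto)
  have 2: "([Bwd f] @ [Fwd f], []) \<in> zz_rel C W (Cod C f) (Cod C f)"
    by (rule zz_rel_step) (use f zz_step.intros(4)[of f C W "[]" "[]"] in auto)
  show ?thesis
    unfolding is_iso_def
    using H zclass_comp[OF z] zclass_comp[OF z(2,1)] zclass_eqI[OF 1] zclass_eqI[OF 2]
    by (intro conjI bexI[of _ ?b]) (auto simp: Hom_iff localization_Idn loc_of_eq)
qed

lemma localization_isomorphic:
  "\<lbrakk>f \<in> Hom C X Y; f \<in> W\<rbrakk> \<Longrightarrow> isomorphic (localization C W) X Y"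
  unfolding isomorphic_def by (intro bexI[OF _ loc_of_Hom] loc_of_iso) (auto simp: Hom_iff[of f])

end

text \<open>Isomorphism in a localization is witnessed by zigzags of arbitrary length. To transport it to another
  category, a functor that inverts \<open>W\<close> is evaluated on zigzags letter by letter.\<close>

locale inverting_functor = C: category C + D: category D
  for C :: "('o, 'm, 'z) cat_scheme" and D :: "('p, 'n, 'y) cat_scheme" +
  fixes W :: "'m set" and Fo :: "'o \<Rightarrow> 'p" and Fm :: "'m \<Rightarrow> 'n"
  assumes map_Obj: "X \<in> Obj C \<Longrightarrow> Fo X \<in> Obj D"
    and map_Hom: "f \<in> Arr C \<Longrightarrow> Fm f \<in> Hom D (Fo (Dom C f)) (Fo (Cod C f))"
    and map_Idn: "X \<in> Obj C \<Longrightarrow> Fm (Idn C X) = Idn D (Fo X)"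
    and map_Comp: "\<lbrakk>f \<in> Hom C X Y; g \<in> Hom C Y Z\<rbrakk> \<Longrightarrow> Fm (g \<cdot>\<^bsub>C\<^esub> f) = Fm g \<cdot>\<^bsub>D\<^esub> Fm f"
    and map_iso: "f \<in> Arr C \<inter> W \<Longrightarrow> is_iso D (Fm f)"
begin

primrec letter_map :: "'m letter \<Rightarrow> 'n" where
  "letter_map (Fwd f) = Fm f"
| "letter_map (Bwd f) = (SOME g. g \<in> Hom D (Fo (Cod C f)) (Fo (Dom C f)) \<and>
     g \<cdot>\<^bsub>D\<^esub> Fm f = Idn D (Fo (Dom C f)) \<and> Fm f \<cdot>\<^bsub>D\<^esub> g = Idn D (Fo (Cod C f)))"

primrec zmap :: "'m letter list \<Rightarrow> 'o \<Rightarrow> 'n" where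
  "zmap [] Y = Idn D (Fo Y)"
| "zmap (l # u) Y = zmap u Y \<cdot>\<^bsub>D\<^esub> letter_map l"

lemma letter_map_Fwd [simp]:
  assumes "f \<in> Arr C"
  shows "Fm f \<in> Arr D" "Dom D (Fm f) = Fo (Dom C f)" "Cod D (Fm f) = Fo (Cod C f)"
  using map_Hom[OF assms] by (auto simp: Hom_iff)

lemma letter_map_Bwd:
  assumes "f \<in> Arr C" "f \<in> W"
  shows "letter_map (Bwd f) \<in> Arr D" "Dom D (letter_map (Bwd f)) = Fo (Cod C f)"
    "Cod D (letter_map (Bwd f)) = Fo (Dom C f)"
    "letter_map (Bwd f) \<cdot>\<^bsub>D\<^esub> Fm f = Idn D (Fo (Dom C f))"
    "Fm f \<cdot>\<^bsub>D\<^esub> letter_map (Bwd f) = Idn D (Fo (Cod C f))"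
proof -
  have "\<exists>g. g \<in> Hom D (Fo (Cod C f)) (Fo (Dom C f)) \<and>
     g \<cdot>\<^bsub>D\<^esub> Fm f = Idn D (Fo (Dom C f)) \<and> Fm f \<cdot>\<^bsub>D\<^esub> g = Idn D (Fo (Cod C f))"
    using map_iso[of f] assms by (auto simp: is_iso_def)
  from someI_ex[OF this]
  show "letter_map (Bwd f) \<in> Arr D" "Dom D (letter_map (Bwd f)) = Fo (Cod C f)"
    "Cod D (letter_map (Bwd f)) = Fo (Dom C f)"
    "letter_map (Bwd f) \<cdot>\<^bsub>D\<^esub> Fm f = Idn D (Fo (Dom C f))"
    "Fm f \<cdot>\<^bsub>D\<^esub> letter_map (Bwd f) = Idn D (Fo (Cod C f))"
    by (simp_all add: Hom_iff)
qed

lemma zmap_simps [simp]: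
  assumes "zigzag C W X u Y"
  shows "zmap u Y \<in> Arr D" "Dom D (zmap u Y) = Fo X" "Cod D (zmap u Y) = Fo Y"
proof -
  have "zmap u Y \<in> Arr D \<and> Dom D (zmap u Y) = Fo X \<and> Cod D (zmap u Y) = Fo Y"
    using assms
  proof (induction u arbitrary: X)
    case Nil
    then show ?case using map_Obj by auto
  next
    case (Cons l u)
    then show ?case using letter_map_Bwd(1-3) by (cases l) (auto simp del: letter_map.simps(2))
  qed
  then show "zmap u Y \<in> Arr D" "Dom D (zmap u Y) = Fo X" "Cod D (zmap u Y) = Fo Y" by auto
qed

lemma zmap_append:
  assumes "zigzag C W X u Z" "zigzag C W Z v Y"
  shows "zmap (u @ v) Y = zmap v Y \<cdot>\<^bsub>D\<^esub> zmap u Z"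
  using assms
proof (induction u arbitrary: X)
  case Nil
  then show ?case by auto
next
  case (Cons l u)
  then show ?case using letter_map_Bwd(1-3) by (cases l) (auto simp del: letter_map.simps(2))
qed

text \<open>Each elementary step replaces a factor of the zigzag by one with the same endpoints and the same
  value.\<close>

lemma zmap_step:
  assumes "zz_step C W u v" "zigzag C W X u Y"
  shows "zmap u Y = zmap v Y"
proof -
  have *: "zmap (a @ p @ b) Y = zmap (a @ q @ b) Y"
    if z0: "zigzag C W X (a @ p @ b) Y"
      and pq: "\<And>Z Z'. zigzag C W Z p Z' \<Longrightarrow> zigzag C W Z q Z' \<and> zmap p Z' = zmap q Z'" for a p q b
  proof -
    obtain Z Z' where z: "zigzag C W X a Z" "zigzag C W Z p Z'" "zigzag C W Z' b Y"
      using z0 by (auto simp: C.zigzag_append)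
    have q: "zigzag C W Z q Z'" "zmap p Z' = zmap q Z'" using pq[OF z(2)] by auto
    have "zigzag C W Z (p @ b) Y" "zigzag C W Z (q @ b) Y"
      using z q by (auto simp: C.zigzag_append)
    then show ?thesis
      using zmap_append[OF z(1), of "p @ b" Y] zmap_append[OF z(1), of "q @ b" Y]
        zmap_append[OF z(2,3)] zmap_append[OF q(1) z(3)] q(2) by simp
  qed
  show ?thesis
    using assms
  proof (cases rule: zz_step.cases)
    case (1 f X' Y' g Z u' v')
    show ?thesis
      unfolding 1 by (rule *) (use assms(2) 1 map_Comp[of f X' Y' g Z] in
        \<open>auto simp: Hom_iff map_Obj\<close>)
  next
    case (2 X' u' v')
    show ?thesis
      unfolding 2 using *[of u' "[Fwd (Idn C X')]" v' "[]"] assms(2) 2 by (auto simp: map_Idn map_Obj)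
  next
    case (3 f u' v')
    show ?thesis
      unfolding 3 using *[of u' "[Fwd f, Bwd f]" v' "[]"] assms(2) 3 letter_map_Bwd[of f]
      by (auto simp: map_Obj simp del: letter_map.simps(2))
  next
    case (4 f u' v')
    show ?thesis
      unfolding 4 using *[of u' "[Bwd f, Fwd f]" v' "[]"] assms(2) 4 letter_map_Bwd[of f]
      by (auto simp: map_Obj simp del: letter_map.simps(2))
  qed
qed

lemma zmap_rel: "(u, v) \<in> zz_rel C W X Y \<Longrightarrow> zmap u Y = zmap v Y"
  by (induction rule: C.zz_rel_induct) (auto dest: zmap_step)

text \<open>A functor that inverts \<open>W\<close> extends to zigzags, and hence to the localization.\<close>

theorem map_isomorphic:
  assumes "isomorphic (localization C W) X Y"
  shows "isomorphic D (Fo X) (Fo Y)"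
proof -
  let ?L = "localization C W"
  obtain \<alpha> \<beta> where \<alpha>: "\<alpha> \<in> Hom ?L X Y" and \<beta>: "\<beta> \<in> Hom ?L Y X"
    and inv: "\<beta> \<cdot>\<^bsub>?L\<^esub> \<alpha> = Idn ?L X" "\<alpha> \<cdot>\<^bsub>?L\<^esub> \<beta> = Idn ?L Y"
    using assms by (auto simp: isomorphic_def is_iso_def Hom_iff)
  obtain u where u: "zigzag C W X u Y" "\<alpha> = C.zclass W X u Y" using C.localization_HomE[OF \<alpha>] .
  obtain v where v: "zigzag C W Y v X" "\<beta> = C.zclass W Y v X" using C.localization_HomE[OF \<beta>] .
  have O: "X \<in> Obj C" "Y \<in> Obj C" using C.zigzag_Obj[OF u(1)] by auto
  have "(u @ v, []) \<in> zz_rel C W X X"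
    using inv(1) C.zclass_comp[OF u(1) v(1)] u v O
    by (intro C.zclass_eqD) (simp_all add: C.localization_Idn)
  then have 1: "zmap v X \<cdot>\<^bsub>D\<^esub> zmap u Y = Idn D (Fo X)"
    using zmap_rel zmap_append[OF u(1) v(1)] by fastforce
  have "(v @ u, []) \<in> zz_rel C W Y Y"
    using inv(2) C.zclass_comp[OF v(1) u(1)] u v O
    by (intro C.zclass_eqD) (simp_all add: C.localization_Idn)
  then have 2: "zmap u Y \<cdot>\<^bsub>D\<^esub> zmap v X = Idn D (Fo Y)"
    using zmap_rel zmap_append[OF v(1) u(1)] by fastforce
  have "is_iso D (zmap u Y)"
    unfolding is_iso_def using u v 1 2
    by (intro conjI bexI[of _ "zmap v X"]) (simp_all add: Hom_iff)
  then show ?thesis using D.isomorphicI[of "zmap u Y"] u by simp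
qed

end

text \<open>A functor that preserves \<open>W\<close> acts on zigzags compatibly with the congruence; the case of
  interest is the shift of complexes.\<close>

locale localizing_endofunctor = category C for C :: "('o, 'm, 'z) cat_scheme" (structure) +
  fixes W :: "'m set" and Fo :: "'o \<Rightarrow> 'o" and Fm :: "'m \<Rightarrow> 'm"
  assumes endo_Obj: "X \<in> Obj C \<Longrightarrow> Fo X \<in> Obj C"
    and endo_Hom: "f \<in> Arr C \<Longrightarrow> Fm f \<in> Hom C (Fo (Dom C f)) (Fo (Cod C f))"
    and endo_Idn: "X \<in> Obj C \<Longrightarrow> Fm (Idn C X) = Idn C (Fo X)"
    and endo_Comp: "\<lbrakk>f \<in> Hom C X Y; g \<in> Hom C Y Z\<rbrakk> \<Longrightarrow> Fm (g \<cdot> f) = Fm g \<cdot> Fm f"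
    and endo_W: "f \<in> Arr C \<inter> W \<Longrightarrow> Fm f \<in> W"
begin

lemma zigzag_endo: "zigzag C W X u Y \<Longrightarrow> zigzag C W (Fo X) (map (map_letter Fm) u) (Fo Y)"
proof (induction u arbitrary: X)
  case Nil
  then show ?case using endo_Obj by auto
next
  case (Cons l u)
  then show ?case using endo_Hom endo_W by (cases l) (auto simp: Hom_iff)
qed

lemma zz_step_endo:
  "zz_step C W u v \<Longrightarrow> zz_step C W (map (map_letter Fm) u) (map (map_letter Fm) v)"
proof (induction rule: zz_step.induct)
  case (1 f X Y g Z u v)
  then have "Fm f \<in> Hom C (Fo X) (Fo Y)" "Fm g \<in> Hom C (Fo Y) (Fo Z)"
    using endo_Hom[of f] endo_Hom[of g] by (auto simp: Hom_iff)
  then show ?case using zz_step.intros(1)[of "Fm f" C "Fo X" "Fo Y" "Fm g" "Fo Z"] 1 endo_Comp by simp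
next
  case (2 X u v)
  then show ?case using zz_step.intros(2)[of "Fo X" C] endo_Idn endo_Obj by simp
next
  case (3 f u v)
  then show ?case using zz_step.intros(3)[of "Fm f" C W] endo_Hom[of f] endo_W[of f] by (simp add: Hom_iff)
next
  case (4 f u v)
  then show ?case using zz_step.intros(4)[of "Fm f" C W] endo_Hom[of f] endo_W[of f] by (simp add: Hom_iff)
qed

lemma zz_rel_endo:
  "(u, v) \<in> zz_rel C W X Y \<Longrightarrow>
    (map (map_letter Fm) u, map (map_letter Fm) v) \<in> zz_rel C W (Fo X) (Fo Y)"
proof (induction rule: zz_rel_induct)
  case (refl u)
  then show ?case by (intro zz_rel_refl zigzag_endo)
next
  case (step u v)
  then show ?case by (intro zz_rel_step zz_step_endo zigzag_endo)
next
  case (sym u v)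
  then show ?case by (rule zz_rel_sym)
next
  case (trans u v w)
  then show ?case by (rule zz_rel_trans)
qed

text \<open>The induced functor on the localization preserves identities. The image of the class of the empty
  zigzag is a set of many zigzags, all of them congruent to the empty one.\<close>

lemma zclass_endo_idn:
  assumes "X \<in> Obj C"
  shows "zz_rel C W (Fo X) (Fo X) `` (map (map_letter Fm) ` (zz_rel C W X X `` {[]}))
    = zz_rel C W (Fo X) (Fo X) `` {[]}" (is "?L = ?R")
proof
  show "?L \<subseteq> ?R"
  proof
    fix w assume "w \<in> ?L"
    then obtain u where "([], u) \<in> zz_rel C W X X"
        "(map (map_letter Fm) u, w) \<in> zz_rel C W (Fo X) (Fo X)"
      by auto
    then show "w \<in> ?R" using zz_rel_endo[of "[]" u X X] zz_rel_trans by auto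
  qed
  have "([], []) \<in> zz_rel C W X X" using assms by (intro zz_rel_refl) simp
  then show "?R \<subseteq> ?L" by (force simp: Image_iff)
qed

end


section \<open>Chain maps, shifts and mapping cones\<close>

context preadditive_category
begin

lemma shift_ob [simp]: "ob (shift A n X) i = ob X (i - n)"
  by (simp add: shift_def)

lemma shift_df: "df (shift A n X) i = (if even n then df X (i - n) else Neg A (df X (i - n)))"
  by (simp add: shift_def)

lemma shift_complex: "is_complex A X \<Longrightarrow> is_complex A (shift A n X)"
  by (rule complexI) (simp_all add: shift_df algebra_simps)

lemma cycle_shift: "is_complex A X \<Longrightarrow> cycle (shift A n X) i x \<longleftrightarrow> cycle X (i - n) x"
  by (auto simp: cycle_def shift_df algebra_simps)

text \<open>For odd \<open>n\<close> the sign of the shifted differential is absorbed in the preimage.\<close>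

lemma boundary_shift:
  assumes X: "is_complex A X" shows "boundary (shift A n X) i x \<longleftrightarrow> boundary X (i - n) x"
proof (cases "even n")
  case True
  then show ?thesis using X by (simp add: boundary_def shift_df algebra_simps)
next
  case False
  have neg: "boundary X (i - n) x \<longleftrightarrow>
      (\<exists>y \<in> Arr A. Dom A y = Dom A x \<and> Cod A y = ob X (i - n + 1) \<and> Neg A (df X (i - n + 1)) \<cdot> y = x)"
    unfolding boundary_def
  proof
    assume "\<exists>y\<in>Arr A. Dom A y = Dom A x \<and> Cod A y = ob X (i - n + 1) \<and> df X (i - n + 1) \<cdot> y = x"
    then obtain y where "y \<in> Arr A" "Dom A y = Dom A x" "Cod A y = ob X (i - n + 1)" "df X (i - n + 1) \<cdot> y = x"
      by blast
    then show "\<exists>y\<in>Arr A. Dom A y = Dom A x \<and> Cod A y = ob X (i - n + 1) \<and> Neg A (df X (i - n + 1)) \<cdot> y = x"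
      using X by (intro bexI[of _ "Neg A y"]) auto
  next
    assume "\<exists>y\<in>Arr A. Dom A y = Dom A x \<and> Cod A y = ob X (i - n + 1) \<and> Neg A (df X (i - n + 1)) \<cdot> y = x"
    then obtain y where "y \<in> Arr A" "Dom A y = Dom A x" "Cod A y = ob X (i - n + 1)" "Neg A (df X (i - n + 1)) \<cdot> y = x"
      by blast
    then show "\<exists>y\<in>Arr A. Dom A y = Dom A x \<and> Cod A y = ob X (i - n + 1) \<and> df X (i - n + 1) \<cdot> y = x"
      using X by (intro bexI[of _ "Neg A y"]) auto
  qed
  show ?thesis unfolding neg using False X by (simp add: boundary_def shift_df algebra_simps)
qed

lemma shift_chain_map:
  assumes f: "is_chain_map A (X, Y, f)"
  shows "is_chain_map A (shift A n X, shift A n Y, \<lambda>i. f (i - n))"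
proof (rule chain_mapI)
  fix i
  note F = chain_mapD(1-5)[OF f]
  have "df Y (i - n) \<cdot> f (i - n) = f (i - 1 - n) \<cdot> df X (i - n)"
    using chain_mapD(6)[OF f, of "i - n"] by (simp add: algebra_simps)
  then show "df (shift A n Y) i \<cdot> f (i - n) = f (i - 1 - n) \<cdot> df (shift A n X) i"
    using F by (simp add: shift_df algebra_simps)
qed (use chain_mapD(1-5)[OF f] in \<open>simp_all add: shift_complex\<close>)

end

context abelian_category
begin

lemma Ch_simps [simp]:
  "Obj (Ch A) = {X. is_complex A X}" "Arr (Ch A) = {f. is_chain_map A f}"
  "Dom (Ch A) (X, Y, f) = X" "Cod (Ch A) (X, Y, f) = Y"
  "Idn (Ch A) X = (X, X, \<lambda>i. Idn A (ob X i))"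
  "Comp (Ch A) (Y', Z, g) (X, Y, f) = (X, Z, \<lambda>i. g i \<cdot> f i)"
  by (simp_all add: Ch_def)

lemma Ch_Hom: "F \<in> Hom (Ch A) X Y \<longleftrightarrow> (\<exists>f. F = (X, Y, f) \<and> is_chain_map A (X, Y, f))"
  by (cases F) (auto simp: Hom_iff)

lemma chain_map_id: "is_complex A X \<Longrightarrow> is_chain_map A (X, X, \<lambda>i. Idn A (ob X i))"
  by (rule chain_mapI) simp_all

lemma Ch_category: "category (Ch A)"
proof
  fix f assume "f \<in> Arr (Ch A)"
  then show "Dom (Ch A) f \<in> Obj (Ch A)" "Cod (Ch A) f \<in> Obj (Ch A)"
    by (cases f; auto dest: chain_mapD(1,2))+
next
  fix X assume "X \<in> Obj (Ch A)"
  then show "Idn (Ch A) X \<in> Hom (Ch A) X X" by (simp add: Ch_Hom chain_map_id)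
next
  fix f g X Y Z assume "f \<in> Hom (Ch A) X Y" "g \<in> Hom (Ch A) Y Z"
  then show "g \<cdot>\<^bsub>Ch A\<^esub> f \<in> Hom (Ch A) X Z" by (auto simp: Ch_Hom intro: chain_map_comp)
next
  fix f g h W X Y Z assume "f \<in> Hom (Ch A) W X" "g \<in> Hom (Ch A) X Y" "h \<in> Hom (Ch A) Y Z"
  then show "h \<cdot>\<^bsub>Ch A\<^esub> g \<cdot>\<^bsub>Ch A\<^esub> f = h \<cdot>\<^bsub>Ch A\<^esub> (g \<cdot>\<^bsub>Ch A\<^esub> f)"
    by (auto simp: Ch_Hom chain_mapD)
next
  fix f X Y assume "f \<in> Hom (Ch A) X Y"
  then show "f \<cdot>\<^bsub>Ch A\<^esub> Idn (Ch A) X = f" "Idn (Ch A) Y \<cdot>\<^bsub>Ch A\<^esub> f = f"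
    by (auto simp: Ch_Hom chain_mapD)
qed

sublocale Ch: category "Ch A" by (rule Ch_category)

lemma quasi_isos_iff:
  "(X, Y, f) \<in> quasi_isos A \<longleftrightarrow> is_chain_map A (X, Y, f) \<and> (\<forall>i. is_iso A (homol_map A (X, Y, f) i))"
  by (simp add: quasi_isos_def)

text \<open>By functoriality, homology descends to the derived category; \<open>Der_isomorphic_homol\<close> is
  the consequence for objects.\<close>

lemma homology_inverting: "inverting_functor (Ch A) A (quasi_isos A) (\<lambda>X. homol A X i) (\<lambda>f. homol_map A f i)"
proof
  fix f assume "f \<in> Arr (Ch A)"
  then show "homol_map A f i \<in> Hom A (homol A (Dom (Ch A) f) i) (homol A (Cod (Ch A) f) i)"
    by (cases f) (auto simp: Hom_iff)
qed (auto simp: homol_map_id homol_map_comp Ch_Hom quasi_isos_def)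

lemma Der_isomorphic_homol:
  "isomorphic (Der A) X Y \<Longrightarrow> isomorphic A (homol A X i) (homol A Y i)"
  unfolding Der_def by (rule inverting_functor.map_isomorphic[OF homology_inverting])

lemma quasi_iso_Der_isomorphic: "(X, Y, f) \<in> quasi_isos A \<Longrightarrow> isomorphic (Der A) X Y"
  unfolding Der_def by (rule Ch.localization_isomorphic) (auto simp: Ch_Hom quasi_isos_def)

end

context abelian_enough_projectives
begin

lemma quasi_isoI:
  "\<lbrakk>is_chain_map A (X, Y, f); \<And>i. hinj (X, Y, f) i; \<And>i. hsurj (X, Y, f) i\<rbrakk> \<Longrightarrow> (X, Y, f) \<in> quasi_isos A"
  by (simp add: quasi_isos_iff homol_map_iso_iff)

lemma homol_isomorphicI:
  assumes "is_chain_map A (X, Y, f)" "hinj (X, Y, f) i" "hsurj (X, Y, f) i"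
  shows "isomorphic A (homol A X i) (homol A Y i)"
  using isomorphicI[of "homol_map A (X, Y, f) i"] assms homol_map_iso_iff[OF assms(1), of i] by simp

text \<open>The sign in the shifted differential changes neither cycles nor boundaries.\<close>

lemma shift_quasi_iso:
  assumes "(X, Y, f) \<in> quasi_isos A"
  shows "(shift A n X, shift A n Y, \<lambda>i. f (i - n)) \<in> quasi_isos A"
proof (rule quasi_isoI)
  have f: "is_chain_map A (X, Y, f)" using assms by (simp add: quasi_isos_iff)
  note XY = chain_mapD(1,2)[OF f]
  show "is_chain_map A (shift A n X, shift A n Y, \<lambda>i. f (i - n))" by (rule shift_chain_map[OF f])
  fix i
  have h: "hinj (X, Y, f) (i - n)" "hsurj (X, Y, f) (i - n)"
    using assms homol_map_iso_iff[OF f] by (auto simp: quasi_isos_iff)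
  show "hinj (shift A n X, shift A n Y, \<lambda>i. f (i - n)) i"
    using h(1) XY by (auto simp: hinj_def cycle_shift boundary_shift)
  show "hsurj (shift A n X, shift A n Y, \<lambda>i. f (i - n)) i"
    using h(2) XY by (auto simp: hsurj_def cycle_shift boundary_shift)
qed

lemma shift_endofunctor: "localizing_endofunctor (Ch A) (quasi_isos A) (shift A n) (shift_map A n)"
proof
  fix f assume "f \<in> Arr (Ch A)"
  then show "shift_map A n f \<in> Hom (Ch A) (shift A n (Dom (Ch A) f)) (shift A n (Cod (Ch A) f))"
    by (cases f) (auto simp: shift_map_def Ch_Hom intro: shift_chain_map)
next
  fix f assume "f \<in> Arr (Ch A) \<inter> quasi_isos A"
  then show "shift_map A n f \<in> quasi_isos A"
    by (cases f) (auto simp: shift_map_def shift_quasi_iso)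
qed (auto simp: shift_complex shift_map_def Ch_Hom)

lemma Der_shift_Idn:
  assumes "is_complex A X"
  shows "Der_shift A n (Ch.zclass (quasi_isos A) X [] X) = Ch.zclass (quasi_isos A) (shift A n X) [] (shift A n X)"
  using localizing_endofunctor.zclass_endo_idn[OF shift_endofunctor, of X n] assms
  by (simp add: Der_shift_def Ch.zclass_def)

end

context abelian_category
begin

definition pairing :: "_ \<Rightarrow> _ \<Rightarrow> _" where
  "pairing y x = in1 A (Cod A y) (Cod A x) \<cdot> y \<boxplus> in2 A (Cod A y) (Cod A x) \<cdot> x"

lemma pairing_simps [simp]:
  assumes "y \<in> Arr A" "x \<in> Arr A" "Dom A y = Dom A x"
  shows "pairing y x \<in> Arr A" "Dom A (pairing y x) = Dom A x" "Cod A (pairing y x) = dirsum A (Cod A y) (Cod A x)"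
    "\<lbrakk>Y = Cod A y; X = Cod A x\<rbrakk> \<Longrightarrow> pr1 A Y X \<cdot> pairing y x = y"
    "\<lbrakk>Y = Cod A y; X = Cod A x\<rbrakk> \<Longrightarrow> pr2 A Y X \<cdot> pairing y x = x"
  using assms unfolding pairing_def by simp_all

context
  fixes X Y f
  assumes f: "is_chain_map A (X, Y, f)"
begin

lemma cone_ob [simp]: "ob (cone A (X, Y, f)) i = dirsum A (ob Y i) (ob X (i - 1))"
  by (simp add: cone_def)

lemma cone_df_simps [simp]:
  shows "df (cone A (X, Y, f)) i \<in> Arr A"
    "Dom A (df (cone A (X, Y, f)) i) = dirsum A (ob Y i) (ob X (i - 1))"
    "Cod A (df (cone A (X, Y, f)) i) = dirsum A (ob Y (i - 1)) (ob X (i - 1 - 1))"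
    "pr1 A (ob Y (i - 1)) (ob X (i - 1 - 1)) \<cdot> df (cone A (X, Y, f)) i =
      df Y i \<cdot> pr1 A (ob Y i) (ob X (i - 1)) \<boxplus> f (i - 1) \<cdot> pr2 A (ob Y i) (ob X (i - 1))"
    "pr2 A (ob Y (i - 1)) (ob X (i - 1 - 1)) \<cdot> df (cone A (X, Y, f)) i =
      Neg A (df X (i - 1) \<cdot> pr2 A (ob Y i) (ob X (i - 1)))"
  using chain_mapD(1-5)[OF f] unfolding cone_def by (simp_all add: Let_def)

lemma cone_df_comp:
  assumes "c \<in> Arr A" "Cod A c = dirsum A (ob Y i) (ob X (i - 1))"
  shows "pr1 A (ob Y (i - 1)) (ob X (i - 1 - 1)) \<cdot> (df (cone A (X, Y, f)) i \<cdot> c) =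
      df Y i \<cdot> (pr1 A (ob Y i) (ob X (i - 1)) \<cdot> c) \<boxplus> f (i - 1) \<cdot> (pr2 A (ob Y i) (ob X (i - 1)) \<cdot> c)"
    "pr2 A (ob Y (i - 1)) (ob X (i - 1 - 1)) \<cdot> (df (cone A (X, Y, f)) i \<cdot> c) =
      Neg A (df X (i - 1) \<cdot> (pr2 A (ob Y i) (ob X (i - 1)) \<cdot> c))"
  using comp_assoc_eq[OF cone_df_simps(4)[of i], of c] comp_assoc_eq[OF cone_df_simps(5)[of i], of c]
    chain_mapD(1-5)[OF f] assms by simp_all

lemma cone_complex: "is_complex A (cone A (X, Y, f))"
proof (rule complexI)
  note F = chain_mapD(1-5)[OF f]
  fix i
  have "df Y (i - 1) \<cdot> (f (i - 1) \<cdot> pr2 A (ob Y i) (ob X (i - 1))) =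
      f (i - 1 - 1) \<cdot> (df X (i - 1) \<cdot> pr2 A (ob Y i) (ob X (i - 1)))"
    by (rule chain_map_comm[OF f]) (use F in simp_all)
  note fd = this
  show "df (cone A (X, Y, f)) (i - 1) \<cdot> df (cone A (X, Y, f)) i =
      Zer A (ob (cone A (X, Y, f)) i) (ob (cone A (X, Y, f)) (i - 1 - 1))"
    by (rule dirsum_ext[of "ob Y (i - 1 - 1)" "ob X (i - 1 - 1 - 1)"])
      (use fd cone_df_simps(4,5)[of i] cone_df_comp[of "df (cone A (X, Y, f)) i" "i - 1"] F in simp_all)
qed (use chain_mapD(1-5)[OF f] in simp_all)

text \<open>Elements of a mapping cone are handled as pairs: the next four lemmas spell out when a pair is a cycle
  or a boundary.\<close>

lemma cycle_coneI:
  assumes "y \<in> Arr A" "Cod A y = ob Y j" "cycle X (j - 1) x" "Dom A y = Dom A x"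
    "df Y j \<cdot> y \<boxplus> f (j - 1) \<cdot> x = Zer A (Dom A x) (ob Y (j - 1))"
  shows "cycle (cone A (X, Y, f)) j (pairing y x)"
proof -
  note F = chain_mapD(1-5)[OF f]
  have "df (cone A (X, Y, f)) j \<cdot> pairing y x = Zer A (Dom A x) (ob (cone A (X, Y, f)) (j - 1))"
    by (rule dirsum_ext[of "ob Y (j - 1)" "ob X (j - 1 - 1)"])
      (use cone_df_comp[of "pairing y x" j] F assms cycleD[OF assms(3)] in simp_all)
  then show ?thesis using assms cycleD[OF assms(3)] by (simp add: cycle_def[of "cone A (X, Y, f)"])
qed

lemma cycle_coneD:
  assumes c: "cycle (cone A (X, Y, f)) j c"
  defines "y \<equiv> pr1 A (ob Y j) (ob X (j - 1)) \<cdot> c" and "x \<equiv> pr2 A (ob Y j) (ob X (j - 1)) \<cdot> c"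
  shows "y \<in> Arr A" "Dom A y = Dom A c" "Cod A y = ob Y j" "cycle X (j - 1) x" "Dom A x = Dom A c"
    "df Y j \<cdot> y \<boxplus> f (j - 1) \<cdot> x = Zer A (Dom A c) (ob Y (j - 1))"
proof -
  note F = chain_mapD(1-5)[OF f]
  note cD = cycleD[OF c]
  show y: "y \<in> Arr A" "Dom A y = Dom A c" "Cod A y = ob Y j" "Dom A x = Dom A c"
    using cD(1,2) F unfolding y_def x_def by simp_all
  have x: "x \<in> Arr A" "Cod A x = ob X (j - 1)" using cD(1,2) F unfolding y_def x_def by simp_all
  show "df Y j \<cdot> y \<boxplus> f (j - 1) \<cdot> x = Zer A (Dom A c) (ob Y (j - 1))"
    using cone_df_comp(1)[of c j] cD F unfolding y_def x_def by simp
  have "Neg A (df X (j - 1) \<cdot> x) = Zer A (Dom A c) (ob X (j - 1 - 1))"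
    using cone_df_comp(2)[of c j] cD F unfolding y_def x_def by simp
  then show "cycle X (j - 1) x" using x y F by (simp add: cycle_def)
qed

lemma boundary_coneD:
  assumes c: "boundary (cone A (X, Y, f)) j c"
  obtains y' x' where "y' \<in> Arr A" "Dom A y' = Dom A c" "Cod A y' = ob Y (j + 1)"
    "x' \<in> Arr A" "Dom A x' = Dom A c" "Cod A x' = ob X j"
    "pr1 A (ob Y j) (ob X (j - 1)) \<cdot> c = df Y (j + 1) \<cdot> y' \<boxplus> f j \<cdot> x'"
    "pr2 A (ob Y j) (ob X (j - 1)) \<cdot> c = Neg A (df X j \<cdot> x')"
proof -
  note F = chain_mapD(1-5)[OF f]
  obtain b where b: "b \<in> Arr A" "Dom A b = Dom A c" "Cod A b = dirsum A (ob Y (j + 1)) (ob X j)"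
      "df (cone A (X, Y, f)) (j + 1) \<cdot> b = c"
    using c unfolding boundary_def by auto
  show ?thesis
    using that[of "pr1 A (ob Y (j + 1)) (ob X j) \<cdot> b" "pr2 A (ob Y (j + 1)) (ob X j) \<cdot> b"]
      cone_df_comp[of b "j + 1"] b F by simp
qed

lemma boundary_coneI:
  assumes "c \<in> Arr A" "Cod A c = dirsum A (ob Y j) (ob X (j - 1))"
    "y' \<in> Arr A" "Dom A y' = Dom A c" "Cod A y' = ob Y (j + 1)"
    "x' \<in> Arr A" "Dom A x' = Dom A c" "Cod A x' = ob X j"
    "pr1 A (ob Y j) (ob X (j - 1)) \<cdot> c = df Y (j + 1) \<cdot> y' \<boxplus> f j \<cdot> x'"
    "pr2 A (ob Y j) (ob X (j - 1)) \<cdot> c = Neg A (df X j \<cdot> x')"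
  shows "boundary (cone A (X, Y, f)) j c"
proof -
  note F = chain_mapD(1-5)[OF f]
  have "df (cone A (X, Y, f)) (j + 1) \<cdot> pairing y' x' = c"
    by (rule dirsum_ext[of "ob Y j" "ob X (j - 1)"])
      (use cone_df_comp[of "pairing y' x'" "j + 1"] F assms cone_df_simps[of "j + 1"] in simp_all)
  then show ?thesis
    unfolding boundary_def using assms by (intro bexI[of _ "pairing y' x'"]) simp_all
qed

lemma cone_in_chain_map: "is_chain_map A (cone_in A (X, Y, f))"
  unfolding cone_in_def prod.case
proof (rule chain_mapI)
  note F = chain_mapD(1-5)[OF f]
  fix i
  show "df (cone A (X, Y, f)) i \<cdot> in1 A (ob Y i) (ob X (i - 1)) =
      in1 A (ob Y (i - 1)) (ob X (i - 1 - 1)) \<cdot> df Y i"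
    by (rule dirsum_ext[of "ob Y (i - 1)" "ob X (i - 1 - 1)"])
      (use cone_df_comp[of "in1 A (ob Y i) (ob X (i - 1))" i] F in simp_all)
qed (use chain_mapD(1-5)[OF f] cone_complex in simp_all)

lemma cone_out_chain_map: "is_chain_map A (cone_out A (X, Y, f))"
  unfolding cone_out_def prod.case
proof (rule chain_mapI)
  fix i
  show "df (shift A 1 X) i \<cdot> pr2 A (ob Y i) (ob X (i - 1)) =
      pr2 A (ob Y (i - 1)) (ob X (i - 1 - 1)) \<cdot> df (cone A (X, Y, f)) i"
    unfolding cone_df_simps(5) using chain_mapD(1-5)[OF f] by (simp add: shift_df)
qed (use chain_mapD(1-5)[OF f] cone_complex in \<open>simp_all add: shift_complex\<close>)

end

end

context abelian_enough_projectives
begin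

context
  fixes X Y f
  assumes f: "is_chain_map A (X, Y, f)"
begin

text \<open>This and the following lemmas up to \<open>acyclic_coneI\<close> are the pieces of the long exact
  homology sequence of a cone that the comparison of filtrations and resolutions rests on. If \<open>f x
  = d y\<close>, then \<open>(-y, x)\<close> is a cycle of the cone.\<close>

lemma hinj_if_acyclic_cone:
  assumes "acyclic_at (cone A (X, Y, f)) (j + 1)"
  shows "hinj (X, Y, f) j"
  unfolding hinj_def prod.case
proof (intro allI impI)
  note F = chain_mapD(1-5)[OF f]
  fix x assume x: "cycle X j x \<and> projective A (Dom A x) \<and> boundary Y j (f j \<cdot> x)"
  note xD = cycleD[OF x[THEN conjunct1]]
  obtain y where y: "y \<in> Arr A" "Dom A y = Dom A (f j \<cdot> x)" "Cod A y = ob Y (j + 1)" "df Y (j + 1) \<cdot> y = f j \<cdot> x"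
    using x unfolding boundary_def by blast
  have D: "Dom A y = Dom A x" using y xD F by simp
  have "cycle (cone A (X, Y, f)) (j + 1) (pairing (Neg A y) x)"
    by (rule cycle_coneI[OF f]) (use y x D xD F in simp_all)
  then have "boundary (cone A (X, Y, f)) (j + 1) (pairing (Neg A y) x)"
    using assms x xD y D by (simp add: acyclic_at_def)
  then obtain x' where x': "x' \<in> Arr A" "Dom A x' = Dom A (pairing (Neg A y) x)" "Cod A x' = ob X (j + 1)"
      "pr2 A (ob Y (j + 1)) (ob X (j + 1 - 1)) \<cdot> pairing (Neg A y) x = Neg A (df X (j + 1) \<cdot> x')"
    by (rule boundary_coneD[OF f])
  have t: "Dom A (pairing (Neg A y) x) = Dom A x"
    "pr2 A (ob Y (j + 1)) (ob X (j + 1 - 1)) \<cdot> pairing (Neg A y) x = x"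
    using y xD D by simp_all
  note x' = x'[unfolded t]
  have "df X (j + 1) \<cdot> Neg A x' = Neg A (df X (j + 1) \<cdot> x')" using x'(1-3) F by simp
  also have "\<dots> = x" by (rule x'(4)[symmetric])
  finally have "x = df X (j + 1) \<cdot> Neg A x'" by (rule sym)
  then show "boundary X j x" using boundaryI[of "Neg A x'" X j] x'(1-3) F by simp
qed

text \<open>If \<open>y\<close> is a cycle, so is \<open>(y, 0)\<close>; an equation \<open>(y, 0) = d (y',
  x')\<close> says that \<open>y\<close> is homologous to \<open>f x'\<close>.\<close>

lemma hsurj_if_acyclic_cone:
  assumes "acyclic_at (cone A (X, Y, f)) j"
  shows "hsurj (X, Y, f) j"
  unfolding hsurj_def prod.case
proof (intro allI impI)
  note F = chain_mapD(1-5)[OF f]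
  fix y assume y: "cycle Y j y \<and> projective A (Dom A y)"
  note yD = cycleD[OF y[THEN conjunct1]]
  let ?c = "pairing y (Zer A (Dom A y) (ob X (j - 1)))"
  have "cycle (cone A (X, Y, f)) j ?c"
    by (rule cycle_coneI[OF f]) (use y yD F in \<open>simp_all add: cycle_def\<close>)
  then have "boundary (cone A (X, Y, f)) j ?c"
    using assms y yD F by (simp add: acyclic_at_def)
  then obtain y' x' where y': "y' \<in> Arr A" "Dom A y' = Dom A (?c)" "Cod A y' = ob Y (j + 1)"
    "x' \<in> Arr A" "Dom A x' = Dom A (?c)" "Cod A x' = ob X j"
    "pr1 A (ob Y j) (ob X (j - 1)) \<cdot> ?c = df Y (j + 1) \<cdot> y' \<boxplus> f j \<cdot> x'"
    "pr2 A (ob Y j) (ob X (j - 1)) \<cdot> ?c = Neg A (df X j \<cdot> x')"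
    by (rule boundary_coneD[OF f])
  have t: "Dom A ?c = Dom A y" "pr1 A (ob Y j) (ob X (j - 1)) \<cdot> ?c = y"
    "pr2 A (ob Y j) (ob X (j - 1)) \<cdot> ?c = Zer A (Dom A y) (ob X (j - 1))"
    using yD F by simp_all
  note y' = y'[unfolded t]
  have "df X j \<cdot> x' = Zer A (Dom A y) (ob X (j - 1))"
    using y'(8)[symmetric] y'(4-6) yD(1) F by simp
  then have "cycle X j x'" using y'(4-6) F by (simp add: cycle_def)
  moreover have "y \<boxplus> Neg A (f j \<cdot> x') = df Y (j + 1) \<cdot> y'"
    by (subst y'(7)) (use y'(1-6) F in simp)
  then have "boundary Y j (y \<boxplus> Neg A (f j \<cdot> x'))"
    using boundaryI[of y' Y j] y'(1-3) F by simp
  ultimately show "\<exists>x. cycle X j x \<and> Dom A x = Dom A y \<and> boundary Y j (y \<boxplus> Neg A (f j \<cdot> x))"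
    using y' by blast
qed

lemma acyclic_target:
  assumes X: "acyclic_at X j" and s: "hsurj (X, Y, f) j"
  shows "acyclic_at Y j"
  unfolding acyclic_at_def
proof (intro allI impI)
  note F = chain_mapD(1-5)[OF f]
  fix y assume y: "cycle Y j y \<and> projective A (Dom A y)"
  note yD = cycleD[OF y[THEN conjunct1]]
  obtain x where x: "cycle X j x" "Dom A x = Dom A y" "boundary Y j (y \<boxplus> Neg A (f j \<cdot> x))"
    using s y by (auto simp: hsurj_def)
  have fx: "boundary Y j (f j \<cdot> x)" using boundary_map[OF f] X x y by (simp add: acyclic_at_def)
  have "boundary Y j ((y \<boxplus> Neg A (f j \<cdot> x)) \<boxplus> f j \<cdot> x)"
    by (rule boundary_add[OF F(2) x(3) fx]) (use x cycleD[OF x(1)] yD F in simp)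
  also have "(y \<boxplus> Neg A (f j \<cdot> x)) \<boxplus> f j \<cdot> x = y" using x(2) cycleD[OF x(1)] yD F by simp
  finally show "boundary Y j y" .
qed

lemma cone_in_hinj:
  assumes "acyclic_at X i" shows "hinj (cone_in A (X, Y, f)) i"
  unfolding hinj_def cone_in_def prod.case
proof (intro allI impI)
  note F = chain_mapD(1-5)[OF f]
  fix y assume y: "cycle Y i y \<and> projective A (Dom A y) \<and>
    boundary (cone A (X, Y, f)) i (in1 A (ob Y i) (ob X (i - 1)) \<cdot> y)"
  let ?c = "in1 A (ob Y i) (ob X (i - 1)) \<cdot> y"
  note yD = cycleD[OF y[THEN conjunct1]]
  obtain y' x' where y': "y' \<in> Arr A" "Dom A y' = Dom A (?c)" "Cod A y' = ob Y (i + 1)"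
    "x' \<in> Arr A" "Dom A x' = Dom A (?c)" "Cod A x' = ob X i"
    "pr1 A (ob Y i) (ob X (i - 1)) \<cdot> ?c = df Y (i + 1) \<cdot> y' \<boxplus> f i \<cdot> x'"
    "pr2 A (ob Y i) (ob X (i - 1)) \<cdot> ?c = Neg A (df X i \<cdot> x')"
    using y[THEN conjunct2, THEN conjunct2] by (rule boundary_coneD[OF f])
  have t: "Dom A ?c = Dom A y" "pr1 A (ob Y i) (ob X (i - 1)) \<cdot> ?c = y"
    "pr2 A (ob Y i) (ob X (i - 1)) \<cdot> ?c = Zer A (Dom A y) (ob X (i - 1))"
    using yD F by simp_all
  note y' = y'[unfolded t]
  have "df X i \<cdot> x' = Zer A (Dom A y) (ob X (i - 1))"
    using y'(8)[symmetric] y'(4-6) yD(1) F by simp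
  then have "boundary X i x'" using y'(4-6) y assms by (simp add: cycle_def acyclic_at_def)
  then have fx: "boundary Y i (f i \<cdot> x')" by (rule boundary_map[OF f])
  have "boundary Y i (df Y (i + 1) \<cdot> y' \<boxplus> f i \<cdot> x')"
    by (rule boundary_add[OF F(2) boundaryI fx]) (use y'(1-6) F in simp_all)
  then show "boundary Y i y" using y'(7) by simp
qed

text \<open>If \<open>x = d w\<close>, then subtracting the boundary of \<open>(0, -w)\<close> turns the cycle
  \<open>(y, x)\<close> into \<open>(y + f w, 0)\<close>.\<close>

lemma cone_cycle_reduce:
  assumes c: "cycle (cone A (X, Y, f)) j c"
    and b: "boundary X (j - 1) (pr2 A (ob Y j) (ob X (j - 1)) \<cdot> c)"
  obtains y1 where "cycle Y j y1" "Dom A y1 = Dom A c"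
    "boundary (cone A (X, Y, f)) j (c \<boxplus> Neg A (in1 A (ob Y j) (ob X (j - 1)) \<cdot> y1))"
proof -
  note F = chain_mapD(1-5)[OF f]
  define y where "y = pr1 A (ob Y j) (ob X (j - 1)) \<cdot> c"
  define x where "x = pr2 A (ob Y j) (ob X (j - 1)) \<cdot> c"
  note yx = cycle_coneD[OF f c(1), folded y_def x_def]
  note cD = cycleD[OF c(1)]
  obtain w where w: "w \<in> Arr A" "Dom A w = Dom A c" "Cod A w = ob X j" "df X j \<cdot> w = x"
    using b yx(5) unfolding boundary_def x_def[symmetric] by auto
  have fw: "df Y j \<cdot> (f j \<cdot> w) = f (j - 1) \<cdot> x" using chain_map_comm[OF f w(1,3)] w by simp
  \<comment> \<open>Since \<open>x = d w\<close>, the cycle condition \<open>d y + f x = 0\<close> says that \<open>y + f w\<close> is a cycle.\<close>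
  let ?y = "y \<boxplus> f j \<cdot> w"
  have "cycle Y j ?y" unfolding cycle_def using yx w(1-3) fw F by simp
  moreover have "boundary (cone A (X, Y, f)) j (c \<boxplus> Neg A (in1 A (ob Y j) (ob X (j - 1)) \<cdot> ?y))"
  proof (rule boundary_coneI[OF f, of _ _ "Zer A (Dom A c) (ob Y (j + 1))" "Neg A w"])
    show "pr1 A (ob Y j) (ob X (j - 1)) \<cdot> (c \<boxplus> Neg A (in1 A (ob Y j) (ob X (j - 1)) \<cdot> ?y)) =
        df Y (j + 1) \<cdot> Zer A (Dom A c) (ob Y (j + 1)) \<boxplus> f j \<cdot> Neg A w"
      using yx(1-3) w(1-3) cD(1,2) F f by (simp flip: y_def)
    show "pr2 A (ob Y j) (ob X (j - 1)) \<cdot> (c \<boxplus> Neg A (in1 A (ob Y j) (ob X (j - 1)) \<cdot> ?y)) =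
        Neg A (df X j \<cdot> Neg A w)"
      using yx(1-5) cycleD[OF yx(4)] w cD(1,2) F f by (simp flip: x_def)
  qed (use yx(1-3) w(1-3) cD(1,2) F f in simp_all)
  ultimately show ?thesis using that[of ?y] yx w F by simp
qed

lemma cone_in_hsurj:
  assumes "acyclic_at X (i - 1)" shows "hsurj (cone_in A (X, Y, f)) i"
  unfolding hsurj_def cone_in_def prod.case
proof (intro allI impI)
  fix c assume c: "cycle (cone A (X, Y, f)) i c \<and> projective A (Dom A c)"
  have "boundary X (i - 1) (pr2 A (ob Y i) (ob X (i - 1)) \<cdot> c)"
    using cycle_coneD(4,5)[OF f c[THEN conjunct1]] assms c by (simp add: acyclic_at_def)
  then show "\<exists>y. cycle Y i y \<and> Dom A y = Dom A c \<and>
      boundary (cone A (X, Y, f)) i (c \<boxplus> Neg A (in1 A (ob Y i) (ob X (i - 1)) \<cdot> y))"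
    using cone_cycle_reduce c by blast
qed

text \<open>A cycle \<open>(y, x)\<close> has \<open>f x = - d y\<close>, so \<open>x\<close> bounds by
  injectivity and the cycle may be replaced by some \<open>(y1, 0)\<close>; by surjectivity
  \<open>y1\<close> is homologous to some \<open>f x1\<close>, and \<open>(f x1, 0) = d (0, x1)\<close>.\<close>

lemma acyclic_coneI:
  assumes s: "hsurj (X, Y, f) j" and i: "hinj (X, Y, f) (j - 1)"
  shows "acyclic_at (cone A (X, Y, f)) j"
  unfolding acyclic_at_def
proof (intro allI impI)
  note F = chain_mapD(1-5)[OF f]
  let ?C = "cone A (X, Y, f)" and ?in = "in1 A (ob Y j) (ob X (j - 1))"
  note C = cone_complex[OF f]
  fix c assume c: "cycle ?C j c \<and> projective A (Dom A c)"
  define y where "y = pr1 A (ob Y j) (ob X (j - 1)) \<cdot> c"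
  define x where "x = pr2 A (ob Y j) (ob X (j - 1)) \<cdot> c"
  note yx = cycle_coneD[OF f c[THEN conjunct1], folded y_def x_def]
  note cD = cycleD[OF c[THEN conjunct1]]
  have "f (j - 1) \<cdot> x = Neg A (df Y j \<cdot> y)"
    by (rule neg_unique) (use yx cycleD[OF yx(4)] F add_commute[of "f (j - 1) \<cdot> x" "df Y j \<cdot> y"] in simp_all)
  also have "\<dots> = df Y j \<cdot> Neg A y" using yx F by simp
  finally have "boundary Y (j - 1) (f (j - 1) \<cdot> x)"
    using boundaryI[of "Neg A y" Y "j - 1"] yx F by simp
  then have "boundary X (j - 1) x" using i yx c by (auto simp: hinj_def)
  then obtain y1 where y1: "cycle Y j y1" "Dom A y1 = Dom A c" "boundary ?C j (c \<boxplus> Neg A (?in \<cdot> y1))"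
    using cone_cycle_reduce[of j c] c unfolding x_def by blast
  obtain x1 where x1: "cycle X j x1" "Dom A x1 = Dom A y1" "boundary Y j (y1 \<boxplus> Neg A (f j \<cdot> x1))"
    using s y1 c unfolding hsurj_def by auto
  note y1D = cycleD[OF y1(1)] and x1D = cycleD[OF x1(1)]
  have 1: "boundary ?C j (?in \<cdot> (y1 \<boxplus> Neg A (f j \<cdot> x1)))"
    using boundary_map[OF cone_in_chain_map[OF f, unfolded cone_in_def prod.case] x1(3)] .
  have 2: "boundary ?C j (?in \<cdot> (f j \<cdot> x1))"
    by (rule boundary_coneI[OF f, of _ _ "Zer A (Dom A c) (ob Y (j + 1))" x1])
      (use x1D x1(2) y1(2) F c cD(1) in simp_all)
  have 3: "boundary ?C j (?in \<cdot> (y1 \<boxplus> Neg A (f j \<cdot> x1)) \<boxplus> ?in \<cdot> (f j \<cdot> x1))"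
    by (rule boundary_add[OF C 1 2]) (use x1D(1,2) x1(2) y1(2) y1D(1,2) F in simp_all)
  have "boundary ?C j ((c \<boxplus> Neg A (?in \<cdot> y1)) \<boxplus> (?in \<cdot> (y1 \<boxplus> Neg A (f j \<cdot> x1)) \<boxplus> ?in \<cdot> (f j \<cdot> x1)))"
    by (rule boundary_add[OF C y1(3) 3]) (use x1D(1,2) x1(2) y1(2) y1D(1,2) cD(1,2) F f in simp_all)
  also have "(c \<boxplus> Neg A (?in \<cdot> y1)) \<boxplus> (?in \<cdot> (y1 \<boxplus> Neg A (f j \<cdot> x1)) \<boxplus> ?in \<cdot> (f j \<cdot> x1)) = c"
    using x1D(1,2) x1(2) y1(2) y1D(1,2) cD(1,2) F f by simp
  finally show "boundary ?C j c" .
qed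

end

end


section \<open>Direct sums and truncations of complexes\<close>

context abelian_category
begin

lemma dirsum_cx_complex:
  assumes X: "is_complex A X" and Y: "is_complex A Y"
  shows "is_complex A (dirsum_cx A X Y)"
proof (rule complexI)
  fix i
  show "df (dirsum_cx A X Y) (i - 1) \<cdot> df (dirsum_cx A X Y) i =
      Zer A (ob (dirsum_cx A X Y) i) (ob (dirsum_cx A X Y) (i - 1 - 1))"
    using X Y unfolding dirsum_cx_def by simp
qed (use X Y in \<open>simp_all add: dirsum_cx_def\<close>)

lemma zero_cx_complex: "is_complex A (zero_cx A)"
  by (rule complexI) (simp_all add: zero_cx_def)

lemma dpow_cx_complex: "is_complex A N \<Longrightarrow> is_complex A (dpow_cx A N a)"
  by (induction a) (simp_all add: dirsum_cx_complex zero_cx_complex)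

lemma dpow_cx_ob [simp]: "ob (dpow_cx A N a) j = dpow A (ob N j) a"
  by (induction a) (simp_all add: dirsum_cx_def zero_cx_def)

lemma stalk_complex: "M \<in> Obj A \<Longrightarrow> is_complex A (stalk A M)"
  by (rule complexI) (simp_all add: stalk_def Let_def)

lemma shifted_stalk_power:
  assumes "M \<in> Obj A" "N = dpow_cx A (shift A i (stalk A M)) a"
  shows "is_complex A N" "ob N i = dpow A M a" "j \<noteq> i \<Longrightarrow> is_zero A (ob N j)"
  using assms by (simp_all add: dpow_cx_complex shift_complex stalk_complex dpow_zero)
    (simp_all add: stalk_def dpow_zero)

lemma zero_ob_boundary:
  assumes X: "is_complex A X" and z: "is_zero A (ob X i)" and x: "x \<in> Arr A" "Cod A x = ob X i"
  shows "boundary X i x"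
proof -
  have "x = df X (i + 1) \<cdot> Zer A (Dom A x) (ob X (i + 1))"
    using to_zero[OF z x] x X by simp
  then show ?thesis using boundaryI[of "Zer A (Dom A x) (ob X (i + 1))" X i] X x by simp
qed

lemma acyclic_if_zero_ob: "\<lbrakk>is_complex A X; is_zero A (ob X i)\<rbrakk> \<Longrightarrow> acyclic_at X i"
  unfolding acyclic_at_def by (blast intro: zero_ob_boundary dest: cycleD)

lemma cycle_if_zero_ob:
  "\<lbrakk>is_complex A X; is_zero A (ob X (i - 1)); x \<in> Arr A; Cod A x = ob X i\<rbrakk> \<Longrightarrow> cycle X i x"
  unfolding cycle_def using to_zero[of "ob X (i - 1)" "df X i \<cdot> x"] by simp

lemma hinj_if_acyclic: "acyclic_at X i \<Longrightarrow> hinj (X, Y, f) i"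
  by (auto simp: hinj_def acyclic_at_def)

lemma hsurj_if_acyclic:
  assumes f: "is_chain_map A (X, Y, f)" and a: "acyclic_at Y i" shows "hsurj (X, Y, f) i"
  unfolding hsurj_def prod.case
proof (intro allI impI)
  note F = chain_mapD(1-5)[OF f]
  fix y assume y: "cycle Y i y \<and> projective A (Dom A y)"
  note yD = cycleD[OF y[THEN conjunct1]]
  have "boundary Y i y" using a y by (simp add: acyclic_at_def)
  then show "\<exists>x. cycle X i x \<and> Dom A x = Dom A y \<and> boundary Y i (y \<boxplus> Neg A (f i \<cdot> x))"
    using F yD by (intro exI[of _ "Zer A (Dom A y) (ob X i)"]) (simp_all add: cycle_def)
qed

text \<open>The canonical truncation: the cycles in degree \<open>n\<close>, the terms of \<open>X\<close> above,
  and zero below. It has the homology of \<open>X\<close> in degrees at least \<open>n\<close> and none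
  below.\<close>

definition trunc :: "int \<Rightarrow> (_, _) cx \<Rightarrow> (_, _) cx" where
  "trunc n X = (let Z = (\<lambda>i. if n < i then ob X i else if i = n then Dom A (cycles A X n) else zero_ob A)
     in \<lparr>ob = Z, df = (\<lambda>i. if n + 1 < i then df X i else if i = n + 1 then bdry A X n
       else Zer A (Z i) (Z (i - 1)))\<rparr>)"

definition trunc_inc :: "int \<Rightarrow> (_, _) cx \<Rightarrow> int \<Rightarrow> _" where
  "trunc_inc n X i = (if n < i then Idn A (ob X i) else if i = n then cycles A X n
     else Zer A (zero_ob A) (ob X i))"

lemma trunc_ob:
  "n < i \<Longrightarrow> ob (trunc n X) i = ob X i" "ob (trunc n X) n = Dom A (cycles A X n)"
  "i < n \<Longrightarrow> ob (trunc n X) i = zero_ob A"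
  by (auto simp: trunc_def Let_def)

lemma trunc_df:
  "n + 1 < i \<Longrightarrow> df (trunc n X) i = df X i" "df (trunc n X) (n + 1) = bdry A X n"
  "i \<le> n \<Longrightarrow> df (trunc n X) i = Zer A (ob (trunc n X) i) (zero_ob A)"
  by (auto simp: trunc_def Let_def)

lemma cycles_cancel:
  assumes "is_complex A X" "cycles A X n \<cdot> g = cycles A X n \<cdot> h" "g \<in> Arr A" "h \<in> Arr A"
    "Cod A g = Dom A (cycles A X n)" "Cod A h = Dom A (cycles A X n)" "Dom A g = Dom A h"
  shows "g = h"
  using mono_cancel[OF kernel_mono[OF cycles_kernel[OF assms(1)]] assms(2-7)] .

lemma bdry_comp_zero:
  assumes X: "is_complex A X" and y: "y \<in> Arr A" "Cod A y = ob X (n + 1)"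
    "df X (n + 1) \<cdot> y = Zer A (Dom A y) (ob X n)"
  shows "bdry A X n \<cdot> y = Zer A (Dom A y) (Dom A (cycles A X n))"
  by (rule cycles_cancel[OF X])
    (use comp_assoc_eq[OF bdry_simps(4)[OF X], of n y] X y in simp_all)

lemma trunc_complex:
  assumes X: "is_complex A X" shows "is_complex A (trunc n X)"
proof (rule complexI)
  fix i
  consider "i < n" | "i = n" | "n < i" by linarith
  then show "ob (trunc n X) i \<in> Obj A" using X by cases (simp_all add: trunc_ob)
  consider "i \<le> n" | "i = n + 1" | "i = n + 2" | "n + 2 < i" by linarith
  note df_cases = this
  have O: "ob (trunc n X) n \<in> Obj A" "i < n \<Longrightarrow> ob (trunc n X) i \<in> Obj A" using X by (simp_all add: trunc_ob)
  have "df (trunc n X) i \<in> Arr A \<and> Dom A (df (trunc n X) i) = ob (trunc n X) i \<and>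
      Cod A (df (trunc n X) i) = ob (trunc n X) (i - 1)"
    using df_cases
  proof cases
    case 1
    then show ?thesis using X O by (cases "i = n") (simp_all add: trunc_df trunc_ob)
  qed (use X in \<open>simp_all add: trunc_df trunc_ob\<close>)
  then show "df (trunc n X) i \<in> Arr A" "Dom A (df (trunc n X) i) = ob (trunc n X) i"
    "Cod A (df (trunc n X) i) = ob (trunc n X) (i - 1)"
    by blast+
  show "df (trunc n X) (i - 1) \<cdot> df (trunc n X) i = Zer A (ob (trunc n X) i) (ob (trunc n X) (i - 1 - 1))"
    using df_cases
  proof cases
    case 1
    then show ?thesis using X O by (cases "i = n") (simp_all add: trunc_df trunc_ob)
  next
    case 2
    then show ?thesis using X by (simp add: trunc_df trunc_ob)
  next
    case 3
    have i: "i - 1 = n + 1" "i - 1 - 1 = n" using 3 by simp_all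
    have e: "df (trunc n X) (i - 1) = bdry A X n" "ob (trunc n X) (i - 1 - 1) = Dom A (cycles A X n)"
      unfolding i(2) unfolding i(1) by (rule trunc_df trunc_ob)+
    have "bdry A X n \<cdot> df X i = Zer A (Dom A (df X i)) (Dom A (cycles A X n))"
    proof (rule bdry_comp_zero[OF X])
      show "Cod A (df X i) = ob X (n + 1)" unfolding i(1)[symmetric] by (rule complexD(4)[OF X])
      show "df X (n + 1) \<cdot> df X i = Zer A (Dom A (df X i)) (ob X n)"
        using complex_dd[OF X i(1)[symmetric]] X by simp
    qed (use X in simp)
    then show ?thesis unfolding e using 3 X by (simp add: trunc_df trunc_ob)
  next
    case 4
    then show ?thesis using X by (simp add: trunc_df trunc_ob)
  qed
qed

lemma trunc_inc_chain_map:
  assumes X: "is_complex A X" shows "is_chain_map A (trunc n X, X, trunc_inc n X)"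
proof (rule chain_mapI[OF trunc_complex[OF X] X])
  fix i
  show "trunc_inc n X i \<in> Arr A" "Dom A (trunc_inc n X i) = ob (trunc n X) i" "Cod A (trunc_inc n X i) = ob X i"
    using X by (simp_all add: trunc_inc_def trunc_ob)
  consider "i < n" | "i = n" | "i = n + 1" | "n + 1 < i" by linarith
  then show "df X i \<cdot> trunc_inc n X i = trunc_inc n X (i - 1) \<cdot> df (trunc n X) i"
    using X by cases (simp_all add: trunc_inc_def trunc_df trunc_ob)
qed

text \<open>In degrees at least \<open>n\<close> the truncation has the same cycles and the same boundaries as
  \<open>X\<close>; only in degree \<open>n\<close> itself are they described through the inclusion of
  the cycles.\<close>

lemma trunc_inc_hinj:
  assumes X: "is_complex A X" and i: "n \<le> i" shows "hinj (trunc n X, X, trunc_inc n X) i"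
  unfolding hinj_def prod.case
proof (intro allI impI)
  fix x assume x: "cycle (trunc n X) i x \<and> projective A (Dom A x) \<and> boundary X i (trunc_inc n X i \<cdot> x)"
  note xD = cycleD(1,2)[OF x[THEN conjunct1]]
  have D: "Dom A (trunc_inc n X i \<cdot> x) = Dom A x"
    using chain_mapD(3-5)[OF trunc_inc_chain_map[OF X]] xD by simp
  obtain y where y: "y \<in> Arr A" "Dom A y = Dom A x" "Cod A y = ob X (i + 1)"
      "df X (i + 1) \<cdot> y = trunc_inc n X i \<cdot> x"
    using x unfolding boundary_def D by blast
  have "df (trunc n X) (i + 1) \<cdot> y = x"
  proof (cases "i = n")
    case True
    have "bdry A X n \<cdot> y = x"
      by (rule cycles_cancel[OF X])
        (use True comp_assoc_eq[OF bdry_simps(4)[OF X], of n y] X xD y in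
          \<open>simp_all add: trunc_inc_def trunc_ob\<close>)
    then show ?thesis using True by (simp add: trunc_df)
  next
    case False
    then show ?thesis using i y xD X by (simp add: trunc_df trunc_ob trunc_inc_def)
  qed
  then show "boundary (trunc n X) i x" using y i unfolding boundary_def by (auto simp: trunc_ob)
qed

lemma trunc_inc_hsurj:
  assumes X: "is_complex A X" and i: "n \<le> i" shows "hsurj (trunc n X, X, trunc_inc n X) i"
  unfolding hsurj_def prod.case
proof (intro allI impI)
  note f = trunc_inc_chain_map[OF X, of n]
  fix y assume y: "cycle X i y \<and> projective A (Dom A y)"
  note yD = cycleD[OF y[THEN conjunct1]]
  obtain x where x: "cycle (trunc n X) i x" "Dom A x = Dom A y" "trunc_inc n X i \<cdot> x = y"
  proof (cases "i = n")
    case True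
    obtain z where z: "z \<in> Arr A" "Dom A z = Dom A y" "Cod A z = Dom A (cycles A X i)" "y = cycles A X i \<cdot> z"
      using cycleE[OF X y[THEN conjunct1]] by blast
    then have "cycle (trunc n X) i z"
      using True X by (intro cycle_if_zero_ob trunc_complex) (simp_all add: trunc_ob)
    then show ?thesis using that z True by (simp add: trunc_inc_def)
  next
    case False
    have "df (trunc n X) i \<cdot> y = Zer A (Dom A y) (ob (trunc n X) (i - 1))"
    proof (cases "i = n + 1")
      case True
      then show ?thesis using bdry_comp_zero[OF X, of y n] yD by (simp add: trunc_df trunc_ob)
    next
      case False
      then show ?thesis using \<open>i \<noteq> n\<close> i yD by (simp add: trunc_df trunc_ob)
    qed
    then have "cycle (trunc n X) i y" using False i yD by (simp add: cycle_def trunc_ob)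
    then show ?thesis using that[of y] False i yD by (simp add: trunc_inc_def)
  qed
  have "boundary X i (df X (i + 1) \<cdot> Zer A (Dom A y) (ob X (i + 1)))"
    by (rule boundaryI) (use X yD in simp_all)
  then have "boundary X i (y \<boxplus> Neg A (trunc_inc n X i \<cdot> x))"
    unfolding x(3) using X yD by simp
  then show "\<exists>x. cycle (trunc n X) i x \<and> Dom A x = Dom A y \<and> boundary X i (y \<boxplus> Neg A (trunc_inc n X i \<cdot> x))"
    using x by blast
qed

lemma cycles_zero:
  assumes X: "is_complex A X" and z: "is_zero A (ob X n)" shows "is_zero A (Dom A (cycles A X n))"
proof -
  have "Idn A (Dom A (cycles A X n)) = Zer A (Dom A (cycles A X n)) (Dom A (cycles A X n))"
  proof (rule cycles_cancel[OF X])
    have "cycles A X n = Zer A (Dom A (cycles A X n)) (ob X n)"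
      by (rule to_zero[OF z]) (use X in simp_all)
    then show "cycles A X n \<cdot> Idn A (Dom A (cycles A X n)) =
        cycles A X n \<cdot> Zer A (Dom A (cycles A X n)) (Dom A (cycles A X n))"
      using X by simp
  qed (use X in simp_all)
  then show ?thesis using X by (simp add: is_zero_iff)
qed

lemma trunc_ob_zero: "\<lbrakk>is_complex A X; is_zero A (ob X i)\<rbrakk> \<Longrightarrow> is_zero A (ob (trunc n X) i)"
  using cycles_zero[of X n] by (cases i n rule: linorder_cases) (auto simp: trunc_ob)

end

context abelian_enough_projectives
begin

text \<open>Every element of degree \<open>i\<close> is a cycle, and only zero bounds.\<close>

lemma homol_concentrated:
  assumes N: "is_complex A N" and z: "is_zero A (ob N (i + 1))" "is_zero A (ob N (i - 1))"
  shows "isomorphic A (ob N i) (homol A N i)"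
proof -
  let ?g = "hclass N i (Idn A (ob N i))"
  have c: "cycle N i (Idn A (ob N i))" by (rule cycle_if_zero_ob) (use N z in simp_all)
  have g: "?g \<in> Arr A" "Dom A ?g = ob N i" "Cod A ?g = homol A N i" using c N by simp_all
  have gq: "?g \<cdot> q = hclass N i q" if "q \<in> Arr A" "Cod A q = ob N i" for q
    using hclass_comp[OF N c, of q] that N by simp
  have "is_mono A ?g"
  proof (rule mono_if_elements[OF g(1)])
    fix q assume q: "q \<in> Arr A" "projective A (Dom A q)" "Cod A q = Dom A ?g"
      "?g \<cdot> q = Zer A (Dom A q) (Cod A ?g)"
    have "boundary N i q"
      by (rule boundary_if_hclass_zero[OF N cycle_if_zero_ob[OF N z(2)]]) (use q g gq in simp_all)
    then obtain y where y: "y \<in> Arr A" "Dom A y = Dom A q" "Cod A y = ob N (i + 1)" "df N (i + 1) \<cdot> y = q"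
      unfolding boundary_def by blast
    have "df N (i + 1) \<cdot> Zer A (Dom A q) (ob N (i + 1)) = q"
      using y(4) to_zero[OF z(1) y(1,3)] y(2) by metis
    then show "q = Zer A (Dom A q) (Dom A ?g)" using N g q(1) by simp
  qed
  moreover have "is_epi A ?g"
  proof (rule epi_if_elements[OF g(1)])
    fix q assume q: "q \<in> Arr A" "projective A (Dom A q)" "Cod A q = Cod A ?g"
    obtain x where x: "cycle N i x" "Dom A x = Dom A q" "hclass N i x = q"
      using hclass_surj[OF N, of q i] q g by auto
    then show "\<exists>p \<in> Arr A. Dom A p = Dom A q \<and> Cod A p = Dom A ?g \<and> ?g \<cdot> p = q"
      using gq[of x] cycleD[OF x(1)] g by (intro bexI[of _ x]) simp_all
  qed
  ultimately have "is_iso A ?g" by (rule iso_if_mono_epi)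
  then show ?thesis using isomorphicI[of ?g] g by simp
qed

text \<open>As \<open>C\<close> vanishes below degree \<open>i\<close>, its homology in degree \<open>i\<close> is
  a quotient of \<open>C\<^sub>i\<close>. The quotient map, followed by the isomorphism onto
  \<open>N\<^sub>i\<close>, is a chain map when extended by zero.\<close>

lemma quasi_iso_to_concentrated:
  assumes C: "is_complex A C" "\<And>j. j < i \<Longrightarrow> is_zero A (ob C j)" "\<And>j. i < j \<Longrightarrow> acyclic_at C j"
    and N: "is_complex A N" "\<And>j. j \<noteq> i \<Longrightarrow> is_zero A (ob N j)"
    and iso: "isomorphic A (homol A C i) (ob N i)"
  shows "\<exists>f. (C, N, f) \<in> quasi_isos A"
proof -
  obtain \<theta> \<theta>' where th: "\<theta> \<in> Arr A" "Dom A \<theta> = homol A C i" "Cod A \<theta> = ob N i"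
      "\<theta>' \<in> Arr A" "Dom A \<theta>' = ob N i" "Cod A \<theta>' = homol A C i"
      "\<theta>' \<cdot> \<theta> = Idn A (homol A C i)" "\<theta> \<cdot> \<theta>' = Idn A (ob N i)"
    using iso by (auto simp: isomorphic_def is_iso_def Hom_iff)
  let ?g = "hclass C i (Idn A (ob C i))"
  have cyc: "cycle C i x" if "x \<in> Arr A" "Cod A x = ob C i" for x
    by (rule cycle_if_zero_ob) (use C that in simp_all)
  have c: "cycle C i (Idn A (ob C i))" by (rule cyc) (use C in simp_all)
  have g: "?g \<in> Arr A" "Dom A ?g = ob C i" "Cod A ?g = homol A C i" using c C by simp_all
  have gq: "?g \<cdot> q = hclass C i q" if "q \<in> Arr A" "Cod A q = ob C i" for q
    using hclass_comp[OF C(1) c, of q] that C by simp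
  define f where "f j = (if j = i then \<theta> \<cdot> ?g else Zer A (ob C j) (ob N j))" for j
  have f_simps: "f j \<in> Arr A" "Dom A (f j) = ob C j" "Cod A (f j) = ob N j" for j
    using th g C N by (simp_all add: f_def)
  have chain: "is_chain_map A (C, N, f)"
  proof (rule chain_mapI[OF C(1) N(1) f_simps])
    fix j
    have 1: "df N j \<cdot> f j = Zer A (ob C j) (ob N (j - 1))"
    proof (cases "j = i")
      case True
      then have z: "is_zero A (ob N (j - 1))" by (intro N(2)) simp
      have "df N j \<cdot> f j = Zer A (Dom A (df N j \<cdot> f j)) (ob N (j - 1))"
        by (rule to_zero[OF z]) (use f_simps N in simp_all)
      also have "\<dots> = Zer A (ob C j) (ob N (j - 1))" using f_simps N by simp
      finally show ?thesis .
    next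
      case False
      then show ?thesis using C N by (simp add: f_def)
    qed
    have 2: "f (j - 1) \<cdot> df C j = Zer A (ob C j) (ob N (j - 1))"
    proof (cases "j - 1 = i")
      case True
      then have j: "j = i + 1" by simp
      have b: "boundary C i (df C j)"
        using boundaryI[of "Idn A (ob C j)" C i] C unfolding j by simp
      have "f (j - 1) \<cdot> df C j = \<theta> \<cdot> (?g \<cdot> df C j)" using True g th C j by (simp add: f_def)
      also have "?g \<cdot> df C j = Zer A (ob C j) (homol A C i)"
        using gq[of "df C j"] hclass_boundary[OF C(1) b] C j by simp
      finally show ?thesis using th C j by simp
    next
      case False
      then show ?thesis using C N by (simp add: f_def)
    qed
    show "df N j \<cdot> f j = f (j - 1) \<cdot> df C j" unfolding 1 2 ..
  qed
  have "hinj (C, N, f) j" for j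
  proof (cases j i rule: linorder_cases)
    case equal
    show ?thesis
      unfolding hinj_def prod.case
    proof (intro allI impI)
      fix x assume x: "cycle C j x \<and> projective A (Dom A x) \<and> boundary N j (f j \<cdot> x)"
      note xD = cycleD(1,2)[OF x[THEN conjunct1]]
      have D: "Dom A (f j \<cdot> x) = Dom A x" using f_simps[of j] xD by simp
      obtain y where y: "y \<in> Arr A" "Dom A y = Dom A x" "Cod A y = ob N (j + 1)" "df N (j + 1) \<cdot> y = f j \<cdot> x"
        using x unfolding boundary_def D by blast
      have "is_zero A (ob N (j + 1))" using equal by (intro N(2)) simp
      from to_zero[OF this y(1,3)] have "df N (j + 1) \<cdot> y = df N (j + 1) \<cdot> Zer A (Dom A x) (ob N (j + 1))"
        using y by simp
      then have 0: "f j \<cdot> x = Zer A (Dom A x) (ob N j)" using y N xD by simp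
      have "hclass C i x = \<theta>' \<cdot> (\<theta> \<cdot> hclass C i x)"
        using comp_assoc_eq[OF th(7), of "hclass C i x"] th x C equal by simp
      also have "\<theta> \<cdot> hclass C i x = f j \<cdot> x"
        using gq[of x] equal xD g th by (simp add: f_def)
      also have "\<theta>' \<cdot> (f j \<cdot> x) = Zer A (Dom A x) (homol A C i)"
        unfolding 0 using th xD equal by simp
      finally show "boundary C j x" using boundary_if_hclass_zero[OF C(1), of i x] x equal by simp
    qed
  qed (use C in \<open>auto intro: hinj_if_acyclic acyclic_if_zero_ob\<close>)
  moreover have "hsurj (C, N, f) j" for j
  proof (cases "j = i")
    case True
    show ?thesis
      unfolding hsurj_def prod.case
    proof (intro allI impI)
      fix y assume y: "cycle N j y \<and> projective A (Dom A y)"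
      note yD = cycleD[OF y[THEN conjunct1]]
      obtain x where x: "cycle C i x" "Dom A x = Dom A y" "hclass C i x = \<theta>' \<cdot> y"
        using hclass_surj[OF C(1), of "\<theta>' \<cdot> y" i] th y yD True by auto
      have "f j \<cdot> x = \<theta> \<cdot> (\<theta>' \<cdot> y)"
        using gq[of x] cycleD[OF x(1)] g th True by (simp add: f_def x(3))
      also have "\<dots> = y" using comp_assoc_eq[OF th(8), of y] th yD True by simp
      finally have fx: "f j \<cdot> x = y" .
      have "boundary N j (df N (j + 1) \<cdot> Zer A (Dom A y) (ob N (j + 1)))"
        by (rule boundaryI) (use N yD in simp_all)
      then have "boundary N j (y \<boxplus> Neg A (f j \<cdot> x))" unfolding fx using N yD by simp
      then show "\<exists>x. cycle C j x \<and> Dom A x = Dom A y \<and> boundary N j (y \<boxplus> Neg A (f j \<cdot> x))"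
        using x True by blast
    qed
  next
    case False
    then show ?thesis
      by (intro hsurj_if_acyclic[OF chain] acyclic_if_zero_ob N)
  qed
  ultimately show ?thesis using quasi_isoI[OF chain] by blast
qed

text \<open>Below degree \<open>n\<close> a bounded complex of projectives without homology splits from the bottom
  upwards: if the cycles in degree \<open>k\<close> are projective, then the boundary map onto them has
  a section, and the cycles in degree \<open>k + 1\<close> are a retract of
  \<open>P\<^sub>k\<^sub>+\<^sub>1\<close>.\<close>

lemma projective_cycles:
  assumes P: "bounded_proj_cx A P" and a: "\<And>j. j < n \<Longrightarrow> acyclic_at P j"
  shows "projective A (Dom A (cycles A P n))"
proof -
  have X: "is_complex A P" and fin: "finite {i. \<not> is_zero A (ob P i)}"
    and pr: "\<And>i. projective A (ob P i)"
    using P by (auto simp: bounded_proj_cx_def)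
  obtain m where m: "m \<le> n" "is_zero A (ob P m)"
  proof -
    have "infinite {..n}" by (rule infinite_Iic)
    then have "\<not> {..n} \<subseteq> {i. \<not> is_zero A (ob P i)}" using fin finite_subset by blast
    then show ?thesis using that by auto
  qed
  have "k \<le> n \<longrightarrow> projective A (Dom A (cycles A P k))" if "m \<le> k" for k
    using that
  proof (induction k rule: int_ge_induct)
    case base
    show ?case using zero_projective[OF cycles_zero[OF X m(2)]] by simp
  next
    case (step k)
    show ?case
    proof
      assume k: "k + 1 \<le> n"
      then have pk: "projective A (Dom A (cycles A P k))" using step by simp
      let ?b = "bdry A P k" and ?Z = "Dom A (cycles A P k)" and ?z = "cycles A P (k + 1)"
      note b = bdry_simps[OF X, of k]
      have "boundary P k (cycles A P k)"
        using a[of k] k pk cycle_cycles[OF X] by (simp add: acyclic_at_def)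
      then obtain s where s: "s \<in> Arr A" "Dom A s = ?Z" "Cod A s = ob P (k + 1)"
          "df P (k + 1) \<cdot> s = cycles A P k"
        unfolding boundary_def by blast
      have bs: "?b \<cdot> s = Idn A ?Z"
        by (rule cycles_cancel[OF X]) (use comp_assoc_eq[OF b(4), of s] b s X in simp_all)
      \<comment> \<open>The projector onto the cycles along the section \<open>s\<close>; its values are cycles, which gives the retraction \<open>r\<close>.\<close>
      let ?e = "Idn A (ob P (k + 1)) \<boxplus> Neg A (s \<cdot> ?b)"
      have e: "?e \<in> Arr A" "Dom A ?e = ob P (k + 1)" "Cod A ?e = ob P (k + 1)"
        using s b X by simp_all
      have "df P (k + 1) \<cdot> ?e = Zer A (ob P (k + 1)) (ob P k)"
        using comp_assoc_eq[OF s(4), of ?b] s b X by simp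
      then have "cycle P (k + 1) ?e" using e by (simp add: cycle_def)
      then obtain r where r: "r \<in> Arr A" "Dom A r = ob P (k + 1)" "Cod A r = Dom A ?z" "?e = ?z \<cdot> r"
        using e by (elim cycleE[OF X]) simp
      have bz: "?b \<cdot> ?z = Zer A (Dom A ?z) ?Z"
        using bdry_comp_zero[OF X, of ?z k] X by simp
      have "r \<cdot> ?z = Idn A (Dom A ?z)"
      proof (rule cycles_cancel[OF X])
        have "?z \<cdot> (r \<cdot> ?z) = ?e \<cdot> ?z"
          by (rule comp_assoc_eq[OF r(4)[symmetric]]) (use r X in simp_all)
        also have "\<dots> = ?z" using s b bz X by simp
        finally show "?z \<cdot> (r \<cdot> ?z) = ?z \<cdot> Idn A (Dom A ?z)" using X by simp
      qed (use r X in simp_all)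
      then show "projective A (Dom A ?z)"
        using projective_retract[OF pr[of "k + 1"], of ?z "Dom A ?z" r] r X by simp
    qed
  qed
  then show ?thesis using m by simp
qed

lemma trunc_bounded_proj:
  assumes P: "bounded_proj_cx A P" and a: "\<And>j. j < n \<Longrightarrow> acyclic_at P j"
  shows "bounded_proj_cx A (trunc n P)"
  unfolding bounded_proj_cx_def
proof (intro conjI allI)
  have X: "is_complex A P" and fin: "finite {i. \<not> is_zero A (ob P i)}"
    and pr: "\<And>i. projective A (ob P i)"
    using P by (auto simp: bounded_proj_cx_def)
  show "is_complex A (trunc n P)" by (rule trunc_complex[OF X])
  show "finite {i. \<not> is_zero A (ob (trunc n P) i)}"
    by (rule finite_subset[OF _ fin]) (use trunc_ob_zero[OF X] in auto)
  fix i
  show "projective A (ob (trunc n P) i)"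
    using pr projective_cycles[OF P a] zero_projective[OF zero_ob_zero]
    by (cases i n rule: linorder_cases) (auto simp: trunc_ob)
qed

lemma trunc_homol:
  "\<lbrakk>is_complex A X; n \<le> i\<rbrakk> \<Longrightarrow> isomorphic A (homol A (trunc n X) i) (homol A X i)"
  by (rule homol_isomorphicI[OF trunc_inc_chain_map trunc_inc_hinj trunc_inc_hsurj])

end


section \<open>Resolutions and filtrations\<close>

context abelian_enough_projectives
begin

lemma Der_isomorphic_refl: "is_complex A X \<Longrightarrow> isomorphic (Der A) X X"
  unfolding Der_def isomorphic_def
  using Ch.zclass_Hom[of "quasi_isos A" X "[]" X] Ch.localization_iso_idn[of X "quasi_isos A"] by auto

text \<open>The standard triangle of a chain map is distinguished with identities as comparison isomorphisms. What
  has to be checked is that the shift of an identity in the derived category is an identity.\<close>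

lemma cone_is_cone:
  assumes f: "is_chain_map A (X, Y, f)"
  shows "is_cone A (Der_of A (X, Y, f)) (cone A (X, Y, f))"
proof -
  let ?W = "quasi_isos A" and ?C = "cone A (X, Y, f)"
  define g where "g = snd (snd (cone_in A (X, Y, f)))"
  define h where "h = snd (snd (cone_out A (X, Y, f)))"
  have gh: "cone_in A (X, Y, f) = (Y, ?C, g)" "cone_out A (X, Y, f) = (?C, shift A 1 X, h)"
    by (simp_all add: g_def h_def cone_in_def cone_out_def)
  have g: "is_chain_map A (Y, ?C, g)" and h: "is_chain_map A (?C, shift A 1 X, h)"
    using cone_in_chain_map[OF f] cone_out_chain_map[OF f] gh by simp_all
  note O = chain_mapD(1,2)[OF f] chain_mapD(2)[OF g] chain_mapD(2)[OF h]
  let ?id = "\<lambda>X. Ch.zclass ?W X [] X"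
  have z: "zigzag (Ch A) ?W X [Fwd (X, Y, f)] Y" "zigzag (Ch A) ?W Y [Fwd (Y, ?C, g)] ?C"
    "zigzag (Ch A) ?W ?C [Fwd (?C, shift A 1 X, h)] (shift A 1 X)"
    using f g h O by simp_all
  have zi: "zigzag (Ch A) ?W X [] X" "zigzag (Ch A) ?W Y [] Y" "zigzag (Ch A) ?W ?C [] ?C"
    "zigzag (Ch A) ?W (shift A 1 X) [] (shift A 1 X)"
    using O by simp_all
  have D: "Der_of A (X, Y, f) = Ch.zclass ?W X [Fwd (X, Y, f)] Y"
    "Der_of A (Y, ?C, g) = Ch.zclass ?W Y [Fwd (Y, ?C, g)] ?C"
    "Der_of A (?C, shift A 1 X, h) = Ch.zclass ?W ?C [Fwd (?C, shift A 1 X, h)] (shift A 1 X)"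
    by (simp_all add: Der_of_def Ch.loc_of_eq)
  have id: "?id V \<in> Hom (Der A) V V \<and> is_iso (Der A) (?id V)" if "is_complex A V" for V
    unfolding Der_def using that Ch.zclass_Hom[of ?W V "[]" V] Ch.localization_iso_idn[of V ?W] by simp
  have comps:
    "?id Y \<cdot>\<^bsub>Der A\<^esub> Der_of A (X, Y, f) = Der_of A (X, Y, f) \<cdot>\<^bsub>Der A\<^esub> ?id X"
    "?id ?C \<cdot>\<^bsub>Der A\<^esub> Der_of A (Y, ?C, g) = Der_of A (Y, ?C, g) \<cdot>\<^bsub>Der A\<^esub> ?id Y"
    "?id (shift A 1 X) \<cdot>\<^bsub>Der A\<^esub> Der_of A (?C, shift A 1 X, h) =
      Der_of A (?C, shift A 1 X, h) \<cdot>\<^bsub>Der A\<^esub> ?id ?C"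
    unfolding D Der_def Ch.zclass_comp[OF z(1) zi(2)] Ch.zclass_comp[OF zi(1) z(1)]
      Ch.zclass_comp[OF z(2) zi(3)] Ch.zclass_comp[OF zi(2) z(2)]
      Ch.zclass_comp[OF z(3) zi(4)] Ch.zclass_comp[OF zi(3) z(3)] by simp_all
  have homs: "Der_of A (X, Y, f) \<in> Hom (Der A) X Y" "Der_of A (Y, ?C, g) \<in> Hom (Der A) Y ?C"
    "Der_of A (?C, shift A 1 X, h) \<in> Hom (Der A) ?C (shift A 1 X)"
    unfolding D unfolding Der_def by (intro Ch.zclass_Hom z)+
  have "distinguished A (Der_of A (X, Y, f)) (Der_of A (Y, ?C, g)) (Der_of A (?C, shift A 1 X, h))"
    unfolding distinguished_def
    by (rule exI[of _ X], rule exI[of _ Y], rule exI[of _ ?C], intro conjI homs,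
        rule exI[of _ X], rule exI[of _ Y], rule exI[of _ "(X, Y, f)"],
        rule bexI[of _ "?id X"], rule bexI[of _ "?id Y"], rule bexI[of _ "?id ?C"])
      (use id O comps f in \<open>simp_all add: gh Ch_Hom Der_shift_Idn\<close>)
  moreover have "Cod (Der A) (Der_of A (Y, ?C, g)) = ?C" using homs(2) by (simp add: Hom_iff)
  ultimately show ?thesis unfolding is_cone_def by blast
qed

lemma is_coneE:
  assumes "is_cone A u Z" "u \<in> Hom (Der A) X Y"
  obtains X' Y' f where "is_chain_map A (X', Y', f)" "isomorphic (Der A) X X'" "isomorphic (Der A) Y Y'"
    "isomorphic (Der A) Z (cone A (X', Y', f))"
  using assms unfolding is_cone_def distinguished_def isomorphic_def
  by (fastforce simp: Hom_iff Ch_Hom[unfolded Hom_iff])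

lemma homol_isomorphic_dpow_zero:
  "\<lbrakk>is_complex A X; isomorphic A (homol A X j) (dpow A M 0)\<rbrakk> \<Longrightarrow> acyclic_at X j"
  using is_zero_isomorphic[OF isomorphic_sym, of "homol A X j" "zero_ob A"] homol_zero_iff by simp

lemma acyclic_homol_dpow: "\<lbrakk>is_complex A X; acyclic_at X j\<rbrakk> \<Longrightarrow> isomorphic A (homol A X j) (dpow A M 0)"
  using isomorphic_zeros[of "homol A X j" "zero_ob A"] homol_zero_iff by simp

lemma homol_zero_iff_dpow:
  assumes M: "M \<in> Obj A" "\<not> is_zero A M" and h: "isomorphic A (homol A X j) (dpow A M a)"
  shows "is_zero A (homol A X j) \<longleftrightarrow> a = 0"
  using h is_zero_isomorphic isomorphic_sym dpow_zero_iff[OF M] by blast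

lemma hsup_resolution:
  assumes h: "\<And>j. isomorphic A (homol A X j) (dpow A M (a j))" and M: "M \<in> Obj A" "\<not> is_zero A M"
    and t: "a t > 0" "\<And>j. a j \<noteq> 0 \<Longrightarrow> j \<le> t"
  shows "hsup A X = ereal (of_int t)"
  unfolding hsup_def homol_zero_iff_dpow[OF M h]
proof (rule antisym)
  show "(SUP i\<in>{i. a i \<noteq> 0}. ereal (of_int i)) \<le> ereal (of_int t)"
    by (rule SUP_least) (use t in auto)
  show "ereal (of_int t) \<le> (SUP i\<in>{i. a i \<noteq> 0}. ereal (of_int i))"
    by (rule SUP_upper) (use t in auto)
qed

lemma shifted_stalk_homol:
  assumes "M \<in> Obj A"
  shows "isomorphic A (homol A (dpow_cx A (shift A i (stalk A M)) a) j) (dpow A M (if j = i then a else 0))"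
proof -
  let ?N = "dpow_cx A (shift A i (stalk A M)) a"
  note N = shifted_stalk_power[where i=i and a=a, OF assms refl]
  show ?thesis
  proof (cases "j = i")
    case True
    then show ?thesis
      using isomorphic_sym[OF homol_concentrated[OF N(1) N(3) N(3), of i]] N(2) by simp
  next
    case False
    then show ?thesis using acyclic_homol_dpow[OF N(1) acyclic_if_zero_ob[OF N(1) N(3)], of j M] by simp
  qed
qed

text \<open>The truncation at \<open>i + 1\<close> has all the homology of \<open>X\<close> except the lowest, in
  degree \<open>i\<close>. So the cone of its inclusion has homology in degree \<open>i\<close> only,
  and no terms below.\<close>

lemma truncation_cone:
  assumes X: "is_complex A X" "\<And>j. j < i \<Longrightarrow> is_zero A (ob X j)" and M: "M \<in> Obj A"
    and h: "isomorphic A (homol A X i) (dpow A M a)"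
  shows "isomorphic (Der A) (cone A (trunc (i + 1) X, X, trunc_inc (i + 1) X)) (dpow_cx A (shift A i (stalk A M)) a)"
proof -
  let ?T = "trunc (i + 1) X" and ?f = "trunc_inc (i + 1) X"
  let ?C = "cone A (?T, X, ?f)" and ?N = "dpow_cx A (shift A i (stalk A M)) a"
  note f = trunc_inc_chain_map[OF X(1), of "i + 1"]
  note T = trunc_complex[OF X(1), of "i + 1"]
  note N = shifted_stalk_power[where i=i and a=a, OF M refl]
  have Tz: "is_zero A (ob ?T j)" if "j \<le> i" for j using that by (simp add: trunc_ob)
  then have Ta: "acyclic_at ?T j" if "j \<le> i" for j using acyclic_if_zero_ob[OF T] that by blast
  have "is_zero A (ob ?C j)" if "j < i" for j
    unfolding cone_ob[OF f] using X(2) Tz that by (intro dirsum_zero) auto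
  moreover have "acyclic_at ?C j" if "i < j" for j
  proof (rule acyclic_coneI[OF f])
    show "hsurj (?T, X, ?f) j" by (rule trunc_inc_hsurj[OF X(1)]) (use that in simp)
    show "hinj (?T, X, ?f) (j - 1)"
      using trunc_inc_hinj[OF X(1), of "i + 1" "j - 1"] hinj_if_acyclic[OF Ta, of "j - 1"] that by fastforce
  qed
  moreover have "isomorphic A (homol A X i) (homol A ?C i)"
    using homol_isomorphicI[of X ?C _ i] cone_in_chain_map[OF f] cone_in_hinj[OF f Ta] cone_in_hsurj[OF f Ta]
    unfolding cone_in_def prod.case by simp
  then have "isomorphic A (homol A ?C i) (ob ?N i)"
    unfolding N(2) using isomorphic_sym isomorphic_trans h by blast
  ultimately have "\<exists>g. (?C, ?N, g) \<in> quasi_isos A"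
    by (intro quasi_iso_to_concentrated cone_complex[OF f] N(1,3)) 
  then show ?thesis using quasi_iso_Der_isomorphic by blast
qed

lemma Der_zero_if_acyclic:
  assumes X: "is_complex A X" and a: "\<And>j. acyclic_at X j"
  shows "isomorphic (Der A) X (zero_cx A)"
proof -
  let ?f = "\<lambda>i. Zer A (ob X i) (zero_ob A)"
  have f: "is_chain_map A (X, zero_cx A, ?f)"
    by (rule chain_mapI[OF X zero_cx_complex]) (use X in \<open>simp_all add: zero_cx_def\<close>)
  have "acyclic_at (zero_cx A) j" for j
    by (rule acyclic_if_zero_ob[OF zero_cx_complex]) (simp add: zero_cx_def)
  then have "(X, zero_cx A, ?f) \<in> quasi_isos A"
    by (intro quasi_isoI[OF f] hinj_if_acyclic hsurj_if_acyclic[OF f] a)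
  then show ?thesis by (rule quasi_iso_Der_isomorphic)
qed

lemma finite_homol:
  assumes X: "is_complex A X" and fin: "finite {i. \<not> is_zero A (ob X i)}"
  shows "X \<in> Obj (Derb A)"
proof -
  have "{i. \<not> is_zero A (homol A X i)} \<subseteq> {i. \<not> is_zero A (ob X i)}"
    using acyclic_if_zero_ob[OF X] homol_zero_iff[OF X] by blast
  then show ?thesis
    using X fin finite_subset by (auto simp: Derb_def full_subcat_def Der_def)
qed

text \<open>The filtration starts with the truncation of \<open>P\<close> at its lowest homology degree
  \<open>s\<close>, which is still a bounded complex of projectives, and goes on with the truncations at
  \<open>s + 1\<close>, \<open>s + 2\<close>, and so on up to \<open>t + 1\<close>, where no homology is
  left. Each is formed from the preceding one, so that the maps of the filtration are inclusions of
  truncations.\<close>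

lemma resolution_filtration:
  assumes P: "bounded_proj_cx A P" and M: "M \<in> Obj A" "\<not> is_zero A M"
    and h: "\<And>j. isomorphic A (homol A P j) (dpow A M (a j))"
    and st: "s \<le> t" "a s > 0" "a t > 0" "\<And>j. a j \<noteq> 0 \<Longrightarrow> s \<le> j \<and> j \<le> t"
    and n: "\<And>j. n < j \<Longrightarrow> is_zero A (ob P j)"
  shows "\<exists>F \<phi>. qp_filtration A (stalk A M) s t F \<phi> \<and> pd A (F s) \<le> ereal (of_int n)"
proof -
  have X: "is_complex A P" and fin: "finite {i. \<not> is_zero A (ob P i)}"
    using P by (auto simp: bounded_proj_cx_def)
  have acyc: "acyclic_at P j" if "j < s" for j
  proof -
    have "a j = 0" using st(4)[of j] that by linarith
    then show ?thesis using homol_isomorphic_dpow_zero[OF X, of j M] h[of j] by simp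
  qed
  \<comment> \<open>Only indices at least \<open>s\<close> matter; the recursion counts upwards from \<open>s\<close>.\<close>
  define F where "F i = rec_nat (trunc s P) (\<lambda>k Y. trunc (s + int k + 1) Y) (nat (i - s))" for i
  have F0: "F s = trunc s P" by (simp add: F_def)
  have FS: "F (i + 1) = trunc (i + 1) (F i)" if "s \<le> i" for i
  proof -
    have "nat (i + 1 - s) = Suc (nat (i - s))" "s + int (nat (i - s)) + 1 = i + 1" using that by linarith+
    then show ?thesis by (simp add: F_def)
  qed
  have F: "is_complex A (F i) \<and> (\<forall>j < i. is_zero A (ob (F i) j)) \<and> finite {j. \<not> is_zero A (ob (F i) j)} \<and>
      (\<forall>j \<ge> i. isomorphic A (homol A (F i) j) (dpow A M (a j)))" if "s \<le> i" for i
    using that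
  proof (induction i rule: int_ge_induct)
    case base
    have "finite {j. \<not> is_zero A (ob (trunc s P) j)}"
      by (rule finite_subset[OF _ fin]) (use trunc_ob_zero[OF X] in auto)
    then show ?case
      unfolding F0 using trunc_complex[OF X] isomorphic_trans[OF trunc_homol[OF X] h] by (auto simp: trunc_ob)
  next
    case (step i)
    then have Xi: "is_complex A (F i)" by blast
    have "finite {j. \<not> is_zero A (ob (trunc (i + 1) (F i)) j)}"
      by (rule finite_subset[of _ "{j. \<not> is_zero A (ob (F i) j)}"]) (use trunc_ob_zero[OF Xi] step in auto)
    moreover have "isomorphic A (homol A (trunc (i + 1) (F i)) j) (dpow A M (a j))" if "i + 1 \<le> j" for j
      using isomorphic_trans[OF trunc_homol[OF Xi that]] step that by simp
    ultimately show ?case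
      unfolding FS[OF step(1)] using trunc_complex[OF Xi] by (auto simp: trunc_ob)
  qed
  define \<phi> where "\<phi> i = Der_of A (trunc (i + 1) (F i), F i, trunc_inc (i + 1) (F i))" for i
  have cm: "is_chain_map A (trunc (i + 1) (F i), F i, trunc_inc (i + 1) (F i))" if "s \<le> i" for i
    using trunc_inc_chain_map F[OF that] by blast
  have Fb: "F i \<in> Obj (Derb A)" if "s \<le> i" for i using finite_homol F[OF that] by blast
  have \<phi>: "\<phi> i \<in> Hom (Derb A) (F (i + 1)) (F i)" if "s \<le> i" for i
  proof -
    have "\<phi> i \<in> Hom (Der A) (F (i + 1)) (F i)"
      unfolding \<phi>_def Der_of_def Der_def FS[OF that]
      using Ch.loc_of_Hom[of _ "trunc (i + 1) (F i)" "F i"] cm[OF that] by (simp add: Ch_Hom)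
    then show ?thesis
      using Fb[OF that] Fb[of "i + 1"] that unfolding Derb_def full_subcat_def by (auto simp: Hom_iff)
  qed
  have pdP: "pd A (F s) \<le> ereal (of_int n)"
    unfolding pd_def
  proof (rule Inf_lower, rule imageI, rule CollectI, intro exI[of _ "F s"] conjI allI impI)
    show "bounded_proj_cx A (F s)" unfolding F0 by (rule trunc_bounded_proj[OF P acyc])
    show "isomorphic (Der A) (F s) (F s)" using Der_isomorphic_refl F by blast
    fix j assume "n < j" then show "is_zero A (ob (F s) j)"
      unfolding F0 using trunc_ob_zero[OF X] n by blast
  qed
  have "\<not> isomorphic (Der A) (F s) (zero_cx A)"
  proof
    assume "isomorphic (Der A) (F s) (zero_cx A)"
    from Der_isomorphic_homol[OF this, of s]
    have "isomorphic A (dpow A M (a s)) (homol A (zero_cx A) s)"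
      using F[of s] isomorphic_trans isomorphic_sym by blast
    moreover have "is_zero A (homol A (zero_cx A) s)"
      unfolding homol_zero_iff[OF zero_cx_complex]
      by (rule acyclic_if_zero_ob[OF zero_cx_complex]) (simp add: zero_cx_def)
    ultimately have "is_zero A (dpow A M (a s))" using is_zero_isomorphic isomorphic_sym by blast
    then show False using dpow_zero_iff[OF M] st(2) by simp
  qed
  moreover have "isomorphic (Der A) (F (t + 1)) (zero_cx A)"
  proof (rule Der_zero_if_acyclic)
    have Ft: "is_complex A (F (t + 1))" using F[of "t + 1"] st by simp
    then show "is_complex A (F (t + 1))" .
    fix j
    show "acyclic_at (F (t + 1)) j"
    proof (cases "j < t + 1")
      case True
      then show ?thesis using acyclic_if_zero_ob[OF Ft] F[of "t + 1"] st(1) by simp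
    next
      case False
      then have "a j = 0" using st(4)[of j] by linarith
      moreover have "isomorphic A (homol A (F (t + 1)) j) (dpow A M (a j))"
        using F[of "t + 1"] False st(1) by simp
      ultimately show ?thesis using homol_isomorphic_dpow_zero[OF Ft, of j M] by simp
    qed
  qed
  moreover have "\<exists>Z. is_cone A (\<phi> i) Z \<and> isomorphic (Der A) Z (dpow_cx A (shift A i (stalk A M)) (a i))"
    if "s \<le> i" for i
    using cone_is_cone[OF cm[OF that]] truncation_cone[of "F i" i M "a i"] F[OF that] M(1)
    unfolding \<phi>_def by blast
  moreover have "pd A (F s) < \<infinity>" using pdP by (cases "pd A (F s)") auto
  ultimately have "qp_filtration A (stalk A M) s t F \<phi>"
    unfolding qp_filtration_def using st Fb \<phi>
    by (intro conjI ballI exI[of _ a]) auto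
  then show ?thesis using pdP by blast
qed

text \<open>The step at \<open>i\<close> adds the power with exponent \<open>a i\<close> as homology in degree
  \<open>i\<close>, strictly below the homology collected so far; no connecting map can be non-zero.
  Outside the interval from \<open>s\<close> to \<open>t\<close> the exponent zero makes the statement
  uniform.\<close>

lemma filtration_homol:
  assumes filt: "qp_filtration A (stalk A M) s t F \<phi>" and M: "M \<in> Obj A"
  obtains a where "a s > (0::nat)" "a t > 0" "\<And>j. a j \<noteq> 0 \<Longrightarrow> s \<le> j \<and> j \<le> t"
    "\<And>j. isomorphic A (homol A (F s) j) (dpow A M (a j))"
proof -
  obtain a where st: "s \<le> t" and a: "a s > (0::nat)" "a t > 0"
    and cones: "\<And>i. \<lbrakk>s \<le> i; i \<le> t\<rbrakk> \<Longrightarrow>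
      \<exists>Z. is_cone A (\<phi> i) Z \<and> isomorphic (Der A) Z (dpow_cx A (shift A i (stalk A M)) (a i))"
    using filt unfolding qp_filtration_def by auto
  have \<phi>: "\<phi> i \<in> Hom (Der A) (F (i + 1)) (F i)" if "s \<le> i" "i \<le> t" for i
    using filt that unfolding qp_filtration_def Derb_def full_subcat_def by (auto simp: Hom_iff)
  have end0: "isomorphic (Der A) (F (t + 1)) (zero_cx A)"
    using filt unfolding qp_filtration_def by blast
  \<comment> \<open>The exponents of the homology of \<open>F i\<close>.\<close>
  define b where "b i j = (if i \<le> j \<and> j \<le> t then a j else 0)" for i j
  have main: "s \<le> i \<longrightarrow> (\<forall>j. isomorphic A (homol A (F i) j) (dpow A M (b i j)))" if "i \<le> t + 1" for i
    using that
  proof (induction i rule: int_le_induct)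
    case base
    have "acyclic_at (zero_cx A) j" for j
      by (rule acyclic_if_zero_ob[OF zero_cx_complex]) (simp add: zero_cx_def)
    then have "isomorphic A (homol A (zero_cx A) j) (dpow A M (b (t + 1) j))" for j
      using acyclic_homol_dpow[OF zero_cx_complex, of j M] by (cases "t + 1 \<le> j") (simp_all add: b_def)
    then show ?case using isomorphic_trans[OF Der_isomorphic_homol[OF end0]] by blast
  next
    case (step k)
    show ?case
    proof (intro impI allI)
      fix j
      define i where "i = k - 1"
      assume "s \<le> k - 1"
      then have i: "s \<le> i" "i \<le> t" "k = i + 1" using step by (auto simp: i_def)
      obtain Z where Z: "is_cone A (\<phi> i) Z" "isomorphic (Der A) Z (dpow_cx A (shift A i (stalk A M)) (a i))"
        using cones[OF i(1,2)] by blast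
      \<comment> \<open>The morphism \<open>\<phi> i\<close> of the derived category is replaced by an honest chain map, as only isomorphism classes of homology count.\<close>
      obtain X Y f where f: "is_chain_map A (X, Y, f)" and
        iso: "isomorphic (Der A) (F (i + 1)) X" "isomorphic (Der A) (F i) Y" "isomorphic (Der A) Z (cone A (X, Y, f))"
        by (rule is_coneE[OF Z(1) \<phi>[OF i(1,2)]])
      note XY = chain_mapD(1,2)[OF f]
      let ?C = "cone A (X, Y, f)"
      note C = cone_complex[OF f]
      have hX: "isomorphic A (homol A X l) (dpow A M (b (i + 1) l))" for l
        using step i isomorphic_trans[OF isomorphic_sym[OF Der_isomorphic_homol[OF iso(1)]]] by simp
      have hC: "isomorphic A (homol A ?C l) (dpow A M (if l = i then a i else 0))" for l
        using isomorphic_trans[OF isomorphic_sym[OF Der_isomorphic_homol[OF iso(3), of l]]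
            isomorphic_trans[OF Der_isomorphic_homol[OF Z(2), of l] shifted_stalk_homol[OF M]]] .
      have aX: "acyclic_at X l" if "l \<le> i" for l
        using hX[of l] that homol_isomorphic_dpow_zero[OF XY(1), of l M] by (simp add: b_def)
      have aC: "acyclic_at ?C l" if "l \<noteq> i" for l
        using hC[of l] that homol_isomorphic_dpow_zero[OF C, of l M] by simp
      have "isomorphic A (homol A Y j) (dpow A M (b i j))"
      proof (cases j i rule: linorder_cases)
        case less
        have "acyclic_at Y j"
          by (rule acyclic_target[OF f aX hsurj_if_acyclic_cone[OF f aC]]) (use less in simp_all)
        then show ?thesis using acyclic_homol_dpow[OF XY(2), of j M] less by (simp add: b_def)
      next
        case equal
        have "isomorphic A (homol A Y i) (homol A ?C i)"
          using homol_isomorphicI[of Y ?C _ i] cone_in_chain_map[OF f] cone_in_hinj[OF f aX] cone_in_hsurj[OF f aX]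
          unfolding cone_in_def prod.case by simp
        from isomorphic_trans[OF this hC] show ?thesis using equal i by (simp add: b_def)
      next
        case greater
        have "isomorphic A (homol A X j) (homol A Y j)"
          by (rule homol_isomorphicI[OF f hinj_if_acyclic_cone[OF f aC] hsurj_if_acyclic_cone[OF f aC]])
            (use greater in simp_all)
        from isomorphic_trans[OF isomorphic_sym[OF this] hX] show ?thesis using greater by (simp add: b_def)
      qed
      then show "isomorphic A (homol A (F (k - 1)) j) (dpow A M (b (k - 1) j))"
        unfolding i_def[symmetric] by (rule isomorphic_trans[OF Der_isomorphic_homol[OF iso(2)]])
    qed
  qed
  show ?thesis
  proof (rule that[of "b s"])
    show "b s s > 0" "b s t > 0" using a st by (simp_all add: b_def)
    show "\<And>j. b s j \<noteq> 0 \<Longrightarrow> s \<le> j \<and> j \<le> t" by (auto simp: b_def split: if_splits)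
    show "\<And>j. isomorphic A (homol A (F s) j) (dpow A M (b s j))" using main[of s] st by simp
  qed
qed

text \<open>A bounded projective model \<open>P\<close> of \<open>F s\<close> has the right homology, but may have
  terms below degree \<open>s\<close>, which would make its length too large. Truncation at
  \<open>s\<close> removes them and keeps projectivity.\<close>

lemma filtration_resolution:
  assumes filt: "qp_filtration A (stalk A M) s t F \<phi>" and M: "M \<in> Obj A" "\<not> is_zero A M"
    and P: "bounded_proj_cx A P" "isomorphic (Der A) (F s) P" "\<And>j. n < j \<Longrightarrow> is_zero A (ob P j)"
  obtains Q where "qp_resolution A M Q" "csup A Q \<le> ereal (of_int n)" "hsup A Q = ereal (of_int t)"
    "cinf A Q \<ge> ereal (of_int s)"
proof -
  have st: "s \<le> t" using filt by (simp add: qp_filtration_def)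
  obtain a where a: "a s > (0::nat)" "a t > 0" "\<And>j. a j \<noteq> 0 \<Longrightarrow> s \<le> j \<and> j \<le> t"
    "\<And>j. isomorphic A (homol A (F s) j) (dpow A M (a j))"
    using filtration_homol[OF filt M(1)] by blast
  have X: "is_complex A P" using P(1) by (simp add: bounded_proj_cx_def)
  have hP: "isomorphic A (homol A P j) (dpow A M (a j))" for j
    using isomorphic_trans[OF isomorphic_sym[OF Der_isomorphic_homol[OF P(2)]] a(4)] .
  have acyc: "acyclic_at P j" if "j < s" for j
  proof -
    have "a j = 0" using a(3)[of j] that by linarith
    then show ?thesis using homol_isomorphic_dpow_zero[OF X, of j M] hP[of j] by simp
  qed
  let ?Q = "trunc s P"
  note Q = trunc_complex[OF X, of s]
  have hQ: "isomorphic A (homol A ?Q j) (dpow A M (a j))" for j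
  proof (cases "j < s")
    case True
    then have "a j = 0" using a(3)[of j] by linarith
    moreover have "acyclic_at ?Q j" by (rule acyclic_if_zero_ob[OF Q]) (use True in \<open>simp add: trunc_ob\<close>)
    ultimately show ?thesis using acyclic_homol_dpow[OF Q, of j M] by simp
  next
    case False
    then show ?thesis using isomorphic_trans[OF trunc_homol[OF X] hP] by simp
  qed
  have res: "qp_resolution A M ?Q"
    unfolding qp_resolution_def using trunc_bounded_proj[OF P(1) acyc] hQ a(1)
    by (intro conjI exI[of _ a]) auto
  have sup: "csup A ?Q \<le> ereal (of_int n)"
    unfolding csup_def
  proof (rule SUP_least)
    fix i assume "i \<in> {i. \<not> is_zero A (ob ?Q i)}"
    then have "\<not> n < i" using trunc_ob_zero[OF X, of i s] P(3)[of i] by blast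
    then show "ereal (of_int i) \<le> ereal (of_int n)" by simp
  qed
  have inf: "cinf A ?Q \<ge> ereal (of_int s)"
    unfolding cinf_def
  proof (rule INF_greatest)
    fix i assume "i \<in> {i. \<not> is_zero A (ob ?Q i)}"
    then have "\<not> i < s" by (auto simp: trunc_ob)
    then show "ereal (of_int s) \<le> ereal (of_int i)" by simp
  qed
  show ?thesis using that[OF res sup hsup_resolution[OF hQ M a(2) conjunct2[OF a(3)]] inf] .
qed

lemma qp_filt_le_resolution:
  assumes P: "qp_resolution A M P" and M: "M \<in> Obj A" "\<not> is_zero A M"
  shows "qpd_filt A (stalk A M) \<le> csup A P - hsup A P" "qpl_filt A (stalk A M) \<le> csup A P - cinf A P"
proof -
  obtain a where P': "bounded_proj_cx A P" and h: "\<And>j. isomorphic A (homol A P j) (dpow A M (a j))"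
    and ne: "{j. a j \<noteq> 0} \<noteq> {}"
    using P unfolding qp_resolution_def by auto
  have X: "is_complex A P" and fin: "finite {i. \<not> is_zero A (ob P i)}"
    using P' by (auto simp: bounded_proj_cx_def)
  have sub: "\<not> is_zero A (ob P j)" if "a j \<noteq> 0" for j
    using that homol_zero_iff_dpow[OF M h[of j]] homol_zero_iff[OF X, of j] acyclic_if_zero_ob[OF X, of j] by (intro notI) simp
  then have fina: "finite {j. a j \<noteq> 0}" using finite_subset[OF _ fin, of "{j. a j \<noteq> 0}"] by blast
  define s t n where "s = Min {j. a j \<noteq> 0}" and "t = Max {j. a j \<noteq> 0}"
    and "n = Max {i. \<not> is_zero A (ob P i)}"
  have s: "a s > 0" "\<And>j. a j \<noteq> 0 \<Longrightarrow> s \<le> j" and t: "a t > 0" "\<And>j. a j \<noteq> 0 \<Longrightarrow> j \<le> t"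
    using Min_in[OF fina ne] Max_in[OF fina ne] Min_le[OF fina] Max_ge[OF fina] by (auto simp: s_def t_def)
  have nz: "\<not> is_zero A (ob P n)" "\<And>j. n < j \<Longrightarrow> is_zero A (ob P j)"
    using Max_in[OF fin] Max_ge[OF fin] sub s(1) unfolding n_def by (blast, fastforce)
  have n: "ereal (of_int n) \<le> csup A P" unfolding csup_def by (rule SUP_upper) (use nz in simp)
  have c: "cinf A P \<le> ereal (of_int s)" unfolding cinf_def by (rule INF_lower) (use sub s in simp)
  obtain F \<phi> where F: "qp_filtration A (stalk A M) s t F \<phi>" "pd A (F s) \<le> ereal (of_int n)"
    using resolution_filtration[OF P' M h, of s t n] s t nz by blast
  have hs: "hsup A P = ereal (of_int t)" by (rule hsup_resolution[of P M a, OF h M t])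
  have "qpd_filt A (stalk A M) \<le> pd A (F s) - ereal (of_int t)"
    unfolding qpd_filt_def by (rule Inf_lower) (use F in blast)
  also have "\<dots> \<le> csup A P - hsup A P"
    by (rule ereal_minus_mono[OF order_trans[OF F(2) n]]) (simp add: hs)
  finally show "qpd_filt A (stalk A M) \<le> csup A P - hsup A P" .
  have "qpl_filt A (stalk A M) \<le> pd A (F s) - ereal (of_int s)"
    unfolding qpl_filt_def by (rule Inf_lower) (use F in blast)
  also have "\<dots> \<le> csup A P - cinf A P" by (rule ereal_minus_mono[OF order_trans[OF F(2) n] c])
  finally show "qpl_filt A (stalk A M) \<le> csup A P - cinf A P" .
qed

text \<open>The bound is obtained for every integer that occurs in the definition of the projective dimension, and
  then passes to the infimum.\<close>

lemma qp_res_le_filtration: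
  assumes filt: "qp_filtration A (stalk A M) s t F \<phi>" and M: "M \<in> Obj A" "\<not> is_zero A M"
  shows "qpd_res A M \<le> pd A (F s) - ereal (of_int t)" "qpl_res A M \<le> pd A (F s) - ereal (of_int s)"
proof -
  have *: "qpd_res A M + ereal (of_int t) \<le> ereal (of_int n) \<and> qpl_res A M + ereal (of_int s) \<le> ereal (of_int n)"
    if P: "bounded_proj_cx A P" "isomorphic (Der A) (F s) P" "\<forall>i > n. is_zero A (ob P i)" for n P
  proof -
    obtain Q where Q: "qp_resolution A M Q" "csup A Q \<le> ereal (of_int n)" "hsup A Q = ereal (of_int t)"
        "cinf A Q \<ge> ereal (of_int s)"
      using filtration_resolution[OF filt M P(1,2), of n] P(3) by blast
    have "qpd_res A M \<le> csup A Q - hsup A Q" "qpl_res A M \<le> csup A Q - cinf A Q"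
      unfolding qpd_res_def qpl_res_def by (rule Inf_lower; use Q in blast)+
    moreover have "csup A Q - hsup A Q \<le> ereal (of_int n) - ereal (of_int t)"
      "csup A Q - cinf A Q \<le> ereal (of_int n) - ereal (of_int s)"
      by (rule ereal_minus_mono; use Q in simp)+
    ultimately have "qpd_res A M \<le> ereal (of_int n) - ereal (of_int t)"
      "qpl_res A M \<le> ereal (of_int n) - ereal (of_int s)"
      using order_trans by blast+
    then show ?thesis
      using ereal_le_minus[where z = "ereal (of_int n)" and y = "ereal (of_int t)" and x = "qpd_res A M"]
        ereal_le_minus[where z = "ereal (of_int n)" and y = "ereal (of_int s)" and x = "qpl_res A M"]
      by simp
  qed
  have "qpd_res A M + ereal (of_int t) \<le> pd A (F s)" "qpl_res A M + ereal (of_int s) \<le> pd A (F s)"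
    unfolding pd_def using * by (intro INF_greatest; blast)+
  then show "qpd_res A M \<le> pd A (F s) - ereal (of_int t)" "qpl_res A M \<le> pd A (F s) - ereal (of_int s)"
    by (simp_all add: ereal_le_minus)
qed

end

theorem proposition3p4:
  fixes A :: "('o, 'm) addcat" and M :: 'o
  assumes "abelian_category A"
    and "enough_projectives A"
    and "M \<in> Obj A"
    and "\<not> is_zero A M"
  shows "qpd_res A M = qpd_filt A (stalk A M) \<and> qpl_res A M = qpl_filt A (stalk A M)"
proof -
  interpret abelian_category A by fact
  interpret abelian_enough_projectives A by unfold_locales fact
  note M = assms(3,4)
  show ?thesis
  proof (intro conjI antisym)
    show "qpd_res A M \<le> qpd_filt A (stalk A M)" "qpl_res A M \<le> qpl_filt A (stalk A M)"
      unfolding qpd_filt_def qpl_filt_def by (rule Inf_greatest; use qp_res_le_filtration[OF _ M] in blast)+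
    show "qpd_filt A (stalk A M) \<le> qpd_res A M" "qpl_filt A (stalk A M) \<le> qpl_res A M"
      unfolding qpd_res_def qpl_res_def by (rule Inf_greatest; use qp_filt_le_resolution[OF _ M] in blast)+
  qed
qed

end
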